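(* For all $k\in\mathcal{M}(W)$, there is a natural isomorphism of graded algebras $$H^{\rm ev}[\,Q^*_k(W)\,]\;\cong\;Q_k(W),$$ where $Q_k(W)$ is equipped with the cohomological grading. The odd cohomology is given by $$H^{\rm odd}[\,Q^*_k(W)\,]\;\cong\;\bigl(\mathbf{k}[V]^{\mathcal{A}}/S_k(\mathcal{A})\bigr)[-1],$$ where $S_k(\mathcal{A})\subseteq\mathbf{k}[V]^{\mathcal{A}}=\bigoplus_{\alpha\in\mathcal{A}}\mathbf{k}[V]$ is the linear subspace spanned by the tuples $(f_\alpha-f)_{\alpha\in\mathcal{A}}$ with $f_\alpha\in Q_{k_\alpha}$ and $f\in\mathbf{k}[V]$; in particular $H^{\rm odd}[\,Q^*_k(W)\,]\neq0$ in general (i.e. there are $W$ and $k$ for which it is nonzero).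
   Context: Let $\mathbf{k}$ be a field of characteristic zero, $W$ a finite Coxeter group and $V$ a finite-dimensional $\mathbf{k}$-vector space carrying a reflection representation of $W$. Let $\mathcal{A}$ be the set of reflection hyperplanes; for each fix a linear form $\alpha\in V^*$ with $H_\alpha=\mathrm{Ker}(\alpha)$ (we write $\alpha\in\mathcal{A}$), let $s_\alpha$ be the corresponding reflection and $W_\alpha=\{1,s_\alpha\}$. $\mathcal{M}(W)$ is the set of $W$-invariant functions $k:\mathcal{A}\to\mathbb{Z}_{\ge0}$. $\mathbf{k}[V]$ is graded with $V^*$ in cohomological degree $2$ and zero differential. $Q_k(W)=\{p\in\mathbf{k}[V]: s_\alpha(p)\equiv p\bmod\langle\alpha\rangle^{2k_\alpha}\ \forall\alpha\in\mathcal{A}\}$ and $Q_{k_\alpha}=Q_{k_\alpha}(W_\alpha)=\{f\in\mathbf{k}[V]: s_\alpha(f)\equiv f\bmod\langle\alpha\rangle^{2k_\alpha}\}$ are graded subalgebras. Let $\Omega^*_{\mathbf{k}}(\mathcal{A})=\mathbf{k}[\{x_\alpha\}]\otimes\Lambda_{\mathbf{k}}(\{dx_\alpha\})/(\sum_{\alpha}x_\alpha-1,\ \sum_\alpha dx_\alpha)$ ($\alpha\in\mathcal{A}$, $\deg x_\alpha=0$, $\deg dx_\alpha=1$, $d(x_\alpha)=dx_\alpha$) be the de Rham algebra of the algebraic simplex with vertex set $\mathcal{A}$. Evaluations $\mathrm{ev}_\alpha:\Omega^*_{\mathbf{k}}(\mathcal{A})\to\mathbf{k}$ at the vertices $x_\alpha=1$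 give a dg algebra map $p:\mathbf{k}[V]\otimes\Omega^*_{\mathbf{k}}(\mathcal{A})\to\mathbf{k}[V]^{\mathcal{A}}$. The commutative cochain dg algebra $Q^*_k(W)$ is the fibre product $$Q^*_k(W):=\Bigl(\prod_{\alpha\in\mathcal{A}}Q_{k_\alpha}\Bigr)\times_{\mathbf{k}[V]^{\mathcal{A}}}\bigl(\mathbf{k}[V]\otimes\Omega^*_{\mathbf{k}}(\mathcal{A})\bigr)$$ of the product of the inclusions $Q_{k_\alpha}\hookrightarrow\mathbf{k}[V]$ and of $p$. $H^{\rm ev}$ and $H^{\rm odd}$ denote the even- and odd-degree parts of cohomology; $[-1]$ denotes the shift raising cohomological degree by one. *)

theory Defs
  imports
    "HOL-Algebra.Algebra"
    "HOL-Analysis.Cartesian_Space"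
    "HOL-Library.Function_Algebras"
    "HOL-Library.Poly_Mapping"
begin

text \<open>
  Functions form a commutative ring under the pointwise operations of
  \<open>Function_Algebras\<close>; \<open>\<^bold>k[V]\<close> is the subring of polynomial functions on \<open>V\<close> (the field is
  infinite, so polynomials and polynomial functions are the same thing).
  Rings and quotients are those of \<open>HOL-Algebra\<close>. A \<open>\<^bold>k\<close>-algebra or a \<open>\<^bold>k\<close>-vector space is a
  record of type \<open>('k, 'a) module\<close>, where \<open>'k\<close> is a field type.
\<close>


subsection \<open>Algebras, quotients, fibre products, cohomology\<close>

definition alg_quot :: "('k, 'a) module \<Rightarrow> 'a set \<Rightarrow> ('k, 'a set) module" where
  "alg_quot M I = \<lparr>carrier = carrier (M Quot I), monoid.mult = monoid.mult (M Quot I),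
     monoid.one = monoid.one (M Quot I),
     ring.zero = ring.zero (M Quot I), ring.add = ring.add (M Quot I),
     smult = (\<lambda>c C. \<Union>x\<in>C. I +>\<^bsub>M\<^esub> (c \<odot>\<^bsub>M\<^esub> x))\<rparr>"

definition fibre_product ::
    "('k, 'a) module \<Rightarrow> ('k, 'b) module \<Rightarrow> ('a \<Rightarrow> 'c) \<Rightarrow> ('b \<Rightarrow> 'c) \<Rightarrow> ('k, 'a \<times> 'b) module" where
  "fibre_product M N f g =
    \<lparr>carrier = {(x, y). x \<in> carrier M \<and> y \<in> carrier N \<and> f x = g y},
     monoid.mult = (\<lambda>(x, y) (x', y'). (x \<otimes>\<^bsub>M\<^esub> x', y \<otimes>\<^bsub>N\<^esub> y')),
     monoid.one = (\<one>\<^bsub>M\<^esub>, \<one>\<^bsub>N\<^esub>),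
     ring.zero = (\<zero>\<^bsub>M\<^esub>, \<zero>\<^bsub>N\<^esub>),
     ring.add = (\<lambda>(x, y) (x', y'). (x \<oplus>\<^bsub>M\<^esub> x', y \<oplus>\<^bsub>N\<^esub> y')),
     smult = (\<lambda>c (x, y). (c \<odot>\<^bsub>M\<^esub> x, c \<odot>\<^bsub>N\<^esub> y))\<rparr>"

definition cocycles :: "('k, 'a) module \<Rightarrow> ('a \<Rightarrow> 'a) \<Rightarrow> 'a set" where
  "cocycles M \<delta> = {x \<in> carrier M. \<delta> x = \<zero>\<^bsub>M\<^esub>}"

definition coboundaries :: "('k, 'a) module \<Rightarrow> ('a \<Rightarrow> 'a) \<Rightarrow> 'a set" where
  "coboundaries M \<delta> = \<delta> ` carrier M"

definition cohomology :: "('k, 'a) module \<Rightarrow> ('a \<Rightarrow> 'a) \<Rightarrow> ('k, 'a set) module" where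
  "cohomology M \<delta> = alg_quot (M\<lparr>carrier := cocycles M \<delta>\<rparr>) (coboundaries M \<delta>)"

definition cohomology_class :: "('k, 'a) module \<Rightarrow> ('a \<Rightarrow> 'a) \<Rightarrow> 'a \<Rightarrow> 'a set" where
  "cohomology_class M \<delta> z = coboundaries M \<delta> +>\<^bsub>M\<^esub> z"

text \<open>Below, \<open>gr n\<close> is the homogeneous component of degree \<open>n\<close> of \<open>M\<close>.\<close>

definition cohomology_deg ::
    "('k, 'a) module \<Rightarrow> ('a \<Rightarrow> 'a) \<Rightarrow> (nat \<Rightarrow> 'a set) \<Rightarrow> nat \<Rightarrow> 'a set set" where
  "cohomology_deg M \<delta> gr n = cohomology_class M \<delta> ` (cocycles M \<delta> \<inter> gr n)"

text \<open>The sum of the components of \<open>H(M)\<close> whose degree satisfies \<open>P\<close>.\<close>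

definition cohomology_part ::
    "('k, 'a) module \<Rightarrow> ('a \<Rightarrow> 'a) \<Rightarrow> (nat \<Rightarrow> 'a set) \<Rightarrow> (nat \<Rightarrow> bool) \<Rightarrow> ('k, 'a set) module" where
  "cohomology_part M \<delta> gr P = (cohomology M \<delta>)
     \<lparr>carrier := {finsum (cohomology M \<delta>) h F | h F.
        finite F \<and> F \<subseteq> Collect P \<and> (\<forall>n\<in>F. h n \<in> cohomology_deg M \<delta> gr n)}\<rparr>"

definition linear_iso ::
    "('k, 'a) module \<Rightarrow> ('k, 'b) module \<Rightarrow> ('a \<Rightarrow> 'b) \<Rightarrow> bool" where
  "linear_iso M N \<phi> \<longleftrightarrow> bij_betw \<phi> (carrier M) (carrier N) \<and>
     (\<forall>x\<in>carrier M. \<forall>y\<in>carrier M. \<phi> (x \<oplus>\<^bsub>M\<^esub> y) = \<phi> x \<oplus>\<^bsub>N\<^esub> \<phi> y) \<and>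
     (\<forall>c. \<forall>x\<in>carrier M. \<phi> (c \<odot>\<^bsub>M\<^esub> x) = c \<odot>\<^bsub>N\<^esub> \<phi> x)"

definition algebra_iso ::
    "('k, 'a) module \<Rightarrow> ('k, 'b) module \<Rightarrow> ('a \<Rightarrow> 'b) \<Rightarrow> bool" where
  "algebra_iso M N \<phi> \<longleftrightarrow> \<phi> \<in> ring_iso M N \<and> linear_iso M N \<phi>"


subsection \<open>Finite Coxeter groups and reflection representations\<close>

text \<open>
  The congruence on words in \<open>S\<close> generated by the Coxeter relations \<open>(s t)\<^sup>m\<^sup>(\<^sup>s\<^sup>,\<^sup>t\<^sup>) = 1\<close>, where
  \<open>m(s, t)\<close> is the order of \<open>s t\<close> in \<open>G\<close>. For \<open>s = t\<close> the relation is \<open>s s = 1\<close>, so the presented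
  monoid is a group. \<open>group.ord\<close> is \<open>0\<close> on elements of infinite order, which gives a void relation.
\<close>

inductive coxeter_equiv :: "('g, 'h) monoid_scheme \<Rightarrow> 'g set \<Rightarrow> 'g list \<Rightarrow> 'g list \<Rightarrow> bool"
  for G S where
    relation: "\<lbrakk>s \<in> S; t \<in> S; u \<in> lists S; v \<in> lists S\<rbrakk> \<Longrightarrow>
      coxeter_equiv G S (u @ concat (replicate (group.ord G (s \<otimes>\<^bsub>G\<^esub> t)) [s, t]) @ v) (u @ v)"
  | refl: "u \<in> lists S \<Longrightarrow> coxeter_equiv G S u u"
  | sym: "coxeter_equiv G S u v \<Longrightarrow> coxeter_equiv G S v u"
  | trans: "coxeter_equiv G S u v \<Longrightarrow> coxeter_equiv G S v w \<Longrightarrow> coxeter_equiv G S u w"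

locale coxeter_system = group G for G (structure) and S +
  assumes gens_closed: "S \<subseteq> carrier G"
    and gens_ne_one: "s \<in> S \<Longrightarrow> s \<noteq> \<one>"
    and gens_involution: "s \<in> S \<Longrightarrow> s \<otimes> s = \<one>"
    and gens_generate: "generate G S = carrier G"
    and presentation: "\<lbrakk>u \<in> lists S; v \<in> lists S; foldr (\<otimes>) u \<one> = foldr (\<otimes>) v \<one>\<rbrakk>
      \<Longrightarrow> coxeter_equiv G S u v"

definition linear_form :: "('k::field \<Rightarrow> 'v::ab_group_add \<Rightarrow> 'v) \<Rightarrow> ('v \<Rightarrow> 'k) \<Rightarrow> bool" where
  "linear_form scl l \<longleftrightarrow> Vector_Spaces.linear scl (*) l"

definition ker_form :: "('v \<Rightarrow> 'k::zero) \<Rightarrow> 'v set" where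
  "ker_form l = {v. l v = 0}"

definition fixed_space :: "('v \<Rightarrow> 'v) \<Rightarrow> 'v set" where
  "fixed_space T = {v. T v = v}"

definition is_reflection :: "('k::field \<Rightarrow> 'v::ab_group_add \<Rightarrow> 'v) \<Rightarrow> ('v \<Rightarrow> 'v) \<Rightarrow> bool" where
  "is_reflection scl T \<longleftrightarrow> Vector_Spaces.linear scl scl T \<and> T \<circ> T = id \<and>
     (\<exists>l. linear_form scl l \<and> l \<noteq> 0 \<and> fixed_space T = ker_form l)"

definition reflection_hyperplanes ::
    "('k::field \<Rightarrow> 'v::ab_group_add \<Rightarrow> 'v) \<Rightarrow> ('g, 'h) monoid_scheme \<Rightarrow> ('g \<Rightarrow> 'v \<Rightarrow> 'v) \<Rightarrow> 'v set set" where
  "reflection_hyperplanes scl G \<rho> =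
     {fixed_space (\<rho> g) | g. g \<in> carrier G \<and> is_reflection scl (\<rho> g)}"

text \<open>
  The hyperplanes are indexed by a finite set \<open>A\<close>; \<open>\<alpha> i\<close> is the chosen form of the \<open>i\<close>-th hyperplane
  and \<open>\<sigma> i\<close> the corresponding reflection. The order on the index type only serves to write down
  the basis of an exterior algebra. The trivial group is excluded, since there is no simplex with
  empty vertex set (the relation \<open>\<Sum>x\<^sub>\<alpha> = 1\<close> would read \<open>0 = 1\<close>).
\<close>

locale coxeter_reflection_rep =
  vector_space scl + coxeter_system G S
  for scl :: "'k::field_char_0 \<Rightarrow> 'v::ab_group_add \<Rightarrow> 'v"
    and G :: "('g, 'h) monoid_scheme" (structure)
    and S :: "'g set" +
  fixes \<rho> :: "'g \<Rightarrow> 'v \<Rightarrow> 'v"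
    and A :: "'i::linorder set"
    and \<alpha> :: "'i \<Rightarrow> 'v \<Rightarrow> 'k"
    and \<sigma> :: "'i \<Rightarrow> 'v \<Rightarrow> 'v"
  assumes finite_group: "finite (carrier G)"
    and finite_dim: "\<exists>B. finite B \<and> Modules.module.span scl B = UNIV"
    and rep_linear: "g \<in> carrier G \<Longrightarrow> Vector_Spaces.linear scl scl (\<rho> g)"
    and rep_one: "\<rho> \<one> = id"
    and rep_mult: "\<lbrakk>g \<in> carrier G; h \<in> carrier G\<rbrakk> \<Longrightarrow> \<rho> (g \<otimes> h) = \<rho> g \<circ> \<rho> h"
    and rep_faithful: "inj_on \<rho> (carrier G)"
    and rep_gens: "s \<in> S \<Longrightarrow> is_reflection scl (\<rho> s)"
    and finite_index: "finite A"
    and nonempty_index: "A \<noteq> {}"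
    and forms: "i \<in> A \<Longrightarrow> linear_form scl (\<alpha> i)"
    and hyperplanes: "bij_betw (\<lambda>i. ker_form (\<alpha> i)) A (reflection_hyperplanes scl G \<rho>)"
    and reflections_in_group: "i \<in> A \<Longrightarrow> \<sigma> i \<in> \<rho> ` carrier G"
    and reflections: "i \<in> A \<Longrightarrow> is_reflection scl (\<sigma> i)"
    and reflections_fix: "i \<in> A \<Longrightarrow> fixed_space (\<sigma> i) = ker_form (\<alpha> i)"

definition invariant_multiplicity ::
    "('g, 'h) monoid_scheme \<Rightarrow> ('g \<Rightarrow> 'v \<Rightarrow> 'v) \<Rightarrow> 'i set \<Rightarrow> ('i \<Rightarrow> 'v \<Rightarrow> 'k::zero) \<Rightarrow> ('i \<Rightarrow> nat) \<Rightarrow> bool" where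
  "invariant_multiplicity G \<rho> A \<alpha> k \<longleftrightarrow>
     (\<forall>g\<in>carrier G. \<forall>i\<in>A. \<forall>j\<in>A. \<rho> g ` ker_form (\<alpha> i) = ker_form (\<alpha> j) \<longrightarrow> k i = k j)"


subsection \<open>Polynomial functions and quasi-invariants\<close>

text \<open>\<open>hom_poly scl d\<close> consists of the homogeneous polynomial functions of polynomial degree \<open>d\<close>,
  i.e. of cohomological degree \<open>2d\<close>.\<close>

primrec hom_poly :: "('k::field \<Rightarrow> 'v::ab_group_add \<Rightarrow> 'v) \<Rightarrow> nat \<Rightarrow> ('v \<Rightarrow> 'k) set" where
  "hom_poly scl 0 = range (\<lambda>c v. c)"
| "hom_poly scl (Suc d) = Modules.module.span (\<lambda>c f v. c * f v)
     {l * f | l f. linear_form scl l \<and> f \<in> hom_poly scl d}"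

definition poly_funs :: "('k::field \<Rightarrow> 'v::ab_group_add \<Rightarrow> 'v) \<Rightarrow> ('v \<Rightarrow> 'k) set" where
  "poly_funs scl = Modules.module.span (\<lambda>c f v. c * f v) (\<Union>d. hom_poly scl d)"

text \<open>The set of \<open>f\<close> with \<open>T(f) \<equiv> f\<close> modulo \<open>\<langle>l\<rangle>\<^sup>2\<^sup>m\<close>, where \<open>T(f) = f \<circ> T\<^sup>-\<^sup>1\<close>.\<close>

definition quasi_inv1 ::
    "('k::field \<Rightarrow> 'v::ab_group_add \<Rightarrow> 'v) \<Rightarrow> ('v \<Rightarrow> 'k) \<Rightarrow> ('v \<Rightarrow> 'v) \<Rightarrow> nat \<Rightarrow> ('v \<Rightarrow> 'k) set" where
  "quasi_inv1 scl l T m =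
     {f \<in> poly_funs scl. \<exists>g\<in>poly_funs scl. (f \<circ> inv_into UNIV T) - f = l ^ (2 * m) * g}"

definition quasi_inv ::
    "('k::field \<Rightarrow> 'v::ab_group_add \<Rightarrow> 'v) \<Rightarrow> 'i set \<Rightarrow> ('i \<Rightarrow> 'v \<Rightarrow> 'k) \<Rightarrow> ('i \<Rightarrow> 'v \<Rightarrow> 'v)
      \<Rightarrow> ('i \<Rightarrow> nat) \<Rightarrow> ('k, 'v \<Rightarrow> 'k) module" where
  "quasi_inv scl A \<alpha> \<sigma> k =
    \<lparr>carrier = {f \<in> poly_funs scl. \<forall>i\<in>A. \<exists>g\<in>poly_funs scl.
        (f \<circ> inv_into UNIV (\<sigma> i)) - f = \<alpha> i ^ (2 * k i) * g},
     monoid.mult = (*), monoid.one = 1, ring.zero = 0, ring.add = (+), smult = (\<lambda>c f v. c * f v)\<rparr>"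

text \<open>The product \<open>\<Prod>\<^sub>i\<^sub>\<in>\<^sub>A R i\<close> of algebras of functions; tuples are extended by \<open>0\<close> outside \<open>A\<close>.\<close>

definition prod_alg :: "'i set \<Rightarrow> ('i \<Rightarrow> ('v \<Rightarrow> 'k::field) set) \<Rightarrow> ('k, 'i \<Rightarrow> 'v \<Rightarrow> 'k) module" where
  "prod_alg A R =
    \<lparr>carrier = {f. (\<forall>i\<in>A. f i \<in> R i) \<and> (\<forall>i. i \<notin> A \<longrightarrow> f i = 0)},
     monoid.mult = (*), monoid.one = (\<lambda>i. if i \<in> A then 1 else 0), ring.zero = 0, ring.add = (+),
     smult = (\<lambda>c f i v. c * f i v)\<rparr>"


subsection \<open>Polynomial de Rham forms on the simplex with vertex set \<open>A\<close>\<close>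

text \<open>
  A form \<open>\<omega> = \<Sum>\<^sub>K \<omega>\<^sub>K dx\<^sub>K\<close> is given by its coefficients \<open>\<omega> K\<close> with respect to the basis
  \<open>dx\<^sub>K = dx\<^sub>i\<^sub>1 \<and> \<dots> \<and> dx\<^sub>i\<^sub>q\<close>, \<open>K = {i\<^sub>1 < \<dots> < i\<^sub>q}\<close>, of the exterior algebra. The coefficients are
  polynomials in the \<open>x\<^sub>i\<close> with coefficients in a ring \<open>'r\<close>.
\<close>

type_synonym ('i, 'r) form = "'i set \<Rightarrow> (('i \<Rightarrow>\<^sub>0 nat) \<Rightarrow>\<^sub>0 'r)"

text \<open>For disjoint \<open>I\<close> and \<open>J\<close> one has \<open>dx\<^sub>I \<and> dx\<^sub>J = shuffle_sign I J \<cdot> dx\<^sub>I\<^sub>\<union>\<^sub>J\<close>.\<close>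

definition shuffle_sign :: "'i::linorder set \<Rightarrow> 'i set \<Rightarrow> 'r::comm_ring_1" where
  "shuffle_sign I J = (-1) ^ card {(i, j). i \<in> I \<and> j \<in> J \<and> j < i}"

definition wedge ::
    "('i::linorder, 'r::comm_ring_1) form \<Rightarrow> ('i, 'r) form \<Rightarrow> ('i, 'r) form" where
  "wedge \<omega> \<eta> = (\<lambda>K. \<Sum>I\<in>Pow K. shuffle_sign I (K - I) * \<omega> I * \<eta> (K - I))"

definition partial :: "'i \<Rightarrow> (('i \<Rightarrow>\<^sub>0 nat) \<Rightarrow>\<^sub>0 'r::comm_ring_1) \<Rightarrow> (('i \<Rightarrow>\<^sub>0 nat) \<Rightarrow>\<^sub>0 'r)" where
  "partial i p = (\<Sum>m\<in>Poly_Mapping.keys p. Poly_Mapping.single (m - Poly_Mapping.single i 1)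
     (of_nat (Poly_Mapping.lookup m i) * Poly_Mapping.lookup p m))"

text \<open>\<open>d(\<Sum>\<^sub>J \<omega>\<^sub>J dx\<^sub>J) = \<Sum>\<^sub>J \<Sum>\<^sub>i (\<partial>\<^sub>i \<omega>\<^sub>J) dx\<^sub>i \<and> dx\<^sub>J\<close>.\<close>

definition ext_deriv ::
    "('i::linorder, 'r::comm_ring_1) form \<Rightarrow> ('i, 'r) form" where
  "ext_deriv \<omega> = (\<lambda>K. \<Sum>i\<in>K. shuffle_sign {i} (K - {i}) * partial i (\<omega> (K - {i})))"

definition fun_form :: "(('i \<Rightarrow>\<^sub>0 nat) \<Rightarrow>\<^sub>0 'r::comm_ring_1) \<Rightarrow> ('i, 'r) form" where
  "fun_form p = (\<lambda>K. if K = {} then p else 0)"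

definition const_form :: "'r::comm_ring_1 \<Rightarrow> ('i, 'r) form" where
  "const_form a = fun_form (Poly_Mapping.single 0 a)"

definition x_form :: "'i \<Rightarrow> ('i, 'r::comm_ring_1) form" where
  "x_form i = fun_form (Poly_Mapping.single (Poly_Mapping.single i 1) 1)"

definition dx_form :: "'i \<Rightarrow> ('i, 'r::comm_ring_1) form" where
  "dx_form i = (\<lambda>K. if K = {i} then 1 else 0)"

text \<open>
  The algebra \<open>\<^bold>k[V] \<otimes> \<^bold>k[{x\<^sub>i}] \<otimes> \<Lambda>({dx\<^sub>i})\<close>. The second and the third factor have the bases of
  monomials \<open>x\<^sup>m\<close> and \<open>dx\<^sub>K\<close>, so an element is a finite sum \<open>\<Sum> f\<^sub>m\<^sub>,\<^sub>K \<otimes> x\<^sup>m \<otimes> dx\<^sub>K\<close> with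
  unique \<open>f\<^sub>m\<^sub>,\<^sub>K \<in> \<^bold>k[V]\<close>, namely \<open>f\<^sub>m\<^sub>,\<^sub>K = lookup (\<omega> K) m\<close>.
\<close>

definition free_forms ::
    "('k::field \<Rightarrow> 'v::ab_group_add \<Rightarrow> 'v) \<Rightarrow> 'i::linorder set \<Rightarrow> ('k, ('i, 'v \<Rightarrow> 'k) form) module" where
  "free_forms scl A =
    \<lparr>carrier = {\<omega>. (\<forall>K. \<omega> K \<noteq> 0 \<longrightarrow> K \<subseteq> A) \<and>
        (\<forall>K. \<forall>m\<in>Poly_Mapping.keys (\<omega> K).
          Poly_Mapping.keys m \<subseteq> A \<and> Poly_Mapping.lookup (\<omega> K) m \<in> poly_funs scl)},
     monoid.mult = wedge, monoid.one = const_form 1, ring.zero = 0, ring.add = (+),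
     smult = (\<lambda>c. wedge (const_form (\<lambda>v. c)))\<rparr>"

definition simplex_ideal ::
    "('k::field \<Rightarrow> 'v::ab_group_add \<Rightarrow> 'v) \<Rightarrow> 'i::linorder set \<Rightarrow> ('i, 'v \<Rightarrow> 'k) form set" where
  "simplex_ideal scl A =
     Idl\<^bsub>free_forms scl A\<^esub> {(\<Sum>i\<in>A. x_form i) - const_form 1, \<Sum>i\<in>A. dx_form i}"

text \<open>
  \<open>\<^bold>k[V] \<otimes> \<Omega>\<^sup>*(A)\<close>. With \<open>\<Omega>\<^sup>*(A) = F / J\<close>, \<open>F = \<^bold>k[{x\<^sub>i}] \<otimes> \<Lambda>({dx\<^sub>i})\<close>, this is
  \<open>(\<^bold>k[V] \<otimes> F) / (\<^bold>k[V] \<otimes> J)\<close>, and \<open>\<^bold>k[V] \<otimes> J\<close> is the ideal of \<open>\<^bold>k[V] \<otimes> F\<close> generated by the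
  generators of \<open>J\<close>.
\<close>

definition simplex_forms ::
    "('k::field \<Rightarrow> 'v::ab_group_add \<Rightarrow> 'v) \<Rightarrow> 'i::linorder set \<Rightarrow> ('k, ('i, 'v \<Rightarrow> 'k) form set) module" where
  "simplex_forms scl A = alg_quot (free_forms scl A) (simplex_ideal scl A)"

definition form_class ::
    "('k::field \<Rightarrow> 'v::ab_group_add \<Rightarrow> 'v) \<Rightarrow> 'i::linorder set \<Rightarrow> ('i, 'v \<Rightarrow> 'k) form \<Rightarrow> ('i, 'v \<Rightarrow> 'k) form set" where
  "form_class scl A \<omega> = simplex_ideal scl A +>\<^bsub>free_forms scl A\<^esub> \<omega>"

text \<open>Differential and evaluations are constant modulo \<open>simplex_ideal\<close> on the elements of a class, so the
  union and the image below are a single class and a singleton.\<close>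

definition simplex_d ::
    "('k::field \<Rightarrow> 'v::ab_group_add \<Rightarrow> 'v) \<Rightarrow> 'i::linorder set
      \<Rightarrow> ('i, 'v \<Rightarrow> 'k) form set \<Rightarrow> ('i, 'v \<Rightarrow> 'k) form set" where
  "simplex_d scl A C = (\<Union>\<omega>\<in>C. form_class scl A (ext_deriv \<omega>))"

definition poly_eval :: "('i \<Rightarrow> 'r::comm_ring_1) \<Rightarrow> (('i \<Rightarrow>\<^sub>0 nat) \<Rightarrow>\<^sub>0 'r) \<Rightarrow> 'r" where
  "poly_eval a p = (\<Sum>m\<in>Poly_Mapping.keys p. Poly_Mapping.lookup p m *
     (\<Prod>j\<in>Poly_Mapping.keys m. a j ^ Poly_Mapping.lookup m j))"

definition vertex_eval :: "'i \<Rightarrow> ('i, 'v \<Rightarrow> 'k::field) form set \<Rightarrow> 'v \<Rightarrow> 'k" where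
  "vertex_eval i C = the_elem ((\<lambda>\<omega>. poly_eval (\<lambda>j. if j = i then 1 else 0) (\<omega> {})) ` C)"

definition vertices_eval :: "'i set \<Rightarrow> ('i, 'v \<Rightarrow> 'k::field) form set \<Rightarrow> 'i \<Rightarrow> 'v \<Rightarrow> 'k" where
  "vertices_eval A C = (\<lambda>i. if i \<in> A then vertex_eval i C else 0)"

text \<open>Total degree: \<open>f \<otimes> x\<^sup>m \<otimes> dx\<^sub>K\<close> has degree \<open>2d + |K|\<close> if \<open>f\<close> has polynomial degree \<open>d\<close>.\<close>

definition simplex_forms_deg ::
    "('k::field \<Rightarrow> 'v::ab_group_add \<Rightarrow> 'v) \<Rightarrow> 'i::linorder set \<Rightarrow> nat \<Rightarrow> ('i, 'v \<Rightarrow> 'k) form set set" where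
  "simplex_forms_deg scl A n = form_class scl A `
     {\<omega> \<in> carrier (free_forms scl A). \<forall>K. \<forall>m\<in>Poly_Mapping.keys (\<omega> K).
        \<exists>d. n = 2 * d + card K \<and> Poly_Mapping.lookup (\<omega> K) m \<in> hom_poly scl d}"


subsection \<open>The dg algebra \<open>Q\<^sup>*\<^sub>k(W)\<close>\<close>

type_synonym ('i, 'v, 'k) qdga = "('i \<Rightarrow> 'v \<Rightarrow> 'k) \<times> ('i, 'v \<Rightarrow> 'k) form set"

definition Q_dga ::
    "('k::field \<Rightarrow> 'v::ab_group_add \<Rightarrow> 'v) \<Rightarrow> 'i::linorder set \<Rightarrow> ('i \<Rightarrow> 'v \<Rightarrow> 'k) \<Rightarrow> ('i \<Rightarrow> 'v \<Rightarrow> 'v)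
      \<Rightarrow> ('i \<Rightarrow> nat) \<Rightarrow> ('k, ('i, 'v, 'k) qdga) module" where
  "Q_dga scl A \<alpha> \<sigma> k =
     fibre_product (prod_alg A (\<lambda>i. quasi_inv1 scl (\<alpha> i) (\<sigma> i) (k i))) (simplex_forms scl A)
       (\<lambda>f. f) (vertices_eval A)"

definition Q_d ::
    "('k::field \<Rightarrow> 'v::ab_group_add \<Rightarrow> 'v) \<Rightarrow> 'i::linorder set \<Rightarrow> ('i, 'v, 'k) qdga \<Rightarrow> ('i, 'v, 'k) qdga" where
  "Q_d scl A = (\<lambda>(f, C). (0, simplex_d scl A C))"

definition Q_deg ::
    "('k::field \<Rightarrow> 'v::ab_group_add \<Rightarrow> 'v) \<Rightarrow> 'i::linorder set \<Rightarrow> ('i \<Rightarrow> 'v \<Rightarrow> 'k) \<Rightarrow> ('i \<Rightarrow> 'v \<Rightarrow> 'v)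
      \<Rightarrow> ('i \<Rightarrow> nat) \<Rightarrow> nat \<Rightarrow> ('i, 'v, 'k) qdga set" where
  "Q_deg scl A \<alpha> \<sigma> k n = {(f, C) \<in> carrier (Q_dga scl A \<alpha> \<sigma> k).
     (\<forall>i\<in>A. f i = 0 \<or> (\<exists>d. n = 2 * d \<and> f i \<in> hom_poly scl d)) \<and>
     C \<in> simplex_forms_deg scl A n}"

definition H_ev where
  "H_ev scl A \<alpha> \<sigma> k = cohomology_part (Q_dga scl A \<alpha> \<sigma> k) (Q_d scl A) (Q_deg scl A \<alpha> \<sigma> k) even"

definition H_odd where
  "H_odd scl A \<alpha> \<sigma> k = cohomology_part (Q_dga scl A \<alpha> \<sigma> k) (Q_d scl A) (Q_deg scl A \<alpha> \<sigma> k) odd"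

definition H_deg where
  "H_deg scl A \<alpha> \<sigma> k n = cohomology_deg (Q_dga scl A \<alpha> \<sigma> k) (Q_d scl A) (Q_deg scl A \<alpha> \<sigma> k) n"

text \<open>The natural map from \<open>Q\<^sub>k(W)\<close> to \<open>H(Q\<^sup>*\<^sub>k(W))\<close>, \<open>f \<mapsto> [((f)\<^sub>\<alpha>, f \<otimes> 1)]\<close>.\<close>

definition Q_to_H ::
    "('k::field \<Rightarrow> 'v::ab_group_add \<Rightarrow> 'v) \<Rightarrow> 'i::linorder set \<Rightarrow> ('i \<Rightarrow> 'v \<Rightarrow> 'k) \<Rightarrow> ('i \<Rightarrow> 'v \<Rightarrow> 'v)
      \<Rightarrow> ('i \<Rightarrow> nat) \<Rightarrow> ('v \<Rightarrow> 'k) \<Rightarrow> ('i, 'v, 'k) qdga set" where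
  "Q_to_H scl A \<alpha> \<sigma> k f = cohomology_class (Q_dga scl A \<alpha> \<sigma> k) (Q_d scl A)
     (\<lambda>i. if i \<in> A then f else 0, form_class scl A (const_form f))"

definition S_space ::
    "('k::field \<Rightarrow> 'v::ab_group_add \<Rightarrow> 'v) \<Rightarrow> 'i set \<Rightarrow> ('i \<Rightarrow> 'v \<Rightarrow> 'k) \<Rightarrow> ('i \<Rightarrow> 'v \<Rightarrow> 'v)
      \<Rightarrow> ('i \<Rightarrow> nat) \<Rightarrow> ('i \<Rightarrow> 'v \<Rightarrow> 'k) set" where
  "S_space scl A \<alpha> \<sigma> k = Modules.module.span (\<lambda>c f i v. c * f i v)
     {(\<lambda>i. if i \<in> A then F i - f else 0) | F f.
        (\<forall>i\<in>A. F i \<in> quasi_inv1 scl (\<alpha> i) (\<sigma> i) (k i)) \<and> f \<in> poly_funs scl}"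

text \<open>The vector space \<open>\<^bold>k[V]\<^sup>A / S\<^sub>k(A)\<close> and its component of cohomological degree \<open>2d\<close>. As
  \<open>S\<^sub>k(A)\<close> is not an ideal, the multiplicative fields of the first record are irrelevant.\<close>

definition coker_space where
  "coker_space scl A \<alpha> \<sigma> k =
     alg_quot (prod_alg A (\<lambda>i. poly_funs scl)) (S_space scl A \<alpha> \<sigma> k)"

definition coker_deg where
  "coker_deg scl A \<alpha> \<sigma> k d =
     {S_space scl A \<alpha> \<sigma> k +>\<^bsub>prod_alg A (\<lambda>i. poly_funs scl)\<^esub> f | f.
        f \<in> carrier (prod_alg A (\<lambda>i. hom_poly scl d))}"

end

theory Submission
  imports Defs "HOL-Computational_Algebra.Polynomial"
begin

text \<open>
  Let \<open>F\<close> be the algebra of forms in the free variables \<open>x\<^sub>\<alpha>\<close> with coefficients in \<open>\<^bold>k[V]\<close> and \<open>J\<close> the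
  simplex ideal. An element of \<open>Q\<^sup>*\<^sub>k(W)\<close> is determined by its de Rham component, so \<open>Q\<^sup>*\<^sub>k(W) = E / J\<close>,
  where \<open>E \<subseteq> F\<close> consists of the forms whose value at each vertex \<open>\<alpha>\<close> lies in \<open>Q\<^sub>k\<^sub>\<alpha>\<close>. By the
  Poincare lemma a cocycle \<open>\<omega> \<in> E\<close> equals \<open>h + d\<eta>\<close> modulo \<open>J\<close> with \<open>h \<in> \<^bold>k[V]\<close>. In even degree \<open>\<eta>\<close> has
  odd form degree and vanishes at the vertices, so \<open>\<omega>\<close> is cohomologous to \<open>h\<close>, and \<open>h\<close> lies in all
  \<open>Q\<^sub>k\<^sub>\<alpha>\<close>. In odd degree \<open>h = 0\<close>, and the class of \<open>d\<eta>\<close> depends only on the vertex values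
  \<open>(g\<^sub>\<alpha>)\<close> of \<open>\<eta>\<close>; it is zero iff \<open>\<eta>\<close> can be changed by an element of \<open>E\<close> into a closed
  form \<open>h\<close>, that is, iff \<open>g\<^sub>\<alpha> - h \<in> Q\<^sub>k\<^sub>\<alpha>\<close> for all \<open>\<alpha>\<close>. The Poincare lemma is proved directly modulo
  \<open>J\<close>: contraction with the radial vector field at a vertex preserves \<open>J\<close>.
\<close>

\<comment> \<open>Cohomology classes of \<open>Q_dga\<close> are cosets of pairs that themselves
  contain cosets. All computations are therefore done on forms, with \<open>J\<close> and the
  coboundaries as subspaces modulo which one compares. Contraction preserves \<open>J\<close>
  because the radial vector field at a vertex maps \<open>bary\<close> (the sum of the coordinates
  minus 1) to itself: it is tangent to the simplex. No coordinate has to be eliminated, and all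
  vertices stay on an equal footing. Characteristic zero enters in the division by n, and through
  the infinite field on which a polynomial function determines its homogeneous components. The
  grading is carried by coefficient spaces \<open>N q\<close> that depend on the form degree q. One
  Poincare lemma for an arbitrary family \<open>N\<close> then gives both the ungraded statement and
  its refinement to each total degree. Since k[V] sits in even degrees, total degree and form degree
  have the same parity; this separates the even from the odd case. For the nonvanishing one
  hyperplane is too few: with a single index the elements \<open>F i - f\<close> already fill k[V].
  Two commuting reflections with multiplicity 1 suffice.\<close>
alias lookup = Poly_Mapping.lookup
alias single = Poly_Mapping.single
alias keys = Poly_Mapping.keys

subsection \<open>Presentations of quotients\<close>

text \<open>No vector space axioms are asked of \<open>sc\<close>, so functions, tuples and forms
  share one notion. Closure under differences makes up for the fact that negation cannot be obtained
  as scaling by -1.\<close>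

definition lin_sub :: "('k \<Rightarrow> 'x \<Rightarrow> 'x) \<Rightarrow> 'x::ab_group_add set \<Rightarrow> bool" where
  "lin_sub sc Z \<longleftrightarrow> 0 \<in> Z \<and> (\<forall>x\<in>Z. \<forall>y\<in>Z. x - y \<in> Z) \<and> (\<forall>a. \<forall>x\<in>Z. sc a x \<in> Z)"

lemma lin_subI:
  assumes "0 \<in> Z" "\<And>x y. x \<in> Z \<Longrightarrow> y \<in> Z \<Longrightarrow> x - y \<in> Z" "\<And>a x. x \<in> Z \<Longrightarrow> sc a x \<in> Z"
  shows "lin_sub sc Z"
  using assms unfolding lin_sub_def by blast

lemma lin_sub_zero: "lin_sub sc Z \<Longrightarrow> 0 \<in> Z"
  and lin_sub_diff: "lin_sub sc Z \<Longrightarrow> x \<in> Z \<Longrightarrow> y \<in> Z \<Longrightarrow> x - y \<in> Z"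
  and lin_sub_scale: "lin_sub sc Z \<Longrightarrow> x \<in> Z \<Longrightarrow> sc a x \<in> Z"
  unfolding lin_sub_def by auto

lemma lin_sub_uminus: "lin_sub sc Z \<Longrightarrow> x \<in> Z \<Longrightarrow> - x \<in> Z"
  using lin_sub_diff[of sc Z 0 x] lin_sub_zero by force

lemma lin_sub_add: "lin_sub sc Z \<Longrightarrow> x \<in> Z \<Longrightarrow> y \<in> Z \<Longrightarrow> x + y \<in> Z"
  using lin_sub_diff[of sc Z x "- y"] lin_sub_uminus by force

lemma lin_sub_sum: "lin_sub sc Z \<Longrightarrow> (\<And>i. i \<in> F \<Longrightarrow> f i \<in> Z) \<Longrightarrow> sum f F \<in> Z"
  by (induction F rule: infinite_finite_induct) (auto simp: lin_sub_zero lin_sub_add)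

lemma lin_sub_coset_eq:
  assumes N: "lin_sub sc N"
  shows "(\<lambda>h. h + x) ` N = (\<lambda>h. h + y) ` N \<longleftrightarrow> x - y \<in> N"
proof
  assume "(\<lambda>h. h + x) ` N = (\<lambda>h. h + y) ` N"
  then have "x \<in> (\<lambda>h. h + y) ` N"
    using lin_sub_zero[OF N] by (metis add_0 image_eqI)
  then show "x - y \<in> N" by auto
next
  assume d: "x - y \<in> N"
  show "(\<lambda>h. h + x) ` N = (\<lambda>h. h + y) ` N"
  proof (intro Set.set_eqI iffI)
    fix z assume "z \<in> (\<lambda>h. h + x) ` N"
    then obtain h where "h \<in> N" "z = h + x" by blast
    then show "z \<in> (\<lambda>h. h + y) ` N"
      using lin_sub_add[OF N _ d] by (intro image_eqI[of _ _ "h + (x - y)"]) auto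
  next
    fix z assume "z \<in> (\<lambda>h. h + y) ` N"
    then obtain h where "h \<in> N" "z = h + y" by blast
    then show "z \<in> (\<lambda>h. h + x) ` N"
      using lin_sub_diff[OF N _ d] by (intro image_eqI[of _ _ "h - (x - y)"]) auto
  qed
qed

text \<open>\<open>lin_pres M Z N sc c\<close>: the map \<open>c\<close> induces an isomorphism \<open>Z / N \<cong> M\<close> of vector spaces, and
  \<open>mult_pres M Z mul e c\<close> that it carries \<open>mul\<close> to the product of \<open>M\<close>. Iterated quotients and
  subquotients are computed on representatives in \<open>Z\<close>.\<close>

locale lin_pres =
  fixes M :: "('k, 'a) module" and Z N :: "'x::ab_group_add set"
    and sc :: "'k \<Rightarrow> 'x \<Rightarrow> 'x" and c :: "'x \<Rightarrow> 'a"
  assumes Z: "lin_sub sc Z" and N: "lin_sub sc N" and N_subset: "N \<subseteq> Z"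
    and carrier: "carrier M = c ` Z"
    and eq_iff: "x \<in> Z \<Longrightarrow> y \<in> Z \<Longrightarrow> c x = c y \<longleftrightarrow> x - y \<in> N"
    and add: "x \<in> Z \<Longrightarrow> y \<in> Z \<Longrightarrow> c x \<oplus>\<^bsub>M\<^esub> c y = c (x + y)"
    and zero: "\<zero>\<^bsub>M\<^esub> = c 0"
    and smult: "x \<in> Z \<Longrightarrow> a \<odot>\<^bsub>M\<^esub> c x = c (sc a x)"
begin

lemma eq_zero_iff: "x \<in> Z \<Longrightarrow> c x = \<zero>\<^bsub>M\<^esub> \<longleftrightarrow> x \<in> N"
  using eq_iff[of x 0] lin_sub_zero[OF Z] by (simp add: zero)

text \<open>Needed because \<open>cohomology_part\<close> is defined with \<open>finsum\<close>,
  which is meaningful only in a commutative monoid.\<close>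

lemma abelian_monoid: "abelian_monoid M"
proof (rule abelian_monoidI)
  fix x y z
  assume "x \<in> carrier M" "y \<in> carrier M" "z \<in> carrier M"
  then obtain x' y' z' where x: "x' \<in> Z" "x = c x'" and y: "y' \<in> Z" "y = c y'"
    and z: "z' \<in> Z" "z = c z'" by (auto simp: carrier)
  note cl = lin_sub_add[OF Z]
  show "x \<oplus>\<^bsub>M\<^esub> y \<oplus>\<^bsub>M\<^esub> z = x \<oplus>\<^bsub>M\<^esub> (y \<oplus>\<^bsub>M\<^esub> z)" "x \<oplus>\<^bsub>M\<^esub> y = y \<oplus>\<^bsub>M\<^esub> x"
    "\<zero>\<^bsub>M\<^esub> \<oplus>\<^bsub>M\<^esub> x = x" "x \<oplus>\<^bsub>M\<^esub> y \<in> carrier M"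
    using x y z lin_sub_zero[OF Z] by (simp_all add: add cl zero carrier ac_simps)
qed (simp add: zero carrier lin_sub_zero[OF Z])

lemma finsum:
  assumes "finite F" "\<And>n. n \<in> F \<Longrightarrow> f n \<in> Z"
  shows "finsum M (\<lambda>n. c (f n)) F = c (sum f F)"
proof -
  interpret abelian_monoid M by (rule abelian_monoid)
  show ?thesis using assms
  proof (induction F rule: finite_induct)
    case (insert n F)
    have "(\<lambda>n. c (f n)) \<in> F \<rightarrow> carrier M" "c (f n) \<in> carrier M"
      using insert.prems by (auto simp: carrier)
    moreover have "sum f F \<in> Z" using insert.prems by (intro lin_sub_sum[OF Z]) auto
    ultimately show ?case
      using insert by (simp add: add)
  qed (simp add: zero)
qed

lemma restrict:
  assumes "lin_sub sc Z'" "N \<subseteq> Z'" "Z' \<subseteq> Z"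
  shows "lin_pres (M\<lparr>carrier := c ` Z'\<rparr>) Z' N sc c"
  using assms N by (unfold_locales) (auto simp: zero add smult eq_iff subset_iff)

lemma coset:
  assumes N': "lin_sub sc N'" "N' \<subseteq> Z" and x: "x \<in> Z"
  shows "c ` N' +>\<^bsub>M\<^esub> c x = c ` (\<lambda>h. h + x) ` N'"
  unfolding a_r_coset_def' using assms by (auto simp: add subset_iff intro!: image_eqI)

lemma coset_eq_iff:
  assumes N': "lin_sub sc N'" "N \<subseteq> N'" "N' \<subseteq> Z" and x: "x \<in> Z" and y: "y \<in> Z"
  shows "c ` N' +>\<^bsub>M\<^esub> c x = c ` N' +>\<^bsub>M\<^esub> c y \<longleftrightarrow> x - y \<in> N'"
proof
  assume "c ` N' +>\<^bsub>M\<^esub> c x = c ` N' +>\<^bsub>M\<^esub> c y"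
  then have "c ` (\<lambda>h. h + x) ` N' = c ` (\<lambda>h. h + y) ` N'"
    using N' x y by (simp add: coset)
  moreover have "c x \<in> c ` (\<lambda>h. h + x) ` N'"
    using lin_sub_zero[OF N'(1)] by force
  ultimately obtain h where h: "h \<in> N'" "c x = c (h + y)" by auto
  then have "x - (h + y) \<in> N'"
    using eq_iff[of x "h + y"] x y N' lin_sub_add[OF Z, of h y] by auto
  from lin_sub_add[OF N'(1) this h(1)] show "x - y \<in> N'" by simp
next
  assume "x - y \<in> N'"
  then have "(\<lambda>h. h + x) ` N' = (\<lambda>h. h + y) ` N'"
    using lin_sub_coset_eq[OF N'(1)] by blast
  then show "c ` N' +>\<^bsub>M\<^esub> c x = c ` N' +>\<^bsub>M\<^esub> c y"
    using N' x y by (simp add: coset)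
qed

text \<open>Third isomorphism theorem: dividing Z / N by the image of N' gives Z / N'. Iterating it
  keeps the representatives in the same space.\<close>

lemma quotient:
  assumes N': "lin_sub sc N'" "N \<subseteq> N'" "N' \<subseteq> Z" and I: "I = c ` N'"
    and sc: "\<And>a x y. sc a (x + y) = sc a x + sc a y"
  shows "lin_pres (alg_quot M I) Z N' sc (\<lambda>x. I +>\<^bsub>M\<^esub> c x)"
proof
  note cl = lin_sub_add[OF Z] lin_sub_scale[OF Z]
  have coset': "I +>\<^bsub>M\<^esub> c x = c ` (\<lambda>h. h + x) ` N'" if "x \<in> Z" for x
    using that N' by (simp add: coset I)
  show "I +>\<^bsub>M\<^esub> c x = I +>\<^bsub>M\<^esub> c y \<longleftrightarrow> x - y \<in> N'" if "x \<in> Z" "y \<in> Z" for x y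
    using that N' by (simp add: coset_eq_iff I)
  show "carrier (alg_quot M I) = (\<lambda>x. I +>\<^bsub>M\<^esub> c x) ` Z"
    by (auto simp: alg_quot_def FactRing_def A_RCOSETS_def' carrier)
  show "\<zero>\<^bsub>alg_quot M I\<^esub> = I +>\<^bsub>M\<^esub> c 0"
    using lin_sub_zero[OF Z] by (simp add: alg_quot_def FactRing_def coset') (simp add: I)
  fix x assume x: "x \<in> Z"
  show "(I +>\<^bsub>M\<^esub> c x) \<oplus>\<^bsub>alg_quot M I\<^esub> (I +>\<^bsub>M\<^esub> c y) = I +>\<^bsub>M\<^esub> c (x + y)" if y: "y \<in> Z" for y
  proof -
    have "(I +>\<^bsub>M\<^esub> c x) <+>\<^bsub>M\<^esub> (I +>\<^bsub>M\<^esub> c y)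
      = {c ((h + x) + (h' + y)) | h h'. h \<in> N' \<and> h' \<in> N'}"
      using N' x y cl by (auto simp: set_add_def' coset' add subset_iff)
    also have "\<dots> = c ` (\<lambda>h. h + (x + y)) ` N'"
    proof (intro Set.set_eqI iffI)
      fix u assume "u \<in> {c ((h + x) + (h' + y)) | h h'. h \<in> N' \<and> h' \<in> N'}"
      then obtain h h' where "h \<in> N'" "h' \<in> N'" "u = c ((h + h') + (x + y))"
        by (auto simp: algebra_simps)
      then show "u \<in> c ` (\<lambda>h. h + (x + y)) ` N'"
        using lin_sub_add[OF N'(1)] by blast
    next
      fix u assume "u \<in> c ` (\<lambda>h. h + (x + y)) ` N'"
      then obtain h where "h \<in> N'" "u = c ((h + x) + (0 + y))" by (auto simp: algebra_simps)
      then show "u \<in> {c ((h + x) + (h' + y)) | h h'. h \<in> N' \<and> h' \<in> N'}"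
        using lin_sub_zero[OF N'(1)] by blast
    qed
    finally show ?thesis using x y cl by (simp add: alg_quot_def FactRing_def coset')
  qed
  show "a \<odot>\<^bsub>alg_quot M I\<^esub> (I +>\<^bsub>M\<^esub> c x) = I +>\<^bsub>M\<^esub> c (sc a x)" for a
  proof -
    have "I +>\<^bsub>M\<^esub> (a \<odot>\<^bsub>M\<^esub> u) = I +>\<^bsub>M\<^esub> c (sc a x)" if u: "u \<in> I +>\<^bsub>M\<^esub> c x" for u
    proof -
      obtain h where h: "h \<in> N'" "u = c (h + x)" using u x by (auto simp: coset')
      have h': "sc a h \<in> N'" by (rule lin_sub_scale[OF N'(1) h(1)])
      have "h + x \<in> Z" "sc a h + sc a x \<in> Z" "sc a x \<in> Z" using N' x cl h(1) h' by auto
      then show ?thesis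
        using h h' N' by (simp add: smult coset_eq_iff I sc)
    qed
    \<comment> \<open>Scaling in \<open>alg_quot\<close> is a union over the coset. All members give
      the same class, so the union is that class as soon as the coset is inhabited.\<close>
    moreover have "I +>\<^bsub>M\<^esub> c x \<noteq> {}" using x lin_sub_zero[OF N'(1)] by (auto simp: coset')
    ultimately show ?thesis by (simp add: alg_quot_def)
  qed
qed (use Z N' in auto)

text \<open>First isomorphism theorem on representatives. Surjectivity is asked only after applying
  \<open>c'\<close>, so the map has to hit every class but not every representative.\<close>

lemma induced_linear_iso:
  assumes M': "lin_pres M' Z' N' sc' c'"
    and \<psi>: "\<And>x. x \<in> Z \<Longrightarrow> \<psi> x \<in> Z'"
    and add': "\<And>x y. x \<in> Z \<Longrightarrow> y \<in> Z \<Longrightarrow> \<psi> (x + y) = \<psi> x + \<psi> y"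
    and sc': "\<And>a x. x \<in> Z \<Longrightarrow> \<psi> (sc a x) = sc' a (\<psi> x)"
    and ker: "\<And>x. x \<in> Z \<Longrightarrow> \<psi> x \<in> N' \<longleftrightarrow> x \<in> N"
    and surj: "c' ` Z' = c' ` \<psi> ` Z"
  shows "\<exists>\<phi>. linear_iso M M' \<phi> \<and> (\<forall>x\<in>Z. \<phi> (c x) = c' (\<psi> x))"
proof -
  interpret M': lin_pres M' Z' N' sc' c' by (rule M')
  define \<phi> where "\<phi> = (\<lambda>u. c' (\<psi> (inv_into Z c u)))"
  have diff: "\<psi> (x - y) = \<psi> x - \<psi> y" if "x \<in> Z" "y \<in> Z" for x y
    using add'[of "x - y" y] that lin_sub_diff[OF Z that] by (simp add: algebra_simps)
  have \<psi>_eq: "c' (\<psi> x) = c' (\<psi> y) \<longleftrightarrow> c x = c y" if "x \<in> Z" "y \<in> Z" for x y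
    using that ker[of "x - y"] lin_sub_diff[OF Z that] by (simp add: eq_iff M'.eq_iff \<psi> diff)
  have \<phi>: "\<phi> (c x) = c' (\<psi> x)" if "x \<in> Z" for x
    unfolding \<phi>_def using that by (subst \<psi>_eq) (auto simp: f_inv_into_f inv_into_into)
  note cl = lin_sub_add[OF Z] lin_sub_scale[OF Z]
  have "linear_iso M M' \<phi>"
    unfolding linear_iso_def
  proof (intro conjI ballI allI)
    show "bij_betw \<phi> (carrier M) (carrier M')"
      using surj by (auto simp: bij_betw_def inj_on_def carrier M'.carrier \<phi> \<psi>_eq image_image)
  qed (auto simp: carrier add smult M'.add M'.smult \<psi> \<phi> cl add' sc')
  then show ?thesis using \<phi> by blast
qed

end

locale mult_pres =
  fixes M :: "('k, 'a) module" and Z :: "'x::ab_group_add set"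
    and mul :: "'x \<Rightarrow> 'x \<Rightarrow> 'x" and e :: 'x and c :: "'x \<Rightarrow> 'a"
  assumes mul_closed: "x \<in> Z \<Longrightarrow> y \<in> Z \<Longrightarrow> mul x y \<in> Z"
    and one_closed: "e \<in> Z"
    and mult: "x \<in> Z \<Longrightarrow> y \<in> Z \<Longrightarrow> c x \<otimes>\<^bsub>M\<^esub> c y = c (mul x y)"
    and one: "\<one>\<^bsub>M\<^esub> = c e"

text \<open>From \<open>(h + x)(h' + y) - xy = h(h' + y) + xh'\<close>. It serves twice: for
  \<open>J\<close> inside all forms and for the coboundaries inside the cocycles.\<close>

lemma (in lin_pres) quotient_mult:
  assumes N': "lin_sub sc N'" "N \<subseteq> N'" "N' \<subseteq> Z" and I: "I = c ` N'"
    and M: "mult_pres M Z mul e c"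
    and distrib: "\<And>x y z. mul (x + y) z = mul x z + mul y z" "\<And>x y z. mul z (x + y) = mul z x + mul z y"
    and ideal: "\<And>h x. h \<in> N' \<Longrightarrow> x \<in> Z \<Longrightarrow> mul h x \<in> N'" "\<And>h x. h \<in> N' \<Longrightarrow> x \<in> Z \<Longrightarrow> mul x h \<in> N'"
  shows "mult_pres (alg_quot M I) Z mul e (\<lambda>x. I +>\<^bsub>M\<^esub> c x)"
proof -
  interpret mult_pres M Z mul e c by (rule M)
  show ?thesis
  proof
    show "\<one>\<^bsub>alg_quot M I\<^esub> = I +>\<^bsub>M\<^esub> c e"
      by (simp add: alg_quot_def FactRing_def one)
    fix x y assume x: "x \<in> Z" and y: "y \<in> Z"
    have coset': "I +>\<^bsub>M\<^esub> c x = c ` (\<lambda>h. h + x) ` N'" if "x \<in> Z" for x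
      using that N' by (simp add: coset I)
    have "I +>\<^bsub>M\<^esub> (u \<otimes>\<^bsub>M\<^esub> v) = I +>\<^bsub>M\<^esub> c (mul x y)"
      if u: "u \<in> I +>\<^bsub>M\<^esub> c x" and v: "v \<in> I +>\<^bsub>M\<^esub> c y" for u v
    proof -
      obtain h where h: "h \<in> N'" "u = c (h + x)" using u x by (auto simp: coset')
      obtain h' where h': "h' \<in> N'" "v = c (h' + y)" using v y by (auto simp: coset')
      have Z': "h + x \<in> Z" "h' + y \<in> Z" "mul x y \<in> Z"
        using h h' N' x y lin_sub_add[OF Z] mul_closed by auto
      have "mul (h + x) (h' + y) - mul x y = mul h (h' + y) + mul x h'"
        by (simp add: distrib algebra_simps)
      also have "\<dots> \<in> N'" using h h' x Z' by (intro lin_sub_add[OF N'(1)] ideal)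
      finally show ?thesis
        using h h' Z' N' mul_closed[OF Z'(1,2)] by (simp add: mult coset_eq_iff I)
    qed
    moreover have "I +>\<^bsub>M\<^esub> c x \<noteq> {}" "I +>\<^bsub>M\<^esub> c y \<noteq> {}"
      using x y lin_sub_zero[OF N'(1)] by (auto simp: coset')
    ultimately show "(I +>\<^bsub>M\<^esub> c x) \<otimes>\<^bsub>alg_quot M I\<^esub> (I +>\<^bsub>M\<^esub> c y) = I +>\<^bsub>M\<^esub> c (mul x y)"
      by (auto simp: alg_quot_def FactRing_def rcoset_mult_def)
  qed (fact mul_closed one_closed)+
qed

subsection \<open>Polynomial functions\<close>

interpretation funs: vector_space "\<lambda>c (f :: 'v \<Rightarrow> 'k::field) v. c * f v"
  by unfold_locales (auto simp: fun_eq_iff algebra_simps)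

lemma lin_sub_fun_iff: "lin_sub (\<lambda>c (f :: 'v \<Rightarrow> 'k::field) v. c * f v) V \<longleftrightarrow> funs.subspace V"
proof
  assume V: "lin_sub (\<lambda>c (f :: 'v \<Rightarrow> 'k) v. c * f v) V"
  show "funs.subspace V"
    using lin_sub_zero[OF V] lin_sub_add[OF V] lin_sub_scale[OF V] by (intro funs.subspaceI)
next
  assume V: "funs.subspace V"
  show "lin_sub (\<lambda>c f v. c * f v) V"
    using funs.subspace_0[OF V] funs.subspace_diff[OF V] funs.subspace_scale[OF V]
    by (intro lin_subI)
qed

lemma fun_sum_apply: "(\<Sum>i\<in>I. f i) x = (\<Sum>i\<in>I. f i x)"
  by (induction I rule: infinite_finite_induct) auto

lemma linear_form_scale: "linear_form scl l \<Longrightarrow> l (scl t v) = t * l v"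
  by (simp add: linear_form_def Vector_Spaces.linear_iff)

lemma linear_form_comp: "linear_form scl l \<Longrightarrow> Vector_Spaces.linear scl scl T \<Longrightarrow> linear_form scl (l \<circ> T)"
  by (simp add: linear_form_def Vector_Spaces.linear_iff)

lemma subspace_hom_poly:
  fixes scl :: "'k::field \<Rightarrow> 'v::ab_group_add \<Rightarrow> 'v"
  shows "funs.subspace (hom_poly scl d)"
proof (cases d)
  case 0
  have "funs.subspace (range (\<lambda>(c::'k) (v::'v). c))"
    by (intro funs.subspaceI) (auto simp: fun_eq_iff zero_fun_def plus_fun_def)
  then show ?thesis using 0 by simp
qed simp

lemma subspace_poly_funs: "funs.subspace (poly_funs scl)"
  by (simp add: poly_funs_def)

lemmas lin_sub_hom_poly = subspace_hom_poly[folded lin_sub_fun_iff]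
lemmas lin_sub_poly_funs = subspace_poly_funs[folded lin_sub_fun_iff]

lemma hom_poly_subset: "hom_poly scl d \<subseteq> poly_funs scl"
  unfolding poly_funs_def by (auto intro: funs.span_base)

lemma const_hom_poly: "(\<lambda>v. c) \<in> hom_poly scl 0"
  by simp

lemma linear_form_mult_hom_poly:
  "linear_form scl l \<Longrightarrow> f \<in> hom_poly scl d \<Longrightarrow> l * f \<in> hom_poly scl (Suc d)"
  by (auto intro: funs.span_base)

lemma linear_form_power_mult_hom_poly:
  "linear_form scl l \<Longrightarrow> f \<in> hom_poly scl d \<Longrightarrow> l ^ n * f \<in> hom_poly scl (d + n)"
proof (induction n)
  case (Suc n)
  then have "l * (l ^ n * f) \<in> hom_poly scl (Suc (d + n))"
    by (intro linear_form_mult_hom_poly Suc.IH)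
  then show ?case by (simp only: power_Suc mult.assoc add_Suc_right)
qed simp

text \<open>The scalar of the span is pushed into the factor of degree d, so that an induction
  hypothesis about \<open>hom_poly scl d\<close> applies to that factor directly.\<close>

lemma hom_poly_Suc_induct [consumes 1, case_names zero add mult]:
  assumes "f \<in> hom_poly scl (Suc d)"
    and "V 0" "\<And>x y. V x \<Longrightarrow> V y \<Longrightarrow> V (x + y)"
    and "\<And>c l f. linear_form scl l \<Longrightarrow> f \<in> hom_poly scl d \<Longrightarrow> V (l * (\<lambda>v. c * f v))"
  shows "V f"
  using assms(1)[unfolded hom_poly.simps]
proof (induction rule: funs.span_induct_alt)
  case (step c x y)
  then obtain l f where "x = l * f" "linear_form scl l" "f \<in> hom_poly scl d" by blast
  moreover have "(\<lambda>v. c * (l * f) v) = l * (\<lambda>v. c * f v)"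
    by (simp add: fun_eq_iff algebra_simps)
  ultimately show ?case using step assms(3,4) by metis
qed (fact assms)

lemma hom_poly_scale: "f \<in> hom_poly scl d \<Longrightarrow> f (scl t v) = t ^ d * f v"
proof (induction d arbitrary: f)
  case (Suc d)
  from Suc.prems show ?case
  proof (induction rule: hom_poly_Suc_induct)
    case (mult c l f)
    then show ?case using Suc.IH[OF mult(2)] by (simp add: linear_form_scale)
  qed (auto simp: algebra_simps)
qed auto

lemma hom_poly_comp:
  fixes scl :: "'k::field \<Rightarrow> 'v::ab_group_add \<Rightarrow> 'v"
  assumes T: "Vector_Spaces.linear scl scl T"
  shows "f \<in> hom_poly scl d \<Longrightarrow> f \<circ> T \<in> hom_poly scl d"
proof (induction d arbitrary: f)
  case (Suc d)
  from Suc.prems show ?case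
  proof (induction rule: hom_poly_Suc_induct)
    case zero
    have "0 \<circ> T = (0 :: 'v \<Rightarrow> 'k)" by (simp add: fun_eq_iff)
    then show ?case using funs.subspace_0[OF subspace_hom_poly] by metis
  next
    case (add x y)
    then have "(x \<circ> T) + (y \<circ> T) \<in> hom_poly scl (Suc d)" by (rule funs.subspace_add[OF subspace_hom_poly])
    then show ?case by (simp add: plus_fun_def o_def)
  next
    case (mult c l f)
    have "(l \<circ> T) * (\<lambda>v. c * (f \<circ> T) v) \<in> hom_poly scl (Suc d)"
      using mult Suc.IH
      by (intro linear_form_mult_hom_poly linear_form_comp T funs.subspace_scale[OF subspace_hom_poly])
    then show ?case by (simp add: o_def times_fun_def)
  qed
qed (auto simp: o_def)

lemma hom_poly_mult:
  "f \<in> hom_poly scl d \<Longrightarrow> g \<in> hom_poly scl e \<Longrightarrow> f * g \<in> hom_poly scl (d + e)"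
proof (induction d arbitrary: f)
  case 0
  then obtain c where "f = (\<lambda>v. c)" by auto
  then show ?case
    using funs.subspace_scale[OF subspace_hom_poly 0(2), of c] by (simp add: times_fun_def)
next
  case (Suc d)
  from Suc.prems(1) show ?case
  proof (induction rule: hom_poly_Suc_induct)
    case (mult c l f)
    have "l * ((\<lambda>v. c * f v) * g) \<in> hom_poly scl (Suc (d + e))"
      using mult Suc.prems(2)
      by (intro linear_form_mult_hom_poly Suc.IH funs.subspace_scale[OF subspace_hom_poly])
    then show ?case by (simp only: mult.assoc add_Suc)
  qed (use funs.subspace_0[OF subspace_hom_poly] funs.subspace_add[OF subspace_hom_poly] in
      \<open>auto simp only: distrib_right mult_zero_left\<close>)
qed

text \<open>The components form a total sequence that vanishes from n on, so that decompositions of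
  different lengths can be padded to a common length.\<close>

lemma poly_funs_decomp:
  assumes "f \<in> poly_funs scl"
  obtains F n where "\<And>d. F d \<in> hom_poly scl d" "\<And>d. d \<ge> n \<Longrightarrow> F d = 0" "f = (\<Sum>d<n. F d)"
proof -
  have "\<exists>F n. (\<forall>d. F d \<in> hom_poly scl d) \<and> (\<forall>d\<ge>n. F d = 0) \<and> f = (\<Sum>d<n. F d)"
    using assms[unfolded poly_funs_def]
  proof (induction rule: funs.span_induct_alt)
    case base
    have "\<And>d. 0 \<in> hom_poly scl d" by (rule funs.subspace_0[OF subspace_hom_poly])
    then show ?case by (intro exI[of _ "\<lambda>d. 0"] exI[of _ 0] conjI allI impI; (assumption | simp))
  next
    case (step c x y)
    from step(2) obtain F n
      where F: "\<And>d. F d \<in> hom_poly scl d" "\<And>d. d \<ge> n \<Longrightarrow> F d = 0" "y = (\<Sum>d<n. F d)" by blast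
    from step(1) obtain e where e: "x \<in> hom_poly scl e" by blast
    let ?F = "\<lambda>d. F d + (if d = e then (\<lambda>v. c * x v) else 0)"
    let ?n = "max n (Suc e)"
    have "(\<lambda>v. c * x v) \<in> hom_poly scl e" by (rule funs.subspace_scale[OF subspace_hom_poly e])
    then have "?F d \<in> hom_poly scl d" for d
      using F(1)[of d] funs.subspace_add[OF subspace_hom_poly F(1), of _ e] by (cases "d = e") auto
    moreover have "?F d = 0" if "d \<ge> ?n" for d using F(2) that by auto
    moreover have "(\<lambda>v. c * x v) + y = (\<Sum>d<?n. ?F d)"
    proof -
      have "(\<Sum>d<?n. F d) = y"
        unfolding F(3) using F(2) by (intro sum.mono_neutral_right) auto
      then show ?thesis by (simp add: sum.distrib add.commute)
    qed
    ultimately show ?case by (intro exI[of _ ?F] exI[of _ ?n] conjI allI impI)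
  qed
  then show thesis using that by blast
qed

lemma poly_funs_mult:
  assumes f: "f \<in> poly_funs scl" and g: "g \<in> poly_funs scl"
  shows "f * g \<in> poly_funs scl"
proof -
  obtain F n where F: "\<And>d. F d \<in> hom_poly scl d" "f = (\<Sum>d<n. F d)"
    using poly_funs_decomp[OF f] by metis
  obtain G m where G: "\<And>d. G d \<in> hom_poly scl d" "g = (\<Sum>d<m. G d)"
    using poly_funs_decomp[OF g] by metis
  show ?thesis unfolding F(2) G(2) sum_product
    using hom_poly_mult[OF F(1) G(1)] hom_poly_subset
    by (intro funs.subspace_sum[OF subspace_poly_funs]) blast
qed

lemma const_poly_funs: "(\<lambda>v. c) \<in> poly_funs scl"
  using hom_poly_subset[of scl 0] const_hom_poly by blast

lemma one_poly_funs: "1 \<in> poly_funs scl"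
  using const_poly_funs[of 1] by (simp add: one_fun_def)

lemma linear_form_poly_funs:
  assumes "linear_form scl l" shows "l \<in> poly_funs scl"
proof -
  have "l * (\<lambda>v. 1) \<in> hom_poly scl 1"
    using linear_form_mult_hom_poly[OF assms const_hom_poly] by simp
  then show ?thesis using hom_poly_subset[of scl 1] by (auto simp: times_fun_def)
qed

lemma poly_funs_comp:
  assumes T: "Vector_Spaces.linear scl scl T" and f: "f \<in> poly_funs scl"
  shows "f \<circ> T \<in> poly_funs scl"
proof -
  obtain F n where F: "\<And>d. F d \<in> hom_poly scl d" "f = (\<Sum>d<n. F d)"
    using poly_funs_decomp[OF f] by metis
  have "f \<circ> T = (\<Sum>d<n. F d \<circ> T)" by (simp add: F(2) fun_eq_iff fun_sum_apply)
  then show ?thesis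
    using hom_poly_comp[OF T F(1)] hom_poly_subset
    by (auto intro!: funs.subspace_sum[OF subspace_poly_funs])
qed

text \<open>Evaluating \<open>\<Sum> h\<^sub>d = 0\<close> at \<open>t v\<close> gives a polynomial in \<open>t\<close> that vanishes on the infinite field.\<close>

lemma hom_poly_independent:
  fixes scl :: "'k::field_char_0 \<Rightarrow> 'v::ab_group_add \<Rightarrow> 'v"
  assumes h: "\<And>d. h d \<in> hom_poly scl d" and 0: "(\<Sum>d<n. h d) = 0" and d: "d < n"
  shows "h d = 0"
proof
  fix v
  define p where "p = (\<Sum>d<n. Polynomial.monom (h d v) d)"
  have "poly p t = 0" for t
  proof -
    have "poly p t = (\<Sum>d<n. h d (scl t v))"
      by (simp add: p_def poly_sum poly_monom hom_poly_scale[OF h] mult.commute)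
    also have "\<dots> = (\<Sum>d<n. h d) (scl t v)" by (simp add: fun_sum_apply)
    finally show ?thesis by (simp add: 0)
  qed
  then have "p = 0" using poly_all_0_iff_0 by blast
  then have "Polynomial.coeff p d = 0" by simp
  then show "h d v = 0 v" using d by (simp add: p_def coeff_sum)
qed

subsection \<open>Quasi-invariants of a single reflection\<close>

lemma quasi_inv1_poly: "f \<in> quasi_inv1 scl l T m \<Longrightarrow> f \<in> poly_funs scl"
  by (simp add: quasi_inv1_def)

lemma quasi_inv1I:
  "f \<in> poly_funs scl \<Longrightarrow> g \<in> poly_funs scl \<Longrightarrow> (f \<circ> inv_into UNIV T) - f = l ^ (2 * m) * g
    \<Longrightarrow> f \<in> quasi_inv1 scl l T m"
  by (auto simp: quasi_inv1_def)

lemma subspace_quasi_inv1: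
  fixes scl :: "'k::field \<Rightarrow> 'v::ab_group_add \<Rightarrow> 'v"
  shows "funs.subspace (quasi_inv1 scl l T m)"
proof (rule funs.subspaceI)
  note P = subspace_poly_funs
  show "0 \<in> quasi_inv1 scl l T m"
    by (rule quasi_inv1I[OF funs.subspace_0[OF P] funs.subspace_0[OF P]]) (simp add: fun_eq_iff)
  fix f assume "f \<in> quasi_inv1 scl l T m"
  then obtain u where f: "f \<in> poly_funs scl" "u \<in> poly_funs scl"
      "(f \<circ> inv_into UNIV T) - f = l ^ (2 * m) * u"
    unfolding quasi_inv1_def by blast
  show "(\<lambda>v. c * f v) \<in> quasi_inv1 scl l T m" for c
  proof (rule quasi_inv1I[OF funs.subspace_scale[OF P f(1)] funs.subspace_scale[OF P f(2)]])
    have "((\<lambda>v. c * f v) \<circ> inv_into UNIV T) - (\<lambda>v. c * f v) = (\<lambda>v. c) * ((f \<circ> inv_into UNIV T) - f)"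
      by (simp add: fun_eq_iff algebra_simps)
    also have "\<dots> = l ^ (2 * m) * (\<lambda>v. c * u v)"
      unfolding f(3) by (simp add: fun_eq_iff algebra_simps)
    finally show "((\<lambda>v. c * f v) \<circ> inv_into UNIV T) - (\<lambda>v. c * f v) = l ^ (2 * m) * (\<lambda>v. c * u v)" .
  qed
  fix g assume "g \<in> quasi_inv1 scl l T m"
  then obtain w where g: "g \<in> poly_funs scl" "w \<in> poly_funs scl"
      "(g \<circ> inv_into UNIV T) - g = l ^ (2 * m) * w"
    unfolding quasi_inv1_def by blast
  show "f + g \<in> quasi_inv1 scl l T m"
  proof (rule quasi_inv1I[OF funs.subspace_add[OF P f(1) g(1)] funs.subspace_add[OF P f(2) g(2)]])
    have "((f + g) \<circ> inv_into UNIV T) - (f + g) = ((f \<circ> inv_into UNIV T) - f) + ((g \<circ> inv_into UNIV T) - g)"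
      by (simp add: fun_eq_iff algebra_simps)
    also have "\<dots> = l ^ (2 * m) * (u + w)" unfolding f(3) g(3) by (simp add: distrib_left)
    finally show "((f + g) \<circ> inv_into UNIV T) - (f + g) = l ^ (2 * m) * (u + w)" .
  qed
qed

lemma const_quasi_inv1: "(\<lambda>v. c) \<in> quasi_inv1 scl l T m"
  by (rule quasi_inv1I[OF const_poly_funs funs.subspace_0[OF subspace_poly_funs]])
    (simp add: fun_eq_iff)

locale linear_involution =
  fixes scl :: "'k::field_char_0 \<Rightarrow> 'v::ab_group_add \<Rightarrow> 'v" and l :: "'v \<Rightarrow> 'k" and T :: "'v \<Rightarrow> 'v"
  assumes form: "linear_form scl l" and linear: "Vector_Spaces.linear scl scl T" and invol: "T \<circ> T = id"
begin

lemma inv_eq: "inv_into UNIV T = T"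
  using invol by (metis comp_apply id_apply inv_unique_comp)

lemma quasi_inv1_iff:
  "f \<in> quasi_inv1 scl l T m \<longleftrightarrow> f \<in> poly_funs scl \<and> (\<exists>g\<in>poly_funs scl. (f \<circ> T) - f = l ^ (2 * m) * g)"
  by (simp add: quasi_inv1_def inv_eq)

text \<open>Twisted Leibniz rule: \<open>s(fg) - fg = (s(f) - f) s(g) + f (s(g) - g)\<close>, and
  both terms are divisible by the same power of \<open>l\<close>.\<close>

lemma quasi_inv1_mult:
  assumes "f \<in> quasi_inv1 scl l T m" "g \<in> quasi_inv1 scl l T m"
  shows "f * g \<in> quasi_inv1 scl l T m"
proof -
  from assms obtain u w where f: "f \<in> poly_funs scl" "u \<in> poly_funs scl" "(f \<circ> T) - f = l ^ (2 * m) * u"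
    and g: "g \<in> poly_funs scl" "w \<in> poly_funs scl" "(g \<circ> T) - g = l ^ (2 * m) * w"
    unfolding quasi_inv1_iff by blast
  have "((f * g) \<circ> T) - f * g = ((f \<circ> T) - f) * (g \<circ> T) + f * ((g \<circ> T) - g)"
    by (simp add: fun_eq_iff algebra_simps)
  also have "\<dots> = l ^ (2 * m) * (u * (g \<circ> T) + f * w)"
    unfolding f(3) g(3) by (simp add: algebra_simps)
  finally have "((f * g) \<circ> T) - f * g = l ^ (2 * m) * (u * (g \<circ> T) + f * w)" .
  moreover have "u * (g \<circ> T) + f * w \<in> poly_funs scl"
    using f g by (intro funs.subspace_add[OF subspace_poly_funs] poly_funs_mult poly_funs_comp[OF linear])
  ultimately show ?thesis
    using poly_funs_mult[OF f(1) g(1)] by (intro quasi_inv1I) (simp_all only: inv_eq)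
qed

text \<open>Both sides of \<open>s(f) - f = l ^ (2 * m) * u\<close> can be compared degree by
  degree, as s preserves degrees and the factor shifts them by 2m. This is why the quasi-invariants
  are the sum of their homogeneous parts, which \<open>carrier_H_ev\<close> needs.\<close>

lemma quasi_inv1_graded:
  assumes f: "(\<Sum>d<n. F d) \<in> quasi_inv1 scl l T m"
    and F: "\<And>d. F d \<in> hom_poly scl d" "\<And>d. d \<ge> n \<Longrightarrow> F d = 0"
  shows "F d \<in> quasi_inv1 scl l T m"
proof -
  note V = subspace_hom_poly
  from f obtain u where u: "u \<in> poly_funs scl" "((\<Sum>d<n. F d) \<circ> T) - (\<Sum>d<n. F d) = l ^ (2 * m) * u"
    unfolding quasi_inv1_iff by blast
  from poly_funs_decomp[OF u(1)] obtain U n'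
    where U: "\<And>d. U d \<in> hom_poly scl d" "\<And>d. d \<ge> n' \<Longrightarrow> U d = 0" "u = (\<Sum>d<n'. U d)" by metis
  \<comment> \<open>Reindexed by the degree after multiplication: \<open>l ^ (2 * m) * U' d\<close>
    is the component of degree d of the right-hand side, and there is none below 2m.\<close>
  define U' where "U' d = (if d < 2 * m then 0 else U (d - 2 * m))" for d
  define h where "h d = (F d \<circ> T) - F d - l ^ (2 * m) * U' d" for d
  \<comment> \<open>Large enough to cover all components of f and all shifted components of
    u.\<close>
  define N where "N = n + n' + 2 * m"
  have lU': "l ^ (2 * m) * U' d \<in> hom_poly scl d" for d
  proof (cases "d < 2 * m")
    case True
    then show ?thesis using funs.subspace_0[OF V] by (simp only: U'_def if_True mult_zero_right)
  next
    case False
    then show ?thesis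
      using linear_form_power_mult_hom_poly[OF form U(1), of "2 * m" "d - 2 * m"] by (simp add: U'_def)
  qed
  have h: "h d \<in> hom_poly scl d" for d
    unfolding h_def by (intro funs.subspace_diff[OF V] hom_poly_comp[OF linear] F(1) lU')
  have sF: "(\<Sum>d<N. F d) = (\<Sum>d<n. F d)"
    by (intro sum.mono_neutral_right) (auto simp: N_def F(2))
  have "(\<Sum>d<N. U' d) = (\<Sum>d=2*m..<N. U' d)"
    by (intro sum.mono_neutral_right) (auto simp: U'_def)
  also have "\<dots> = (\<Sum>d<n + n'. U d)"
    by (rule sum.reindex_bij_witness[of _ "\<lambda>d. d + 2 * m" "\<lambda>d. d - 2 * m"]) (auto simp: N_def U'_def)
  also have "\<dots> = u" unfolding U(3) by (intro sum.mono_neutral_right) (auto simp: U(2))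
  finally have sU: "(\<Sum>d<N. U' d) = u" .
  have "(\<Sum>d<N. h d) = ((\<Sum>d<N. F d) \<circ> T) - (\<Sum>d<N. F d) - l ^ (2 * m) * (\<Sum>d<N. U' d)"
  proof -
    have "(\<Sum>d<N. F d) \<circ> T = (\<Sum>d<N. F d \<circ> T)" by (rule ext) (simp add: fun_sum_apply)
    then show ?thesis by (simp only: h_def sum_subtractf sum_distrib_left)
  qed
  also have "\<dots> = 0" by (simp only: sF sU u(2) diff_self)
  finally have sum0: "(\<Sum>d<N. h d) = 0" .
  show ?thesis
  proof (cases "d < N")
    case True
    then have "(F d \<circ> T) - F d = l ^ (2 * m) * U' d"
      using hom_poly_independent[OF h sum0 True] by (simp only: h_def right_minus_eq)
    moreover have "U' d \<in> poly_funs scl"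
      using U(1) hom_poly_subset funs.subspace_0[OF subspace_poly_funs] by (auto simp: U'_def)
    moreover have "F d \<in> poly_funs scl" using F(1) hom_poly_subset by blast
    ultimately show ?thesis by (intro quasi_inv1I[of _ _ "U' d"]) (simp_all only: inv_eq)
  next
    case False
    then show ?thesis using F(2) funs.subspace_0[OF subspace_quasi_inv1] by (simp add: N_def)
  qed
qed

end

subsection \<open>Polynomials in the barycentric coordinates\<close>

abbreviation pvar :: "'i \<Rightarrow> ('i \<Rightarrow>\<^sub>0 nat) \<Rightarrow>\<^sub>0 'r::comm_ring_1" where
  "pvar i \<equiv> single (single i 1) 1"

abbreviation vertex :: "'i \<Rightarrow> 'i \<Rightarrow> 'r::comm_ring_1" where
  "vertex i \<equiv> \<lambda>j. if j = i then 1 else 0"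

lemma poly_mapping_sum_single:
  "p = (\<Sum>m\<in>keys p. single m (lookup p m))"
proof (rule poly_mapping_eqI)
  fix m
  have "(\<Sum>m'\<in>keys p. lookup (single m' (lookup p m')) m)
      = (\<Sum>m'\<in>keys p. if m = m' then lookup p m' else 0)"
    by (intro sum.cong) (auto simp: lookup_single)
  also have "\<dots> = lookup p m"
    by (simp add: sum.delta in_keys_iff)
  finally show "lookup p m = lookup
      (\<Sum>m\<in>keys p. single m (lookup p m)) m"
    by (simp add: lookup_sum)
qed

lemma poly_mapping_single_induct [case_names zero single add]:
  fixes p :: "'a \<Rightarrow>\<^sub>0 'b::comm_monoid_add"
  assumes "V 0" "\<And>m c. m \<in> keys p \<Longrightarrow> c = lookup p m \<Longrightarrow> V (single m c)"
    and "\<And>p q. V p \<Longrightarrow> V q \<Longrightarrow> V (p + q)"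
  shows "V p"
proof -
  have "V (\<Sum>m\<in>F. single m (lookup p m))" if "F \<subseteq> keys p" for F
    using finite_subset[OF that finite_keys] that assms
    by (induction F rule: finite_induct) auto
  then show ?thesis by (subst poly_mapping_sum_single) blast
qed

definition pm_over :: "'i set \<Rightarrow> 'r::comm_ring_1 set \<Rightarrow> (('i \<Rightarrow>\<^sub>0 nat) \<Rightarrow>\<^sub>0 'r) set" where
  "pm_over A V = {p. \<forall>m\<in>keys p. keys m \<subseteq> A \<and> lookup p m \<in> V}"

lemma pm_over_iff:
  "0 \<in> V \<Longrightarrow> p \<in> pm_over A V \<longleftrightarrow>
    (\<forall>m. lookup p m \<in> V \<and> (lookup p m \<noteq> 0 \<longrightarrow> keys m \<subseteq> A))"
  by (auto simp: pm_over_def in_keys_iff)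

lemma pm_over_mono: "V \<subseteq> V' \<Longrightarrow> pm_over A V \<subseteq> pm_over A V'"
  unfolding pm_over_def by blast

lemma pm_over_zero: "0 \<in> pm_over A V"
  by (simp add: pm_over_def)

lemma pm_over_single: "keys m \<subseteq> A \<Longrightarrow> c \<in> V \<Longrightarrow> single m c \<in> pm_over A V"
  by (auto simp: pm_over_def split: if_splits)

lemma pm_over_diff:
  assumes "lin_sub sc V" "p \<in> pm_over A V" "q \<in> pm_over A V"
  shows "p - q \<in> pm_over A V"
  unfolding pm_over_iff[OF lin_sub_zero[OF assms(1)]]
proof (intro allI conjI impI)
  fix m
  note over = pm_over_iff[OF lin_sub_zero[OF assms(1)]]
  show "lookup (p - q) m \<in> V"
    using assms(2,3) unfolding over lookup_minus by (intro lin_sub_diff[OF assms(1)]) auto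
  assume "lookup (p - q) m \<noteq> 0"
  then have "lookup p m \<noteq> 0 \<or> lookup q m \<noteq> 0"
    by (auto simp: lookup_minus)
  then show "keys m \<subseteq> A" using assms(2,3) unfolding over by blast
qed

lemma pm_over_add:
  assumes "lin_sub sc V" "p \<in> pm_over A V" "q \<in> pm_over A V"
  shows "p + q \<in> pm_over A V"
  using pm_over_diff[OF assms(1,2) pm_over_diff[OF assms(1) pm_over_zero assms(3)]] by simp

lemma pm_over_sum:
  "lin_sub sc V \<Longrightarrow> (\<And>x. x \<in> F \<Longrightarrow> f x \<in> pm_over A V) \<Longrightarrow> sum f F \<in> pm_over A V"
  by (induction F rule: infinite_finite_induct) (auto simp: pm_over_zero intro: pm_over_add)

text \<open>Three coefficient spaces, so that the lemma also says that polynomials with constant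
  coefficients act on polynomials with coefficients in any subspace.\<close>

lemma pm_over_mult:
  assumes V: "lin_sub sc V''" and mult: "\<And>a b. a \<in> V \<Longrightarrow> b \<in> V' \<Longrightarrow> a * b \<in> V''"
    and p: "p \<in> pm_over A V" and q: "q \<in> pm_over A V'"
  shows "p * q \<in> pm_over A V''"
proof -
  have "p * q = (\<Sum>m\<in>keys p. \<Sum>n\<in>keys q.
      single (m + n) (lookup p m * lookup q n))"
    by (subst (1) poly_mapping_sum_single[of p], subst (1) poly_mapping_sum_single[of q])
      (simp add: sum_product mult_single)
  also have "\<dots> \<in> pm_over A V''"
  proof (intro pm_over_sum[OF V] pm_over_single)
    fix m n assume "m \<in> keys p" "n \<in> keys q"
    then have "lookup p m \<in> V" "lookup q n \<in> V'"
      and "keys m \<subseteq> A" "keys n \<subseteq> A"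
      using p q by (auto simp: pm_over_def)
    then show "lookup p m * lookup q n \<in> V''" "keys (m + n) \<subseteq> A"
      using keys_add[of m n] mult by blast+
  qed
  finally show ?thesis .
qed

lemma lookup_partial:
  fixes p :: "('i \<Rightarrow>\<^sub>0 nat) \<Rightarrow>\<^sub>0 'r::comm_ring_1"
  shows "lookup (partial i p) m
    = of_nat (lookup m i + 1) * lookup p (m + single i 1)"
proof -
  let ?e = "single i (1::nat)"
  \<comment> \<open>The truncated subtraction \<open>m' - ?e\<close> is wrong only if
    \<open>m'\<close> does not contain the variable i, and then the factor \<open>of_nat 0\<close>
    removes the term.\<close>
  have "lookup (single (m' - ?e) (of_nat (lookup m' i) * c)) m
      = (if m + ?e = m' then of_nat (lookup m i + 1) * c else 0)" for m' and c :: 'r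
  proof (cases "lookup m' i = 0")
    case True
    then have "m + ?e \<noteq> m'" by (metis lookup_add lookup_single_eq add_is_0 one_neq_zero)
    then show ?thesis using True by simp
  next
    case False
    then have "m' = (m' - ?e) + ?e"
      by (intro poly_mapping_eqI) (auto simp: lookup_add lookup_minus lookup_single when_def)
    then have "m' - ?e = m \<longleftrightarrow> m + ?e = m'" by (metis add_diff_cancel_right')
    then show ?thesis by (auto simp: lookup_single lookup_add)
  qed
  then have "lookup (partial i p) m = (\<Sum>m'\<in>keys p.
      if m + ?e = m' then of_nat (lookup m i + 1) * lookup p m' else 0)"
    unfolding partial_def lookup_sum by simp
  also have "\<dots> = of_nat (lookup m i + 1) * lookup p (m + ?e)"
    by (simp add: sum.delta in_keys_iff)
  finally show ?thesis .
qed

lemma partial_zero [simp]: "partial i 0 = 0"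
  by (intro poly_mapping_eqI) (simp add: lookup_partial)

lemma partial_add: "partial i (p + q) = partial i p + partial i q"
  by (intro poly_mapping_eqI) (simp add: lookup_partial lookup_add algebra_simps)

lemma partial_uminus: "partial i (- p) = - partial i p"
  by (intro poly_mapping_eqI) (simp add: lookup_partial)

lemma partial_sum: "partial i (\<Sum>x\<in>F. f x) = (\<Sum>x\<in>F. partial i (f x))"
  by (induction F rule: infinite_finite_induct) (simp_all add: partial_add)

lemma partial_commute: "partial i (partial j p) = partial j (partial i p)"
proof (cases "i = j")
  case False
  then show ?thesis
    by (intro poly_mapping_eqI)
      (simp add: lookup_partial lookup_add lookup_single ac_simps)
qed simp

lemma partial_single:
  "partial i (single m c)
    = single (m - single i 1) (of_nat (lookup m i) * c)"
  by (simp add: partial_def)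

lemma partial_mult:
  fixes p :: "('i \<Rightarrow>\<^sub>0 nat) \<Rightarrow>\<^sub>0 'r::comm_ring_1"
  shows "partial i (p * q) = partial i p * q + p * partial i q"
proof (induction p rule: poly_mapping_single_induct)
  case (single m c)
  show ?case
  proof (induction q rule: poly_mapping_single_induct)
    case (single n b)
    let ?e = "single i (1::nat)"
    have diff: "(m' - ?e) + n' = m' + n' - ?e" if "lookup m' i \<noteq> 0" for m' n'
      using that by (intro poly_mapping_eqI) (auto simp: lookup_add lookup_minus lookup_single when_def)
    have l: "single ((m' - ?e) + n') (of_nat (lookup m' i) * x)
      = single (m' + n' - ?e) (of_nat (lookup m' i) * x)" for m' n' and x :: 'r
      by (cases "lookup m' i = 0") (simp_all add: diff del: One_nat_def)
    have "partial i (single m c * single n b)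
        = single (m + n - ?e) (of_nat (lookup m i) * (c * b))
        + single (n + m - ?e) (of_nat (lookup n i) * (c * b))"
      by (simp add: mult_single partial_single single_add[symmetric] lookup_add algebra_simps)
    also have "\<dots> = partial i (single m c) * single n b
        + single m c * partial i (single n b)"
      unfolding l[symmetric] by (simp add: mult_single partial_single ac_simps)
    finally show ?case .
  qed (simp_all add: partial_add algebra_simps)
qed (simp_all add: partial_add algebra_simps)

lemma partial_pvar: "partial i (pvar j) = (if i = j then 1 else 0)"
  by (simp add: partial_single lookup_single)

lemma partial_one [simp]: "partial i 1 = 0"
  using partial_single[of i 0 1] by simp

lemma partial_over:
  assumes V: "lin_sub (\<lambda>c f v. c * f v) V" and p: "p \<in> pm_over A V"
  shows "partial i p \<in> pm_over A V"
proof -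
  note 0 = lin_sub_zero[OF V]
  have "of_nat n * f \<in> V" if "f \<in> V" for n f
    using lin_sub_add[OF V] that 0 by (induction n) (auto simp: distrib_right)
  moreover have "keys m \<subseteq> A"
    if "lookup p (m + single i 1) \<noteq> 0" for m
  proof -
    have "keys m \<subseteq> keys (m + single i 1)"
      by (auto simp: in_keys_iff lookup_add)
    then show ?thesis using p that by (auto simp: pm_over_iff[OF 0])
  qed
  ultimately show ?thesis
    using p unfolding pm_over_iff[OF 0] lookup_partial by (metis mult_zero_right)
qed

lemma partial_outside:
  fixes p :: "('i \<Rightarrow>\<^sub>0 nat) \<Rightarrow>\<^sub>0 'r::comm_ring_1"
  assumes "p \<in> pm_over A V" "i \<notin> A"
  shows "partial i p = 0"
proof (rule poly_mapping_eqI)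
  fix m :: "'i \<Rightarrow>\<^sub>0 nat"
  have "i \<in> keys (m + single i 1)"
    unfolding in_keys_iff lookup_add lookup_single_eq by simp
  then have "m + single i 1 \<notin> keys p"
    using assms unfolding pm_over_def by blast
  then show "lookup (partial i p) m = lookup 0 m"
    by (simp add: lookup_partial in_keys_iff)
qed

text \<open>The Euler operator of one variable is diagonal on monomials, with the exponent as
  eigenvalue. Summed over the variables it produces the polynomial degree in the Poincare
  lemma.\<close>

lemma lookup_pvar_partial:
  "lookup (pvar i * partial i p) m
    = of_nat (lookup m i) * lookup p m"
proof (induction p rule: poly_mapping_single_induct)
  case (single n c)
  let ?e = "single i (1::nat)"
  have "?e + (n - ?e) = n" if "lookup n i \<noteq> 0"
    using that by (intro poly_mapping_eqI) (auto simp: lookup_add lookup_minus lookup_single when_def)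
  then have "pvar i * partial i (single n c)
      = single n (of_nat (lookup n i) * c)"
    by (cases "lookup n i = 0") (simp_all add: mult_single partial_single)
  then show ?case by (simp add: lookup_single when_def)
qed (simp_all add: partial_add lookup_add algebra_simps)

section \<open>Evaluation at points, in particular at the vertices\<close>

lemma poly_eval_add: "poly_eval a (p + q) = poly_eval a p + poly_eval a q"
  unfolding poly_eval_def
  by (rule setsum_keys_plus_distrib[where f = "\<lambda>m c. c * (\<Prod>j\<in>keys m. a j ^ lookup m j)"])
    (simp_all add: algebra_simps)

lemma poly_eval_zero [simp]: "poly_eval a 0 = 0"
  by (simp add: poly_eval_def)

lemma poly_eval_diff: "poly_eval a (p - q) = poly_eval a p - poly_eval a q"
  using poly_eval_add[of a "p - q" q] by simp

lemma poly_eval_sum: "poly_eval a (\<Sum>x\<in>F. f x) = (\<Sum>x\<in>F. poly_eval a (f x))"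
  by (induction F rule: infinite_finite_induct) (simp_all add: poly_eval_add)

lemma poly_eval_single:
  "poly_eval a (single m c) = c * (\<Prod>j\<in>keys m. a j ^ lookup m j)"
  by (simp add: poly_eval_def)

lemma poly_eval_const: "poly_eval a (single 0 c) = c"
  by (simp add: poly_eval_single)

lemma poly_eval_one [simp]: "poly_eval a 1 = 1"
  using poly_eval_const[of a 1] by simp

lemma poly_eval_mult: "poly_eval a (p * q) = poly_eval a p * poly_eval a q"
proof (induction p rule: poly_mapping_single_induct)
  case (single m c)
  show ?case
  proof (induction q rule: poly_mapping_single_induct)
    case (single n b)
    let ?mon = "\<lambda>m. \<Prod>j\<in>keys m. a j ^ lookup m j"
    let ?I = "keys m \<union> keys n"
    have mon: "?mon m' = (\<Prod>j\<in>?I. a j ^ lookup m' j)" if "keys m' \<subseteq> ?I" for m'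
      using that by (intro prod.mono_neutral_left) (auto simp: in_keys_iff)
    have "?mon (m + n) = ?mon m * ?mon n"
      by (subst (1 2 3) mon) (use keys_add[of m n] in \<open>auto simp: lookup_add power_add prod.distrib\<close>)
    then show ?case by (simp add: mult_single poly_eval_single ac_simps)
  qed (simp_all add: poly_eval_add algebra_simps)
qed (simp_all add: poly_eval_add algebra_simps)

lemma poly_eval_pvar: "poly_eval a (pvar i) = a i"
  by (simp add: poly_eval_single)

lemma vertex_monomial:
  fixes m :: "'i \<Rightarrow>\<^sub>0 nat"
  shows "(\<Prod>j\<in>keys m. vertex i j ^ lookup m j)
    = (if keys m \<subseteq> {i} then 1 else (0 :: 'r::comm_ring_1))"
proof (cases "keys m \<subseteq> {i}")
  case True
  then show ?thesis by (auto intro!: prod.neutral)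
next
  case False
  then obtain j where "j \<in> keys m" "j \<noteq> i" by blast
  then have "(\<Prod>j\<in>keys m. vertex i j ^ lookup m j) = (0 :: 'r)"
    by (intro prod_zero) (auto simp: in_keys_iff zero_power intro!: bexI[of _ j])
  then show ?thesis by (simp only: False if_False)
qed

text \<open>A vertex has coordinates 0 and 1, so the value is a sum of coefficients of
  \<open>p\<close>. Hence homogeneous coefficients give homogeneous vertex values.\<close>

lemma poly_eval_vertex_in:
  assumes V: "lin_sub sc V" and p: "p \<in> pm_over A V"
  shows "poly_eval (vertex i) p \<in> V"
  unfolding poly_eval_def vertex_monomial
proof (rule lin_sub_sum[OF V])
  fix m assume "m \<in> keys p"
  then have "lookup p m \<in> V" using p by (auto simp: pm_over_def)
  then show "lookup p m * (if keys m \<subseteq> {i} then 1 else 0) \<in> V"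
    using lin_sub_zero[OF V] by (simp split: if_split)
qed

subsection \<open>The exterior algebra\<close>

definition form_support :: "'i set \<Rightarrow> ('i, 'r::comm_ring_1) form set" where
  "form_support A = {w. \<forall>K. w K \<noteq> 0 \<longrightarrow> K \<subseteq> A}"

definition fscale :: "(('i \<Rightarrow>\<^sub>0 nat) \<Rightarrow>\<^sub>0 'r::comm_ring_1) \<Rightarrow> ('i, 'r) form \<Rightarrow> ('i, 'r) form" where
  "fscale p w = (\<lambda>K. p * w K)"

definition pderiv_form :: "'i \<Rightarrow> ('i, 'r::comm_ring_1) form \<Rightarrow> ('i, 'r) form" where
  "pderiv_form i w = (\<lambda>K. partial i (w K))"

text \<open>Left multiplication by \<open>dx_form i\<close> without the sum over subsets. It differs
  from \<open>wedge\<close> on infinite index sets, which is why comparisons assume support in a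
  finite set.\<close>

definition dx_wedge :: "'i::linorder \<Rightarrow> ('i, 'r::comm_ring_1) form \<Rightarrow> ('i, 'r) form" where
  "dx_wedge i w = (\<lambda>K. if i \<in> K then shuffle_sign {i} (K - {i}) * w (K - {i}) else 0)"

text \<open>Contraction with the vector field \<open>\<partial>/\<partial>x\<^sub>i\<close>.\<close>

definition contract :: "'i::linorder \<Rightarrow> ('i, 'r::comm_ring_1) form \<Rightarrow> ('i, 'r) form" where
  "contract i w = (\<lambda>K. if i \<in> K then 0 else shuffle_sign {i} K * w (insert i K))"

definition parity :: "('i, 'r::comm_ring_1) form \<Rightarrow> ('i, 'r) form" where
  "parity w = (\<lambda>K. (-1) ^ card K * w K)"

lemma shuffle_sign_empty [simp]: "shuffle_sign {} K = 1" "shuffle_sign K {} = 1"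
  by (simp_all add: shuffle_sign_def)

lemma shuffle_sign_square [simp]:
  fixes I J :: "'i::linorder set" and x :: "'r::comm_ring_1"
  shows "shuffle_sign I J * shuffle_sign I J = (1 :: 'r)"
    "shuffle_sign I J * (shuffle_sign I J * x) = x"
proof -
  show *: "shuffle_sign I J * shuffle_sign I J = (1 :: 'r)"
    by (simp add: shuffle_sign_def power_add[symmetric])
  show "shuffle_sign I J * (shuffle_sign I J * x) = x"
    by (simp add: mult.assoc[symmetric] *)
qed

lemma shuffle_sign_Un_left:
  assumes "finite I" "finite J" "finite L" "I \<inter> J = {}"
  shows "shuffle_sign (I \<union> J) L = shuffle_sign I L * shuffle_sign J L"
proof -
  have fin: "finite {(i, j). i \<in> B \<and> j \<in> L \<and> j < i}" if "finite B" for B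
    by (rule finite_subset[of _ "B \<times> L"]) (use that assms in auto)
  have "{(i, j). i \<in> I \<union> J \<and> j \<in> L \<and> j < i}
      = {(i, j). i \<in> I \<and> j \<in> L \<and> j < i} \<union> {(i, j). i \<in> J \<and> j \<in> L \<and> j < i}" by auto
  moreover have "card \<dots> = card {(i, j). i \<in> I \<and> j \<in> L \<and> j < i} + card {(i, j). i \<in> J \<and> j \<in> L \<and> j < i}"
    using assms by (intro card_Un_disjoint fin) auto
  ultimately show ?thesis by (simp add: shuffle_sign_def power_add)
qed

lemma shuffle_sign_Un_right:
  assumes "finite I" "finite J" "finite L" "I \<inter> J = {}"
  shows "shuffle_sign L (I \<union> J) = shuffle_sign L I * shuffle_sign L J"
proof -
  have fin: "finite {(i, j). i \<in> L \<and> j \<in> B \<and> j < i}" if "finite B" for B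
    by (rule finite_subset[of _ "L \<times> B"]) (use that assms in auto)
  have "{(i, j). i \<in> L \<and> j \<in> I \<union> J \<and> j < i}
      = {(i, j). i \<in> L \<and> j \<in> I \<and> j < i} \<union> {(i, j). i \<in> L \<and> j \<in> J \<and> j < i}" by auto
  moreover have "card \<dots> = card {(i, j). i \<in> L \<and> j \<in> I \<and> j < i} + card {(i, j). i \<in> L \<and> j \<in> J \<and> j < i}"
    using assms by (intro card_Un_disjoint fin) auto
  ultimately show ?thesis by (simp add: shuffle_sign_def power_add)
qed

lemma shuffle_sign_insert_right:
  assumes "finite J" "finite L" "j \<notin> J"
  shows "shuffle_sign L (insert j J) = shuffle_sign L {j} * shuffle_sign L J"
  using shuffle_sign_Un_right[of "{j}" J L] assms by simp

lemma shuffle_sign_singletons: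
  "shuffle_sign {i} {j} = (if j < i then - 1 else 1)"
proof -
  have "{(x, y). x = i \<and> y = j \<and> y < x} = (if j < i then {(i, j)} else {})" by auto
  then show ?thesis by (simp add: shuffle_sign_def)
qed

lemma shuffle_sign_swap_singletons:
  "i \<noteq> j \<Longrightarrow> shuffle_sign {i} {j} = - shuffle_sign {j} {i}"
  by (auto simp: shuffle_sign_singletons)

text \<open>Moving one differential past the \<open>card L\<close> differentials of \<open>L\<close>
  costs one sign each.\<close>

lemma shuffle_sign_swap_singleton:
  assumes "finite L" "i \<notin> L"
  shows "(shuffle_sign L {i} :: 'r::comm_ring_1) = (-1) ^ card L * shuffle_sign {i} L"
  using assms
proof (induction L rule: finite_induct)
  case (insert j L)
  have ji: "j \<noteq> i" using insert by auto
  have "(shuffle_sign (insert j L) {i} :: 'r) = shuffle_sign {j} {i} * shuffle_sign L {i}"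
    using shuffle_sign_Un_left[of "{j}" L "{i}", where 'b = 'r] insert by simp
  also have "\<dots> = - shuffle_sign {i} {j} * ((-1) ^ card L * shuffle_sign {i} L)"
    using insert by (simp add: shuffle_sign_swap_singletons[OF ji])
  also have "\<dots> = (-1) ^ card (insert j L) * shuffle_sign {i} (insert j L)"
    using insert by (subst shuffle_sign_insert_right) auto
  finally show ?case .
qed simp

lemma partial_sign: "partial i (shuffle_sign I J * p) = shuffle_sign I J * partial i p"
proof -
  have "partial i ((-1) ^ n * p) = (-1) ^ n * partial i p" for n
    by (induction n) (simp_all add: partial_uminus)
  then show ?thesis by (simp add: shuffle_sign_def)
qed

lemma form_support_finite:
  "finite A \<Longrightarrow> w \<in> form_support A \<Longrightarrow> infinite K \<Longrightarrow> w K = 0"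
  by (auto simp: form_support_def dest: finite_subset)

text \<open>\<open>Pow K\<close> is infinite, so the sum takes its default value 0. Forms supported
  on a finite set also vanish there.\<close>

lemma wedge_infinite: "infinite K \<Longrightarrow> wedge w \<eta> K = 0"
  by (simp add: wedge_def finite_Pow_iff)

lemma wedge_add_left: "wedge (w + w') \<eta> = wedge w \<eta> + wedge w' \<eta>"
  by (simp add: wedge_def fun_eq_iff algebra_simps sum.distrib)

lemma wedge_add_right: "wedge w (\<eta> + \<eta>') = wedge w \<eta> + wedge w \<eta>'"
  by (simp add: wedge_def fun_eq_iff algebra_simps sum.distrib)

lemma wedge_zero [simp]: "wedge 0 \<eta> = 0" "wedge w 0 = 0"
  by (simp_all add: wedge_def fun_eq_iff)

lemma wedge_sum_left: "wedge (\<Sum>x\<in>F. f x) \<eta> = (\<Sum>x\<in>F. wedge (f x) \<eta>)"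
  by (induction F rule: infinite_finite_induct) (simp_all only: sum.infinite sum.empty sum.insert wedge_zero wedge_add_left not_False_eq_True)

lemma wedge_sum_right: "wedge w (\<Sum>x\<in>F. f x) = (\<Sum>x\<in>F. wedge w (f x))"
  by (induction F rule: infinite_finite_induct) (simp_all only: sum.infinite sum.empty sum.insert wedge_zero wedge_add_right not_False_eq_True)

lemma wedge_fscale: "wedge (fscale p w) \<eta> = fscale p (wedge w \<eta>)" "wedge w (fscale p \<eta>) = fscale p (wedge w \<eta>)"
  by (simp_all add: wedge_def fscale_def fun_eq_iff sum_distrib_left ac_simps)

text \<open>Both sides sum over the ordered partitions of \<open>K\<close> into three blocks. The
  signs agree because the shuffle sign is multiplicative over disjoint unions in each
  argument.\<close>

lemma wedge_assoc:
  fixes w :: "('i::linorder, 'r::comm_ring_1) form"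
  shows "wedge (wedge w \<eta>) \<zeta> = wedge w (wedge \<eta> \<zeta>)"
proof
  fix K
  show "wedge (wedge w \<eta>) \<zeta> K = wedge w (wedge \<eta> \<zeta>) K"
  proof (cases "finite K")
    case False
    then show ?thesis by (simp add: wedge_infinite)
  next
    case K: True
    then have fin: "finite I" if "I \<subseteq> K" for I using that finite_subset by blast
    have "wedge (wedge w \<eta>) \<zeta> K = (\<Sum>(I, J)\<in>(SIGMA I:Pow K. Pow I).
        shuffle_sign I (K - I) * (shuffle_sign J (I - J) * w J * \<eta> (I - J)) * \<zeta> (K - I))"
      using fin by (subst sum.Sigma[symmetric])
        (auto simp: K wedge_def sum_distrib_left sum_distrib_right ac_simps)
    also have "\<dots> = (\<Sum>(J, L)\<in>(SIGMA J:Pow K. Pow (K - J)).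
        shuffle_sign J (K - J) * w J * (shuffle_sign L (K - J - L) * \<eta> L * \<zeta> (K - J - L)))"
    \<comment> \<open>The three blocks are \<open>J\<close>, \<open>I - J\<close> and
      \<open>K - I\<close>. The left side encodes them by the nested sets \<open>(I, J)\<close>, the
      right side by the first two blocks.\<close>
    proof (rule sum.reindex_bij_witness[of _ "\<lambda>(J, L). (J \<union> L, J)" "\<lambda>(I, J). (J, I - J)"]; clarsimp)
      fix I J assume I: "I \<subseteq> K" and J: "J \<subseteq> I"
      have D: "K - J - (I - J) = K - I" "K - J = (I - J) \<union> (K - I)" using I J by auto
      have "(shuffle_sign I (K - I) :: ('i \<Rightarrow>\<^sub>0 nat) \<Rightarrow>\<^sub>0 'r) = shuffle_sign J (K - I) * shuffle_sign (I - J) (K - I)"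
        using shuffle_sign_Un_left[of J "I - J" "K - I"] I J fin[of I] fin[of J] K
        by (simp add: Un_absorb1 finite_subset)
      moreover have "(shuffle_sign J (K - J) :: ('i \<Rightarrow>\<^sub>0 nat) \<Rightarrow>\<^sub>0 'r) = shuffle_sign J (I - J) * shuffle_sign J (K - I)"
        unfolding D(2) using I J fin[of I] fin[of J] K by (intro shuffle_sign_Un_right) auto
      ultimately show "shuffle_sign J (K - J) * w J *
            (shuffle_sign (I - J) (K - J - (I - J)) * \<eta> (I - J) * \<zeta> (K - J - (I - J)))
          = shuffle_sign I (K - I) * (shuffle_sign J (I - J) * w J * \<eta> (I - J)) * \<zeta> (K - I)"
        unfolding D(1) by (simp add: ac_simps)
    qed auto
    also have "\<dots> = wedge w (wedge \<eta> \<zeta>) K"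
      using K by (subst sum.Sigma[symmetric])
        (auto simp: wedge_def sum_distrib_left sum_distrib_right ac_simps)
    finally show ?thesis .
  qed
qed

lemma wedge_fun_form:
  assumes "finite A" "w \<in> form_support A"
  shows "wedge (fun_form p) w = fscale p w" "wedge w (fun_form p) = fscale p w"
proof -
  have "wedge (fun_form p) w K = fscale p w K \<and> wedge w (fun_form p) K = fscale p w K" for K
  proof (cases "finite K")
    case True
    have "wedge (fun_form p) w K = (\<Sum>I\<in>{{}}. shuffle_sign I (K - I) * fun_form p I * w (K - I))"
      unfolding wedge_def using True by (intro sum.mono_neutral_right) (auto simp: fun_form_def)
    moreover have "wedge w (fun_form p) K = (\<Sum>I\<in>{K}. shuffle_sign I (K - I) * w I * fun_form p (K - I))"
      unfolding wedge_def using True by (intro sum.mono_neutral_right) (auto simp: fun_form_def)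
    ultimately show ?thesis by (simp add: fscale_def fun_form_def ac_simps)
  next
    case False
    then show ?thesis using form_support_finite[OF assms] by (simp add: wedge_infinite fscale_def)
  qed
  then show "wedge (fun_form p) w = fscale p w" "wedge w (fun_form p) = fscale p w" by auto
qed

lemma wedge_dx_form:
  assumes "finite A" "w \<in> form_support A"
  shows "wedge (dx_form i) w = dx_wedge i w" "wedge w (dx_form i) = dx_wedge i (parity w)"
proof -
  have "wedge (dx_form i) w K = dx_wedge i w K \<and> wedge w (dx_form i) K = dx_wedge i (parity w) K" for K
  proof (cases "finite K")
    case True
    have "wedge (dx_form i) w K
        = (\<Sum>I\<in>(if i \<in> K then {{i}} else {}). shuffle_sign I (K - I) * dx_form i I * w (K - I))"
      unfolding wedge_def using True by (intro sum.mono_neutral_right) (auto simp: dx_form_def)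
    moreover have "wedge w (dx_form i) K
        = (\<Sum>I\<in>(if i \<in> K then {K - {i}} else {}). shuffle_sign I (K - I) * w I * dx_form i (K - I))"
      unfolding wedge_def
    proof (intro sum.mono_neutral_right ballI)
      fix I assume I: "I \<in> Pow K - (if i \<in> K then {K - {i}} else {})"
      have "K - I \<noteq> {i}"
      proof
        assume "K - I = {i}"
        then have "i \<in> K" "I = K - {i}" using I by auto
        then show False using I by simp
      qed
      then show "shuffle_sign I (K - I) * w I * dx_form i (K - I) = 0" by (simp add: dx_form_def)
    qed (use True in auto)
    moreover have "K - (K - {i}) = {i}" if "i \<in> K" using that by auto
    ultimately show ?thesis
      using True by (simp add: dx_wedge_def dx_form_def parity_def shuffle_sign_swap_singleton ac_simps)
  next
    case False
    then show ?thesis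
      using form_support_finite[OF assms, of "K - {i}"] by (simp add: wedge_infinite dx_wedge_def parity_def)
  qed
  then show "wedge (dx_form i) w = dx_wedge i w" "wedge w (dx_form i) = dx_wedge i (parity w)" by auto
qed

lemma parity_parity [simp]: "parity (parity w) = w"
  by (simp add: parity_def fun_eq_iff mult.assoc[symmetric] power_add[symmetric])

lemma pderiv_form_wedge:
  "pderiv_form i (wedge w \<eta>) = wedge (pderiv_form i w) \<eta> + wedge w (pderiv_form i \<eta>)"
proof
  fix K
  have "partial i (shuffle_sign I (K - I) * w I * \<eta> (K - I))
      = shuffle_sign I (K - I) * partial i (w I) * \<eta> (K - I)
      + shuffle_sign I (K - I) * w I * partial i (\<eta> (K - I))" for I
    unfolding mult.assoc unfolding partial_sign unfolding partial_mult by (simp add: distrib_left ac_simps)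
  then show "pderiv_form i (wedge w \<eta>) K = (wedge (pderiv_form i w) \<eta> + wedge w (pderiv_form i \<eta>)) K"
    by (simp add: pderiv_form_def wedge_def partial_sum sum.distrib)
qed

lemma dx_wedge_fscale: "dx_wedge i (fscale p w) = fscale p (dx_wedge i w)"
  by (auto simp: dx_wedge_def fscale_def fun_eq_iff)

lemma contract_fscale: "contract i (fscale p w) = fscale p (contract i w)"
  by (auto simp: contract_def fscale_def fun_eq_iff)

lemma parity_fscale: "parity (fscale p w) = fscale p (parity w)"
  by (auto simp: parity_def fscale_def fun_eq_iff)

lemma pderiv_form_fscale:
  "pderiv_form i (fscale p w) = fscale (partial i p) w + fscale p (pderiv_form i w)"
  by (auto simp: pderiv_form_def fscale_def fun_eq_iff partial_mult)

lemma pderiv_form_dx_wedge: "pderiv_form i (dx_wedge j w) = dx_wedge j (pderiv_form i w)"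
  by (auto simp: pderiv_form_def dx_wedge_def fun_eq_iff partial_sign)

lemma pderiv_form_contract: "pderiv_form i (contract j w) = contract j (pderiv_form i w)"
  by (auto simp: pderiv_form_def contract_def fun_eq_iff partial_sign)

lemma pderiv_form_parity:
  fixes w :: "('a, 'b::comm_ring_1) form"
  shows "pderiv_form i (parity w) = parity (pderiv_form i w)"
proof
  fix K
  have "partial i ((-1) ^ n * p) = (-1) ^ n * partial i p" for n and p :: "('a \<Rightarrow>\<^sub>0 nat) \<Rightarrow>\<^sub>0 'b"
    by (induction n) (simp_all add: partial_uminus)
  then show "pderiv_form i (parity w) K = parity (pderiv_form i w) K"
    by (simp add: pderiv_form_def parity_def)
qed

lemma pderiv_form_commute: "pderiv_form i (pderiv_form j w) = pderiv_form j (pderiv_form i w)"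
  by (simp add: pderiv_form_def partial_commute)

lemma dx_wedge_add: "dx_wedge i (w + \<eta>) = dx_wedge i w + dx_wedge i \<eta>"
  by (auto simp: dx_wedge_def fun_eq_iff algebra_simps)

lemma contract_add: "contract i (w + \<eta>) = contract i w + contract i \<eta>"
  by (auto simp: contract_def fun_eq_iff algebra_simps)

lemma parity_add: "parity (w + \<eta>) = parity w + parity \<eta>"
  by (auto simp: parity_def fun_eq_iff algebra_simps)

lemma pderiv_form_add: "pderiv_form i (w + \<eta>) = pderiv_form i w + pderiv_form i \<eta>"
  by (auto simp: pderiv_form_def fun_eq_iff partial_add)

lemma fscale_add: "fscale p (w + \<eta>) = fscale p w + fscale p \<eta>"
  by (auto simp: fscale_def fun_eq_iff algebra_simps)

lemma fscale_add_left: "fscale (p + q) w = fscale p w + fscale q w"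
  by (auto simp: fscale_def fun_eq_iff algebra_simps)

lemma fscale_one [simp]: "fscale 1 w = w"
  by (simp add: fscale_def)

lemma fscale_fscale: "fscale p (fscale q w) = fscale (p * q) w"
  by (simp add: fscale_def ac_simps)

lemma form_operator_zero [simp]:
  "dx_wedge i 0 = 0" "contract i 0 = 0" "parity 0 = 0" "pderiv_form i 0 = 0" "fscale p 0 = 0" "fscale 0 w = 0"
  by (auto simp: dx_wedge_def contract_def parity_def pderiv_form_def fscale_def fun_eq_iff)

lemma form_operator_sum:
  "dx_wedge i (\<Sum>x\<in>F. f x) = (\<Sum>x\<in>F. dx_wedge i (f x))"
  "contract i (\<Sum>x\<in>F. f x) = (\<Sum>x\<in>F. contract i (f x))"
  "parity (\<Sum>x\<in>F. f x) = (\<Sum>x\<in>F. parity (f x))"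
  "pderiv_form i (\<Sum>x\<in>F. f x) = (\<Sum>x\<in>F. pderiv_form i (f x))"
  "fscale p (\<Sum>x\<in>F. f x) = (\<Sum>x\<in>F. fscale p (f x))"
  by (induction F rule: infinite_finite_induct)
    (simp_all only: sum.infinite sum.empty sum.insert form_operator_zero not_False_eq_True dx_wedge_add contract_add parity_add pderiv_form_add fscale_add)

lemma fscale_sum_left: "fscale (\<Sum>x\<in>F. f x) w = (\<Sum>x\<in>F. fscale (f x) w)"
  by (induction F rule: infinite_finite_induct) (simp_all only: sum.infinite sum.empty sum.insert form_operator_zero not_False_eq_True fscale_add_left)

lemma dx_wedge_uminus: "dx_wedge i (- w) = - dx_wedge i w"
  by (auto simp: dx_wedge_def fun_eq_iff)

text \<open>Removing i and j in either order leaves the same set, and the signs differ only by that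
  of the transposition of i and j. For \<open>i = j\<close> both sides are 0.\<close>

lemma dx_wedge_commute:
  fixes w :: "('i::linorder, 'r::comm_ring_1) form"
  assumes "finite A" "w \<in> form_support A"
  shows "dx_wedge i (dx_wedge j w) = - dx_wedge j (dx_wedge i w)"
proof
  fix K
  show "dx_wedge i (dx_wedge j w) K = (- dx_wedge j (dx_wedge i w)) K"
  proof (cases "i \<noteq> j \<and> i \<in> K \<and> j \<in> K \<and> finite K")
    case True
    let ?K = "K - {i} - {j}"
    have K: "K - {i} = insert j ?K" "K - {j} = insert i ?K" "K - {j} - {i} = ?K" using True by auto
    let ?s = "shuffle_sign :: _ \<Rightarrow> _ \<Rightarrow> ('i \<Rightarrow>\<^sub>0 nat) \<Rightarrow>\<^sub>0 'r"
    have si: "?s {i} (K - {i}) = ?s {i} {j} * ?s {i} ?K"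
      using True by (subst K(1), subst shuffle_sign_insert_right) auto
    have sj: "?s {j} (K - {j}) = - ?s {i} {j} * ?s {j} ?K"
      using True by (subst K(2), subst shuffle_sign_insert_right)
        (auto simp: shuffle_sign_swap_singletons[of j i])
    have "i \<in> K" "j \<in> K" "j \<in> K - {i}" "i \<in> K - {j}" using True by auto
    then have "dx_wedge i (dx_wedge j w) K = ?s {i} (K - {i}) * (?s {j} ?K * w ?K)"
      "dx_wedge j (dx_wedge i w) K = ?s {j} (K - {j}) * (?s {i} ?K * w ?K)"
      by (simp_all only: dx_wedge_def if_True K(3))
    then show ?thesis unfolding si sj by (simp add: ac_simps)
  next
    case False
    have "infinite K \<Longrightarrow> w (K - {i} - {j}) = 0 \<and> w (K - {j} - {i}) = 0"
      using form_support_finite[OF assms] by simp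
    then show ?thesis using False by (auto simp: dx_wedge_def)
  qed
qed

text \<open>The anticommutation relation of creation and annihilation operators on the exterior
  algebra. It drives both the stability of \<open>J\<close> under contraction and Cartan's
  formula.\<close>

lemma contract_dx_wedge:
  fixes w :: "('i::linorder, 'r::comm_ring_1) form"
  assumes "finite A" "w \<in> form_support A"
  shows "contract i (dx_wedge j w) = (if i = j then w else 0) - dx_wedge j (contract i w)"
proof
  fix K
  have inf: "infinite K \<Longrightarrow> w (insert x K - {y}) = 0 \<and> w (insert x (K - {y})) = 0 \<and> w K = 0" for x y
    using form_support_finite[OF assms] by simp
  show "contract i (dx_wedge j w) K = ((if i = j then w else 0) - dx_wedge j (contract i w)) K"
  proof (cases "i = j")
    case True
    then show ?thesis by (auto simp: contract_def dx_wedge_def insert_absorb)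
  next
    case ij: False
    show ?thesis
    proof (cases "i \<notin> K \<and> j \<in> K \<and> finite K")
      case True
      let ?K = "K - {j}"
      have K: "K = insert j ?K" "insert i K - {j} = insert i ?K" using True ij by auto
      have "(shuffle_sign {i} K :: ('i \<Rightarrow>\<^sub>0 nat) \<Rightarrow>\<^sub>0 'r) = shuffle_sign {i} {j} * shuffle_sign {i} ?K"
        using True by (subst K(1), subst shuffle_sign_insert_right) auto
      moreover have "(shuffle_sign {j} (insert i K - {j}) :: ('i \<Rightarrow>\<^sub>0 nat) \<Rightarrow>\<^sub>0 'r) = shuffle_sign {j} {i} * shuffle_sign {j} ?K"
        unfolding K(2) using True by (subst shuffle_sign_insert_right) auto
      ultimately show ?thesis
        using True ij shuffle_sign_swap_singletons[of i j, where 'b = "('i \<Rightarrow>\<^sub>0 nat) \<Rightarrow>\<^sub>0 'r"]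
        by (simp add: dx_wedge_def contract_def K(2) ac_simps)
    next
      case False
      then show ?thesis using ij inf[of i j] by (auto simp: dx_wedge_def contract_def)
    qed
  qed
qed

text \<open>The occupation number of i. Summed over all i it gives \<open>card K\<close>, the form
  degree in Cartan's formula.\<close>

lemma dx_wedge_contract: "dx_wedge i (contract i w) K = (if i \<in> K then w K else 0)"
  by (auto simp: contract_def dx_wedge_def insert_absorb)

lemma form_support_operators:
  assumes "w \<in> form_support A"
  shows "fscale p w \<in> form_support A" "pderiv_form i w \<in> form_support A"
    "parity w \<in> form_support A" "contract i w \<in> form_support A"
    and "i \<in> A \<Longrightarrow> dx_wedge i w \<in> form_support A"
proof -
  have w: "w K = 0" if "\<not> K \<subseteq> A" for K using assms that by (auto simp: form_support_def)
  have "\<not> insert i K \<subseteq> A" if "\<not> K \<subseteq> A" for K using that by blast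
  with w have "fscale p w K = 0 \<and> pderiv_form i w K = 0 \<and> parity w K = 0 \<and> contract i w K = 0"
    if "\<not> K \<subseteq> A" for K
    using that by (simp add: fscale_def pderiv_form_def parity_def contract_def)
  then show "fscale p w \<in> form_support A" "pderiv_form i w \<in> form_support A"
    "parity w \<in> form_support A" "contract i w \<in> form_support A"
    unfolding form_support_def by blast+
  show "dx_wedge i w \<in> form_support A" if "i \<in> A"
    unfolding form_support_def mem_Collect_eq
  proof (intro allI impI, rule ccontr)
    fix K assume K: "dx_wedge i w K \<noteq> 0" "\<not> K \<subseteq> A"
    then have "\<not> K - {i} \<subseteq> A" using that by auto
    then have "w (K - {i}) = 0" by (rule w)
    then show False using K(1) by (auto simp: dx_wedge_def split: if_splits)
  qed
qed

subsection \<open>Forms on the simplex\<close>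

definition cscale :: "'k \<Rightarrow> ('i, 'v \<Rightarrow> 'k::field) form \<Rightarrow> ('i, 'v \<Rightarrow> 'k) form" where
  "cscale c = fscale (single 0 (\<lambda>v. c))"

text \<open>The coefficient space may depend on the form degree: for forms of a fixed total degree,
  coefficients of higher form degree have lower polynomial degree. The exterior derivative maps the
  forms for the shifted family \<open>N (Suc q)\<close> to those for \<open>N\<close>, and
  contraction goes the other way.\<close>

definition forms_over :: "'i set \<Rightarrow> (nat \<Rightarrow> ('v \<Rightarrow> 'k::field) set) \<Rightarrow> ('i, 'v \<Rightarrow> 'k) form set" where
  "forms_over A N = {w \<in> form_support A. \<forall>K. w K \<in> pm_over A (N (card K))}"

lemma forms_over_support: "w \<in> forms_over A N \<Longrightarrow> w \<in> form_support A"
  and forms_over_coeff: "w \<in> forms_over A N \<Longrightarrow> w K \<in> pm_over A (N (card K))"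
  by (simp_all add: forms_over_def)

lemma forms_over_mono: "(\<And>q. N q \<subseteq> N' q) \<Longrightarrow> forms_over A N \<subseteq> forms_over A N'"
  using pm_over_mono unfolding forms_over_def by blast

lemma const_mult: "(\<lambda>v. c) * f = (\<lambda>v. c * f v :: 'k::field)"
  by (simp add: fun_eq_iff)

lemma lin_sub_const_mult: "lin_sub (\<lambda>c (f :: 'v \<Rightarrow> 'k::field) v. c * f v) V \<Longrightarrow> f \<in> V \<Longrightarrow> (\<lambda>v. c) * f \<in> V"
  unfolding const_mult by (rule lin_sub_scale)

lemma pm_over_const_mult:
  assumes V: "lin_sub (\<lambda>c (f :: 'v \<Rightarrow> 'k::field) v. c * f v) V"
    and "p \<in> pm_over A (range (\<lambda>c v. c))" "q \<in> pm_over A V"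
  shows "p * q \<in> pm_over A V"
  by (rule pm_over_mult[OF V _ assms(2,3)]) (auto intro: lin_sub_const_mult[OF V])

lemma pm_over_const_single: "single 0 (\<lambda>v. c) \<in> pm_over A (range (\<lambda>c v. c))"
  by (auto intro: pm_over_single)

lemma lin_sub_range_const: "lin_sub (\<lambda>c (f :: 'v \<Rightarrow> 'k::field) v. c * f v) (range (\<lambda>c v. c))"
  by (rule lin_subI) (auto simp: fun_eq_iff image_iff)

lemma pm_over_const_one: "1 \<in> pm_over A (range (\<lambda>c (v :: 'v). c :: 'k::field))"
  using pm_over_const_single[of 1 A] by (simp add: one_fun_def[symmetric])

lemma pm_over_const_pvar: "i \<in> A \<Longrightarrow> pvar i \<in> pm_over A (range (\<lambda>c (v :: 'v). c :: 'k::field))"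
  by (intro pm_over_single) (auto simp: one_fun_def)

lemma pm_over_sign:
  assumes V: "lin_sub sc V" and p: "p \<in> pm_over A V"
  shows "shuffle_sign I J * p \<in> pm_over A V" "(-1) ^ n * p \<in> pm_over A V"
proof -
  have m: "- p \<in> pm_over A V"
    using pm_over_diff[OF V pm_over_zero p] by simp
  show *: "(-1) ^ n * p \<in> pm_over A V" for n
    using p m by (cases "even n") simp_all
  show "shuffle_sign I J * p \<in> pm_over A V"
    unfolding shuffle_sign_def by (rule *)
qed

locale simplex =
  fixes scl :: "'k::field_char_0 \<Rightarrow> 'v::ab_group_add \<Rightarrow> 'v" and A :: "'i::linorder set"
  assumes finite_A: "finite A" and nonempty_A: "A \<noteq> {}"
begin

abbreviation P :: "('v \<Rightarrow> 'k) set" where "P \<equiv> poly_funs scl"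

abbreviation subspaces :: "(nat \<Rightarrow> ('v \<Rightarrow> 'k) set) \<Rightarrow> bool" where
  "subspaces N \<equiv> \<forall>q. lin_sub (\<lambda>c f v. c * f v) (N q)"

abbreviation F :: "('i, 'v \<Rightarrow> 'k) form set" where "F \<equiv> forms_over A (\<lambda>_. P)"

lemma subspaces_P: "subspaces (\<lambda>_. P)"
  using lin_sub_poly_funs by blast

lemma F_eq: "F = carrier (free_forms scl A)"
  unfolding forms_over_def form_support_def pm_over_def free_forms_def by auto

lemma F_support: "w \<in> F \<Longrightarrow> w \<in> form_support A"
  by (rule forms_over_support)

context
  fixes N assumes N: "subspaces N"
begin

lemma forms_over_lin_sub: "lin_sub cscale (forms_over A N)"
proof (rule lin_subI)
  show "0 \<in> forms_over A N"
    by (auto simp: forms_over_def form_support_def pm_over_zero)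
  fix w \<eta> assume w: "w \<in> forms_over A N"
  have "cscale c w K \<in> pm_over A (N (card K))" for c K
    unfolding cscale_def fscale_def
    using N forms_over_coeff[OF w] by (intro pm_over_const_mult pm_over_const_single) auto
  then show "cscale c w \<in> forms_over A N" for c
    using form_support_operators(1)[OF forms_over_support[OF w]] by (simp add: forms_over_def cscale_def)
  assume \<eta>: "\<eta> \<in> forms_over A N"
  have "(w - \<eta>) K \<in> pm_over A (N (card K))" for K
    using N forms_over_coeff[OF w] forms_over_coeff[OF \<eta>] by (auto intro!: pm_over_diff)
  moreover have "w - \<eta> \<in> form_support A"
    unfolding form_support_def mem_Collect_eq
  proof (intro allI impI)
    fix K assume "(w - \<eta>) K \<noteq> 0"
    then have "w K \<noteq> 0 \<or> \<eta> K \<noteq> 0" by auto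
    then show "K \<subseteq> A"
      using forms_over_support[OF w] forms_over_support[OF \<eta>] unfolding form_support_def by blast
  qed
  ultimately show "w - \<eta> \<in> forms_over A N" by (simp add: forms_over_def)
qed

lemma forms_over_fscale:
  "p \<in> pm_over A (range (\<lambda>c v. c)) \<Longrightarrow> w \<in> forms_over A N \<Longrightarrow> fscale p w \<in> forms_over A N"
  using form_support_operators(1)[of w A p] pm_over_const_mult[of "N (card K)" p A "w K" for K] N
  by (simp add: forms_over_def fscale_def)

lemma forms_over_pderiv: "w \<in> forms_over A N \<Longrightarrow> pderiv_form i w \<in> forms_over A N"
  using form_support_operators(2)[of w A i] partial_over[of "N (card K)" "w K" A for K] N
  by (simp add: forms_over_def pderiv_form_def)

lemma forms_over_parity: "w \<in> forms_over A N \<Longrightarrow> parity w \<in> forms_over A N"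
  using form_support_operators(3)[of w A]
  by (auto simp: forms_over_def parity_def intro!: pm_over_sign(2)[OF N[rule_format]])

lemma forms_over_dx_wedge:
  assumes w: "w \<in> forms_over A (\<lambda>q. N (Suc q))" and i: "i \<in> A"
  shows "dx_wedge i w \<in> forms_over A N"
proof -
  have "dx_wedge i w K \<in> pm_over A (N (card K))" for K
  proof (cases "i \<in> K \<and> finite K")
    case True
    then have "card K = Suc (card (K - {i}))" by (metis card_Suc_Diff1)
    then show ?thesis
      using True forms_over_coeff[OF w, of "K - {i}"] pm_over_sign(1)[OF N[rule_format]]
      by (simp add: dx_wedge_def)
  next
    case False
    then show ?thesis
      using form_support_finite[OF finite_A forms_over_support[OF w], of "K - {i}"]
      by (auto simp: dx_wedge_def pm_over_zero)
  qed
  then show ?thesis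
    using form_support_operators(5)[OF forms_over_support[OF w] i] by (simp add: forms_over_def)
qed

lemma forms_over_contract:
  assumes w: "w \<in> forms_over A N"
  shows "contract i w \<in> forms_over A (\<lambda>q. N (Suc q))"
proof -
  have "contract i w K \<in> pm_over A (N (Suc (card K)))" for K
  proof (cases "i \<notin> K \<and> finite K")
    case True
    then show ?thesis
      using forms_over_coeff[OF w, of "insert i K"] pm_over_sign(1)[OF N[rule_format]]
      by (simp add: contract_def)
  next
    case False
    then show ?thesis
      using form_support_finite[OF finite_A forms_over_support[OF w], of "insert i K"]
      by (auto simp: contract_def pm_over_zero)
  qed
  then show ?thesis
    using form_support_operators(4)[OF forms_over_support[OF w]] by (simp add: forms_over_def)
qed

end

lemmas F_lin_sub = forms_over_lin_sub[OF subspaces_P]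

lemmas F_zero = lin_sub_zero[OF F_lin_sub] and F_diff = lin_sub_diff[OF F_lin_sub]
  and F_add = lin_sub_add[OF F_lin_sub] and F_scale = lin_sub_scale[OF F_lin_sub]
  and F_uminus = lin_sub_uminus[OF F_lin_sub]

lemma F_pderiv: "w \<in> F \<Longrightarrow> pderiv_form i w \<in> F"
  and F_parity: "w \<in> F \<Longrightarrow> parity w \<in> F"
  and F_dx_wedge: "w \<in> F \<Longrightarrow> i \<in> A \<Longrightarrow> dx_wedge i w \<in> F"
  using forms_over_pderiv[OF subspaces_P] forms_over_parity[OF subspaces_P]
    forms_over_dx_wedge[OF subspaces_P] by auto

lemma F_fscale:
  assumes p: "p \<in> pm_over A P" and w: "w \<in> F"
  shows "fscale p w \<in> F"
proof -
  have "fscale p w K \<in> pm_over A P" for K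
    unfolding fscale_def using p forms_over_coeff[OF w]
    by (intro pm_over_mult[OF lin_sub_poly_funs poly_funs_mult]) auto
  then show ?thesis
    using form_support_operators(1)[OF F_support[OF w]] by (simp add: forms_over_def)
qed

lemma F_wedge:
  assumes w: "w \<in> F" and \<eta>: "\<eta> \<in> F"
  shows "wedge w \<eta> \<in> F"
proof -
  have "wedge w \<eta> K \<in> pm_over A P" for K
    unfolding wedge_def mult.assoc
    using forms_over_coeff[OF w] forms_over_coeff[OF \<eta>]
    by (intro pm_over_sum[OF lin_sub_poly_funs] pm_over_sign(1)[OF lin_sub_poly_funs]
        pm_over_mult[OF lin_sub_poly_funs poly_funs_mult]) auto
  moreover have "wedge w \<eta> K = 0" if K: "\<not> K \<subseteq> A" for K
  proof -
    have "w I = 0 \<or> \<eta> (K - I) = 0" if "I \<subseteq> K" for I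
    proof -
      have "\<not> I \<subseteq> A \<or> \<not> K - I \<subseteq> A" using K that by blast
      then show ?thesis using F_support[OF w] F_support[OF \<eta>] by (auto simp: form_support_def)
    qed
    then have "shuffle_sign I (K - I) * w I * \<eta> (K - I) = 0" if "I \<subseteq> K" for I
    proof -
      from that consider "w I = 0" | "\<eta> (K - I) = 0" using \<open>\<And>I. I \<subseteq> K \<Longrightarrow> w I = 0 \<or> \<eta> (K - I) = 0\<close> by blast
      then show ?thesis by cases (simp_all only: mult_zero_left mult_zero_right)
    qed
    then show ?thesis unfolding wedge_def by (intro sum.neutral) simp
  qed
  ultimately show ?thesis by (auto simp: forms_over_def form_support_def)
qed

lemma F_fun_form: "p \<in> pm_over A P \<Longrightarrow> fun_form p \<in> F"
  by (auto simp: forms_over_def form_support_def fun_form_def pm_over_zero)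

lemma F_const_form: "f \<in> P \<Longrightarrow> const_form f \<in> F"
  unfolding const_form_def by (intro F_fun_form pm_over_single) auto

lemma const_in_P: "range (\<lambda>c v. c) \<subseteq> P"
  using hom_poly_subset[of scl 0] by simp

text \<open>With the fixed index set \<open>A\<close> in place of \<open>K\<close>, the derivative
  becomes a sum of products of operators, and its properties reduce to commutation rules. Directions
  outside \<open>A\<close> contribute nothing as the coefficients do not involve them.\<close>

lemma ext_deriv_eq:
  assumes w: "w \<in> F"
  shows "ext_deriv w = (\<Sum>i\<in>A. dx_wedge i (pderiv_form i w))"
proof
  fix K
  have r: "(\<Sum>i\<in>A. dx_wedge i (pderiv_form i w)) K
      = (\<Sum>i\<in>A. if i \<in> K then shuffle_sign {i} (K - {i}) * partial i (w (K - {i})) else 0)"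
    by (simp add: fun_sum_apply dx_wedge_def pderiv_form_def)
  show "ext_deriv w K = (\<Sum>i\<in>A. dx_wedge i (pderiv_form i w)) K"
  proof (cases "finite K")
    case True
    have 0: "partial i (w (K - {i})) = 0" if "i \<notin> A" for i
      using partial_outside[OF forms_over_coeff[OF w] that] .
    have "ext_deriv w K = (\<Sum>i\<in>K \<inter> A. shuffle_sign {i} (K - {i}) * partial i (w (K - {i})))"
      unfolding ext_deriv_def using True by (intro sum.mono_neutral_right) (auto simp: 0)
    also have "\<dots> = (\<Sum>i\<in>A. if i \<in> K then shuffle_sign {i} (K - {i}) * partial i (w (K - {i})) else 0)"
      using finite_A by (simp add: sum.inter_restrict Int_commute[of K])
    finally show ?thesis unfolding r .
  next
    case False
    then have "(\<Sum>i\<in>A. if i \<in> K then shuffle_sign {i} (K - {i}) * partial i (w (K - {i})) else 0) = 0"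
      using form_support_finite[OF finite_A F_support[OF w]] by (intro sum.neutral) auto
    then show ?thesis using False unfolding r by (simp add: ext_deriv_def)
  qed
qed

lemma ext_deriv_add: "ext_deriv (w + \<eta>) = ext_deriv w + ext_deriv \<eta>"
  by (simp add: ext_deriv_def fun_eq_iff partial_add algebra_simps sum.distrib)

lemma ext_deriv_zero: "ext_deriv 0 = 0"
  by (simp add: ext_deriv_def fun_eq_iff)

lemma ext_deriv_diff: "ext_deriv (w - \<eta>) = ext_deriv w - ext_deriv \<eta>"
  using ext_deriv_add[of "w - \<eta>" \<eta>] by (simp add: algebra_simps)

lemma ext_deriv_empty: "ext_deriv w {} = 0"
  by (simp add: ext_deriv_def)

lemma ext_deriv_in: 
  assumes N: "subspaces N" "\<And>q. N q \<subseteq> P" and w: "w \<in> forms_over A (\<lambda>q. N (Suc q))"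
  shows "ext_deriv w \<in> forms_over A N"
proof -
  have "w \<in> F" using w forms_over_mono[of "\<lambda>q. N (Suc q)" "\<lambda>_. P" A] N(2) by blast
  moreover have "subspaces (\<lambda>q. N (Suc q))" using N(1) by blast
  ultimately show ?thesis
    using w unfolding ext_deriv_eq[OF \<open>w \<in> F\<close>]
    by (intro lin_sub_sum[OF forms_over_lin_sub[OF N(1)]] forms_over_dx_wedge[OF N(1)]
        forms_over_pderiv)
qed

lemma F_ext_deriv: "w \<in> F \<Longrightarrow> ext_deriv w \<in> F"
  using ext_deriv_in[OF subspaces_P] by simp

lemma ext_deriv_wedge:
  assumes w: "w \<in> F" and \<eta>: "\<eta> \<in> F"
  shows "ext_deriv (wedge w \<eta>) = wedge (ext_deriv w) \<eta> + wedge (parity w) (ext_deriv \<eta>)"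
proof -
  have dx: "wedge (dx_wedge i \<alpha>) \<beta> = dx_wedge i (wedge \<alpha> \<beta>)" if "\<alpha> \<in> F" "\<beta> \<in> F" for i \<alpha> \<beta>
    using wedge_assoc[of "dx_form i" \<alpha> \<beta>] that
    by (simp only: wedge_dx_form(1)[OF finite_A F_support] F_wedge)
  \<comment> \<open>Pulling \<open>dx_form i\<close> to the left through a form applies
    \<open>parity\<close> to it, which undoes the \<open>parity\<close> already present.\<close>
  have dx': "wedge (parity \<alpha>) (dx_wedge i \<beta>) = dx_wedge i (wedge \<alpha> \<beta>)" if "\<alpha> \<in> F" "\<beta> \<in> F" for i \<alpha> \<beta>
  proof -
    have "wedge (parity \<alpha>) (dx_wedge i \<beta>) = wedge (wedge (parity \<alpha>) (dx_form i)) \<beta>"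
      using that by (simp add: wedge_assoc wedge_dx_form(1)[OF finite_A F_support])
    also have "\<dots> = wedge (dx_wedge i \<alpha>) \<beta>"
      using that by (simp add: wedge_dx_form(2)[OF finite_A F_support] F_parity)
    finally show ?thesis using dx that by simp
  qed
  have "ext_deriv (wedge w \<eta>)
      = (\<Sum>i\<in>A. dx_wedge i (wedge (pderiv_form i w) \<eta>)) + (\<Sum>i\<in>A. dx_wedge i (wedge w (pderiv_form i \<eta>)))"
    unfolding ext_deriv_eq[OF F_wedge[OF w \<eta>]] pderiv_form_wedge dx_wedge_add sum.distrib ..
  also have "(\<Sum>i\<in>A. dx_wedge i (wedge (pderiv_form i w) \<eta>)) = wedge (ext_deriv w) \<eta>"
    unfolding ext_deriv_eq[OF w] wedge_sum_left by (intro sum.cong HOL.refl dx[symmetric] F_pderiv w \<eta>)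
  also have "(\<Sum>i\<in>A. dx_wedge i (wedge w (pderiv_form i \<eta>))) = wedge (parity w) (ext_deriv \<eta>)"
    unfolding ext_deriv_eq[OF \<eta>] wedge_sum_right by (intro sum.cong HOL.refl dx'[symmetric] F_pderiv w \<eta>)
  finally show ?thesis .
qed

lemma ext_deriv_fscale:
  assumes p: "p \<in> pm_over A P" and w: "w \<in> F"
  shows "ext_deriv (fscale p w) = (\<Sum>i\<in>A. fscale (partial i p) (dx_wedge i w)) + fscale p (ext_deriv w)"
  using p w by (simp add: ext_deriv_eq F_fscale pderiv_form_fscale dx_wedge_add dx_wedge_fscale
      sum.distrib form_operator_sum)

lemma self_neg_zero:
  fixes w :: "('i, 'v \<Rightarrow> 'k) form"
  assumes "w = - w" shows "w = 0"
proof (rule ext, rule poly_mapping_eqI, rule ext)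
  fix K m v
  have "w K = - w K" using fun_cong[OF assms, of K] by simp
  then have "lookup (w K) m = - lookup (w K) m" by (metis lookup_uminus)
  then have "lookup (w K) m v = - lookup (w K) m v"
    by (metis uminus_apply)
  then have "2 * lookup (w K) m v = 0" by (metis add.right_inverse mult_2)
  then show "lookup (w K) m v = lookup (0 K) m v" by simp
qed

text \<open>Partial derivatives commute and the differentials anticommute, so the double sum is its
  own negative; in characteristic zero it vanishes.\<close>

lemma ext_deriv_ext_deriv:
  assumes w: "w \<in> F"
  shows "ext_deriv (ext_deriv w) = 0"
proof (rule self_neg_zero)
  have dd: "ext_deriv (ext_deriv w)
      = (\<Sum>i\<in>A. \<Sum>j\<in>A. dx_wedge i (dx_wedge j (pderiv_form i (pderiv_form j w))))"
    using w by (subst ext_deriv_eq[OF F_ext_deriv]) (simp_all add: ext_deriv_eq form_operator_sum pderiv_form_dx_wedge)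
  also have "\<dots> = (\<Sum>i\<in>A. \<Sum>j\<in>A. - dx_wedge j (dx_wedge i (pderiv_form j (pderiv_form i w))))"
    using w by (intro sum.cong HOL.refl, subst pderiv_form_commute)
      (rule dx_wedge_commute[OF finite_A F_support], simp add: F_pderiv)
  also have "\<dots> = - ext_deriv (ext_deriv w)"
    unfolding dd by (subst sum.swap) (simp add: sum_negf)
  finally show "ext_deriv (ext_deriv w) = - ext_deriv (ext_deriv w)" .
qed

lemma ext_deriv_parity:
  assumes w: "w \<in> F"
  shows "ext_deriv (parity w) = - parity (ext_deriv w)"
proof
  fix K :: "'i set"
  have "(-1) ^ card (K - {i}) = - ((-1) ^ card K :: ('i \<Rightarrow>\<^sub>0 nat) \<Rightarrow>\<^sub>0 ('v \<Rightarrow> 'k))" if "i \<in> K" "finite K" for i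
  proof -
    have "card K = Suc (card (K - {i}))" using that by (metis card_Suc_Diff1)
    then show ?thesis by simp
  qed
  then have "dx_wedge i (parity \<alpha>) K = - parity (dx_wedge i \<alpha>) K" if "\<alpha> \<in> F" for i \<alpha>
    using form_support_finite[OF finite_A F_support[OF that], of K]
      form_support_finite[OF finite_A F_support[OF that], of "K - {i}"]
    by (cases "finite K") (auto simp: dx_wedge_def parity_def ac_simps)
  then show "ext_deriv (parity w) K = (- parity (ext_deriv w)) K"
    using w by (simp add: ext_deriv_eq F_parity pderiv_form_parity F_pderiv form_operator_sum fun_sum_apply sum_negf)
qed

section \<open>The simplex ideal and its stability\<close>

definition bary :: "('i \<Rightarrow>\<^sub>0 nat) \<Rightarrow>\<^sub>0 ('v \<Rightarrow> 'k)" where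
  "bary = (\<Sum>i\<in>A. pvar i) - 1"

definition dbary_wedge :: "('i, 'v \<Rightarrow> 'k) form \<Rightarrow> ('i, 'v \<Rightarrow> 'k) form" where
  "dbary_wedge w = (\<Sum>i\<in>A. dx_wedge i w)"

text \<open>The generators \<open>bary\<close> and its differential commute with all forms up to
  \<open>parity\<close>, so the two-sided ideal they generate consists of these sums; this is
  \<open>simplex_ideal_eq\<close>. Stability under an operator is then shown by exhibiting the new
  pair \<open>u\<close>, \<open>w\<close>.\<close>

definition J :: "('i, 'v \<Rightarrow> 'k) form set" where
  "J = {fscale bary u + dbary_wedge w | u w. u \<in> F \<and> w \<in> F}"

lemma bary_const: "bary \<in> pm_over A (range (\<lambda>c v. c))"
  unfolding bary_def
  by (intro pm_over_diff[OF lin_sub_range_const] pm_over_sum[OF lin_sub_range_const]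
      pm_over_const_pvar pm_over_const_one)

lemma bary_P: "bary \<in> pm_over A P"
  using bary_const pm_over_mono[OF const_in_P] by blast

lemma F_dbary_wedge: "w \<in> F \<Longrightarrow> dbary_wedge w \<in> F"
  unfolding dbary_wedge_def by (intro lin_sub_sum[OF F_lin_sub] F_dx_wedge)

lemma dbary_wedge_add: "dbary_wedge (u + w) = dbary_wedge u + dbary_wedge w"
  by (simp add: dbary_wedge_def dx_wedge_add sum.distrib)

lemma dbary_wedge_uminus: "dbary_wedge (- w) = - dbary_wedge w"
  by (simp add: dbary_wedge_def dx_wedge_uminus sum_negf)

lemma dbary_wedge_diff: "dbary_wedge (u - w) = dbary_wedge u - dbary_wedge w"
  using dbary_wedge_add[of u "- w"] by (simp add: dbary_wedge_uminus)

lemma dbary_wedge_fscale: "dbary_wedge (fscale p w) = fscale p (dbary_wedge w)"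
  by (simp add: dbary_wedge_def dx_wedge_fscale form_operator_sum)

lemma fscale_uminus: "fscale p (- u) = - fscale p u"
  by (simp add: fscale_def fun_eq_iff)

lemma fscale_diff: "fscale p (u - w) = fscale p u - fscale p w"
  by (simp add: fscale_def fun_eq_iff algebra_simps)

lemma J_I: "u \<in> F \<Longrightarrow> w \<in> F \<Longrightarrow> fscale bary u + dbary_wedge w \<in> J"
  unfolding J_def by blast

lemma J_subset: "J \<subseteq> F"
  unfolding J_def using F_fscale[OF bary_P] F_dbary_wedge F_add by blast

lemma J_lin_sub: "lin_sub cscale J"
proof (rule lin_subI)
  have "0 \<in> F" by (rule F_zero)
  from J_I[OF this this] show "0 \<in> J" by (simp add: dbary_wedge_def)
  fix x y c assume "x \<in> J"
  then obtain u w where x: "x = fscale bary u + dbary_wedge w" "u \<in> F" "w \<in> F" unfolding J_def by blast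
  have "cscale c x = fscale bary (cscale c u) + dbary_wedge (cscale c w)"
    by (simp add: x cscale_def fscale_add dbary_wedge_fscale fscale_fscale mult.commute)
  then show "cscale c x \<in> J" using x F_scale by (metis J_I)
  assume "y \<in> J"
  then obtain u' w' where y: "y = fscale bary u' + dbary_wedge w'" "u' \<in> F" "w' \<in> F" unfolding J_def by blast
  have "x - y = fscale bary (u - u') + dbary_wedge (w - w')"
    by (simp add: x y fscale_diff dbary_wedge_diff)
  then show "x - y \<in> J"
    using x y F_diff by (metis J_I)
qed

lemma partial_bary: "i \<in> A \<Longrightarrow> partial i bary = 1"
  using finite_A partial_add[of i bary 1]
  by (simp add: bary_def partial_sum partial_pvar sum.delta del: One_nat_def)

lemma ext_deriv_dbary_wedge:
  assumes w: "w \<in> F"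
  shows "ext_deriv (dbary_wedge w) = - dbary_wedge (ext_deriv w)"
proof -
  have "ext_deriv (dbary_wedge w) = (\<Sum>j\<in>A. \<Sum>i\<in>A. dx_wedge j (dx_wedge i (pderiv_form j w)))"
    using w by (simp add: ext_deriv_eq F_dbary_wedge)
      (simp add: dbary_wedge_def form_operator_sum pderiv_form_dx_wedge)
  also have "\<dots> = (\<Sum>j\<in>A. \<Sum>i\<in>A. - dx_wedge i (dx_wedge j (pderiv_form j w)))"
    using w by (intro sum.cong HOL.refl dx_wedge_commute[OF finite_A F_support] F_pderiv)
  also have "\<dots> = - dbary_wedge (ext_deriv w)"
    unfolding dbary_wedge_def ext_deriv_eq[OF w]
    by (subst sum.swap) (simp add: form_operator_sum sum_negf)
  finally show ?thesis .
qed

lemmas J_zero = lin_sub_zero[OF J_lin_sub] and J_diff = lin_sub_diff[OF J_lin_sub]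
  and J_add = lin_sub_add[OF J_lin_sub] and J_scale = lin_sub_scale[OF J_lin_sub]

text \<open>By the Leibniz rule the new pair is \<open>ext_deriv u\<close> and
  \<open>u - ext_deriv w\<close>: the derivative of \<open>bary\<close> moves \<open>u\<close> to
  the second summand.\<close>

lemma J_ext_deriv: "x \<in> J \<Longrightarrow> ext_deriv x \<in> J"
proof -
  assume "x \<in> J"
  then obtain u w where x: "x = fscale bary u + dbary_wedge w" "u \<in> F" "w \<in> F" unfolding J_def by blast
  have "ext_deriv x = fscale bary (ext_deriv u) + dbary_wedge (u - ext_deriv w)"
  proof -
    have "(\<Sum>i\<in>A. fscale (partial i bary) (dx_wedge i u)) = dbary_wedge u"
      unfolding dbary_wedge_def by (intro sum.cong HOL.refl) (simp add: partial_bary)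
    then show ?thesis
      using x by (simp add: ext_deriv_add ext_deriv_fscale[OF bary_P] ext_deriv_dbary_wedge dbary_wedge_diff)
  qed
  then show ?thesis
    using x F_ext_deriv F_diff by (metis J_I)
qed

lemma J_parity: "x \<in> J \<Longrightarrow> parity x \<in> J"
proof -
  assume "x \<in> J"
  then obtain u w where x: "x = fscale bary u + dbary_wedge w" "u \<in> F" "w \<in> F" unfolding J_def by blast
  have p: "parity (dx_wedge i w) = dx_wedge i (- parity w)" for i
  proof
    fix K
    show "parity (dx_wedge i w) K = dx_wedge i (- parity w) K"
    proof (cases "finite K \<and> i \<in> K")
      case True
      then obtain n where "card K = Suc n" "card (K - {i}) = n" by (metis card_Suc_Diff1)
      then show ?thesis
        using True by (simp add: parity_def dx_wedge_def ac_simps del: card_Diff_singleton card_Diff_insert)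
    next
      case False
      then show ?thesis
        using form_support_finite[OF finite_A F_support[OF x(3)], of "K - {i}"]
        by (auto simp: parity_def dx_wedge_def)
    qed
  qed
  have "parity x = fscale bary (parity u) + dbary_wedge (- parity w)"
    unfolding x by (simp add: parity_add parity_fscale dbary_wedge_def form_operator_sum p)
  then show ?thesis
    using x F_parity F_uminus by (metis J_I)
qed

text \<open>Contraction with the radial vector field \<open>\<Sum> (x\<^sub>i - \<delta>\<^sub>i\<^sub>,\<^sub>b) \<partial>/\<partial>x\<^sub>i\<close> at the vertex \<open>b\<close>.\<close>

definition radial :: "'i \<Rightarrow> 'i \<Rightarrow> ('i \<Rightarrow>\<^sub>0 nat) \<Rightarrow>\<^sub>0 ('v \<Rightarrow> 'k)" where
  "radial b i = pvar i - (if i = b then 1 else 0)"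

definition contract_radial :: "'i \<Rightarrow> ('i, 'v \<Rightarrow> 'k) form \<Rightarrow> ('i, 'v \<Rightarrow> 'k) form" where
  "contract_radial b w = (\<Sum>i\<in>A. fscale (radial b i) (contract i w))"

lemma radial_const: "i \<in> A \<Longrightarrow> radial b i \<in> pm_over A (range (\<lambda>c v. c))"
  unfolding radial_def
  by (intro pm_over_diff[OF lin_sub_range_const] pm_over_const_pvar)
    (auto simp: pm_over_zero pm_over_const_one)

lemma partial_radial: "partial j (radial b i) = (if i = j then 1 else 0)"
  using partial_add[of j "radial b i" "if i = b then 1 else 0"]
  by (auto simp: radial_def partial_pvar simp del: One_nat_def)

text \<open>All partial derivatives of \<open>bary\<close> are 1, so this is the radial field
  applied to \<open>bary\<close>. The coordinate 1 of the vertex \<open>b\<close> supplies the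
  constant -1, whence \<open>b\<close> must lie in \<open>A\<close>.\<close>

lemma sum_radial: "b \<in> A \<Longrightarrow> (\<Sum>i\<in>A. radial b i) = bary"
  using finite_A by (simp add: radial_def bary_def sum_subtractf sum.delta del: One_nat_def)

lemma contract_radial_in:
  assumes N: "subspaces N" and w: "w \<in> forms_over A N"
  shows "contract_radial b w \<in> forms_over A (\<lambda>q. N (Suc q))"
proof -
  have N': "subspaces (\<lambda>q. N (Suc q))" using N by blast
  show ?thesis
    unfolding contract_radial_def
    using w by (intro lin_sub_sum[OF forms_over_lin_sub[OF N']] forms_over_fscale[OF N']
        radial_const forms_over_contract[OF N])
qed

lemma F_contract_radial: "w \<in> F \<Longrightarrow> contract_radial b w \<in> F"
  using contract_radial_in[OF subspaces_P] by simp

text \<open>Contracting the differential of \<open>bary\<close> gives \<open>bary\<close> by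
  \<open>sum_radial\<close>, so a summand \<open>dbary_wedge w\<close> contributes
  \<open>fscale bary w\<close>, again in the ideal.\<close>

lemma J_contract_radial:
  assumes b: "b \<in> A" and "x \<in> J"
  shows "contract_radial b x \<in> J"
proof -
  obtain u w where x: "x = fscale bary u + dbary_wedge w" "u \<in> F" "w \<in> F"
    using assms(2) unfolding J_def by blast
  have "contract_radial b (dbary_wedge w)
      = (\<Sum>i\<in>A. \<Sum>j\<in>A. fscale (radial b i) ((if i = j then w else 0) - dx_wedge j (contract i w)))"
    unfolding contract_radial_def dbary_wedge_def
    using x by (simp add: form_operator_sum contract_dx_wedge[OF finite_A F_support])
  also have "\<dots> = (\<Sum>i\<in>A. \<Sum>j\<in>A. if i = j then fscale (radial b i) w else 0)
      - (\<Sum>i\<in>A. \<Sum>j\<in>A. dx_wedge j (fscale (radial b i) (contract i w)))"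
    unfolding sum_subtractf[symmetric]
    by (intro sum.cong HOL.refl) (auto simp: fscale_diff dx_wedge_fscale fscale_uminus)
  also have "(\<Sum>i\<in>A. \<Sum>j\<in>A. if i = j then fscale (radial b i) w else 0) = fscale bary w"
    using finite_A by (simp add: sum.delta fscale_sum_left[symmetric] sum_radial[OF b])
  also have "(\<Sum>i\<in>A. \<Sum>j\<in>A. dx_wedge j (fscale (radial b i) (contract i w)))
      = dbary_wedge (contract_radial b w)"
    unfolding dbary_wedge_def contract_radial_def by (subst sum.swap) (simp add: form_operator_sum)
  finally have w: "contract_radial b (dbary_wedge w) = fscale bary w - dbary_wedge (contract_radial b w)" .
  have "contract_radial b (fscale bary u) = fscale bary (contract_radial b u)"
    unfolding contract_radial_def
    by (simp add: contract_fscale fscale_fscale form_operator_sum mult.commute)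
  moreover have "contract_radial b x = contract_radial b (fscale bary u) + contract_radial b (dbary_wedge w)"
    by (simp add: x contract_radial_def contract_add fscale_add sum.distrib)
  ultimately have "contract_radial b x
      = fscale bary (contract_radial b u + w) + dbary_wedge (- contract_radial b w)"
    by (simp add: w fscale_add dbary_wedge_uminus)
  then show ?thesis
    using x F_contract_radial F_uminus F_add by (metis J_I)
qed

text \<open>When the outer derivative hits a coefficient \<open>radial b i\<close>, the result is
  the form degree. When it hits \<open>w\<close>, the terms that mix different indices cancel
  against those of \<open>contract_radial b (ext_deriv w)\<close> by the anticommutation
  relation.\<close>

lemma cartan_formula:
  assumes w: "w \<in> F"
  shows "(ext_deriv (contract_radial b w) + contract_radial b (ext_deriv w)) K
    = of_nat (card K) * w K + (\<Sum>i\<in>A. radial b i * partial i (w K))"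
proof -
  let ?e = "radial b"
  have "ext_deriv (contract_radial b w)
      = (\<Sum>j\<in>A. \<Sum>i\<in>A. (if i = j then dx_wedge j (contract i w) else 0)
          + fscale (?e i) (dx_wedge j (contract i (pderiv_form j w))))"
    using w by (simp add: ext_deriv_eq F_contract_radial)
      (auto intro!: sum.cong simp: contract_radial_def form_operator_sum pderiv_form_fscale partial_radial
        dx_wedge_add dx_wedge_fscale pderiv_form_contract)
  also have "\<dots> = (\<Sum>j\<in>A. dx_wedge j (contract j w))
      + (\<Sum>j\<in>A. \<Sum>i\<in>A. fscale (?e i) (dx_wedge j (contract i (pderiv_form j w))))"
    using finite_A by (simp add: sum.distrib sum.delta)
  finally have 1: "ext_deriv (contract_radial b w) = \<dots>" .
  have "contract_radial b (ext_deriv w) = (\<Sum>i\<in>A. \<Sum>j\<in>A. (if i = j then fscale (?e i) (pderiv_form j w) else 0)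
          - fscale (?e i) (dx_wedge j (contract i (pderiv_form j w))))"
    unfolding contract_radial_def ext_deriv_eq[OF w] form_operator_sum
    by (intro sum.cong HOL.refl, subst contract_dx_wedge[OF finite_A F_support[OF F_pderiv[OF w]]])
      (simp add: fscale_diff fscale_uminus)
  also have "\<dots> = (\<Sum>i\<in>A. fscale (?e i) (pderiv_form i w))
      - (\<Sum>j\<in>A. \<Sum>i\<in>A. fscale (?e i) (dx_wedge j (contract i (pderiv_form j w))))"
    using finite_A by (subst (2) sum.swap) (simp add: sum_subtractf sum.delta)
  finally have 2: "contract_radial b (ext_deriv w) = \<dots>" .
  have "ext_deriv (contract_radial b w) + contract_radial b (ext_deriv w)
      = (\<Sum>j\<in>A. dx_wedge j (contract j w)) + (\<Sum>i\<in>A. fscale (?e i) (pderiv_form i w))"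
    unfolding 1 2 by simp
  moreover have "(\<Sum>j\<in>A. dx_wedge j (contract j w)) K = of_nat (card K) * w K"
  proof (cases "K \<subseteq> A")
    case True
    then have "(\<Sum>j\<in>A. dx_wedge j (contract j w)) K = (\<Sum>j\<in>K. w K)"
      using finite_A by (simp add: fun_sum_apply dx_wedge_contract sum.If_cases Int_absorb1)
    then show ?thesis by simp
  next
    case False
    then have "w K = 0" using F_support[OF w] by (auto simp: form_support_def)
    then show ?thesis by (simp add: fun_sum_apply dx_wedge_contract cong: if_cong)
  qed
  ultimately show ?thesis by (simp add: fun_sum_apply fscale_def pderiv_form_def)
qed

end

subsection \<open>The Poincare lemma\<close>

lemma lookup_single_zero_mult:
  "lookup (single 0 c * p) m = c * lookup p m"
  by (simp add: mult_map_scale_conv_mult[symmetric] Poly_Mapping.map.rep_eq when_def)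

lemma lookup_of_nat_mult:
  "lookup (of_nat n * p) m = of_nat n * lookup p m"
  using lookup_single_zero_mult[of "of_nat n" p m] by simp

lemma cscale_add: "cscale c (w + \<eta>) = cscale c w + cscale c \<eta>"
  by (simp add: cscale_def fscale_add)

lemma cscale_cscale: "cscale c (cscale c' w) = cscale (c * c') w"
  by (simp add: cscale_def fscale_fscale mult_single times_fun_def)

lemma cscale_one: "cscale 1 w = w"
  using fscale_one[of w] by (simp add: cscale_def one_fun_def[symmetric] del: fscale_one)

lemma cscale_uminus: "cscale c (- w) = - cscale c w"
  by (simp add: cscale_def fscale_def fun_eq_iff)

lemma cscale_diff: "cscale c (w - \<eta>) = cscale c w - cscale c \<eta>"
  by (simp add: cscale_def fscale_def fun_eq_iff algebra_simps)

lemma cscale_const_form: "cscale c (const_form f) = const_form (\<lambda>v. c * f v)"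
  by (auto simp: cscale_def fscale_def const_form_def fun_form_def fun_eq_iff mult_single times_fun_def)

lemma ext_deriv_const_form: "ext_deriv (const_form f) = 0"
  by (auto simp: ext_deriv_def const_form_def fun_form_def fun_eq_iff partial_single intro!: sum.neutral)

context simplex
begin

lemma const_single_P: "single 0 (\<lambda>v. c) \<in> pm_over A P"
  using pm_over_mono[OF const_in_P] pm_over_const_single by blast

lemma ext_deriv_cscale:
  assumes "w \<in> F" shows "ext_deriv (cscale c w) = cscale c (ext_deriv w)"
proof -
  have "partial i (single 0 (\<lambda>v::'v. c)) = 0" for i :: 'i
    by (simp add: partial_single)
  then show ?thesis
    unfolding cscale_def using ext_deriv_fscale[OF const_single_P assms] by simp
qed

text \<open>The shift of the origin to \<open>b\<close> only adds \<open>- partial b\<close>, whose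
  coefficient at \<open>m\<close> comes from a monomial of degree one higher. On the top degree part
  of a form this term is therefore invisible.\<close>

lemma lookup_radial_sum:
  assumes b: "b \<in> A"
  shows "lookup (\<Sum>i\<in>A. radial b i * partial i p) m
    = of_nat (\<Sum>i\<in>A. lookup m i) * lookup p m
      - of_nat (lookup m b + 1) * lookup p (m + single b 1)"
proof -
  have "(\<Sum>i\<in>A. radial b i * partial i p) = (\<Sum>i\<in>A. pvar i * partial i p) - partial b p"
  proof -
    have "(\<Sum>i\<in>A. radial b i * partial i p)
        = (\<Sum>i\<in>A. pvar i * partial i p - (if i = b then partial i p else 0))"
      by (intro sum.cong HOL.refl) (auto simp: radial_def left_diff_distrib)
    then show ?thesis using finite_A b by (simp add: sum_subtractf sum.delta)
  qed
  then show ?thesis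
    by (simp only: lookup_minus lookup_sum lookup_pvar_partial lookup_partial of_nat_sum sum_distrib_right)
qed

text \<open>By Cartan's formula the Lie derivative of \<open>w\<close> along the radial vector field is exact modulo \<open>J\<close>. It
  acts on the top degree part of \<open>w\<close> (polynomial degree plus form degree \<open>n\<close>) as multiplication by \<open>n\<close>, so
  that \<open>n w\<close> is an exact form plus a cocycle of lower degree.\<close>

theorem poincare_bounded:
  assumes N: "subspaces N" "\<And>q. N q \<subseteq> P"
    and w: "w \<in> forms_over A N" "ext_deriv w \<in> J"
    and bound: "\<And>K m. lookup (w K) m \<noteq> 0 \<Longrightarrow> (\<Sum>i\<in>A. lookup m i) + card K \<le> n"
  shows "\<exists>h\<in>N 0. \<exists>\<eta>\<in>forms_over A (\<lambda>q. N (Suc q)). w - const_form h - ext_deriv \<eta> \<in> J"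
  using w bound
proof (induction n arbitrary: w)
  case 0
  let ?h = "lookup (w {}) 0"
  have z0: "lin_sub (\<lambda>c f v. c * f v) (N q)" for q using N(1) by blast
  have "w = const_form ?h"
  proof (rule ext, rule poly_mapping_eqI)
    fix K m
    show "lookup (w K) m = lookup (const_form ?h K) m"
    proof (cases "lookup (w K) m = 0")
      case True
      then show ?thesis by (auto simp: const_form_def fun_form_def lookup_single when_def)
    next
      case False
      then have "w K \<noteq> 0" by auto
      then have "K \<subseteq> A" using forms_over_support[OF 0(1)] by (auto simp: form_support_def)
      moreover have "card K = 0" "\<And>i. i \<in> A \<Longrightarrow> lookup m i = 0"
        using 0(3)[OF False] finite_A by auto
      ultimately have K: "K = {}" using finite_subset[OF _ finite_A, of K] by auto
      have "keys m \<subseteq> A"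
        using forms_over_coeff[OF 0(1), of K] False by (auto simp: pm_over_def in_keys_iff)
      then have "m = 0"
        using \<open>\<And>i. i \<in> A \<Longrightarrow> lookup m i = 0\<close>
        by (intro poly_mapping_eqI) (metis in_keys_iff lookup_zero subsetD)
      then show ?thesis using K by (simp add: const_form_def fun_form_def)
    qed
  qed
  then have "w - const_form ?h - ext_deriv 0 = 0" by (simp add: ext_deriv_zero)
  moreover have "?h \<in> N 0"
    using forms_over_coeff[OF 0(1), of "{}"] lin_sub_zero[OF z0] by (auto simp: pm_over_iff)
  moreover have "0 \<in> forms_over A (\<lambda>q. N (Suc q))"
    using N(1) by (intro lin_sub_zero[OF forms_over_lin_sub]) auto
  ultimately show ?case using J_zero by metis
next
  case (Suc n)
  note V = forms_over_lin_sub[OF N(1)]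
  \<comment> \<open>The family \<open>N (q - 1)\<close> is chosen so that its shift by
    \<open>Suc\<close> is \<open>N\<close>; thus it accommodates \<open>ext_deriv w\<close>. The
    truncation at q = 0 is harmless, as a derivative has no coefficient at the empty set.\<close>
  have N': "subspaces (\<lambda>q. N (Suc q))" "subspaces (\<lambda>q. N (q - 1))" "\<And>q. N (q - 1) \<subseteq> P" using N by auto
  note V' = forms_over_lin_sub[OF N'(1)]
  obtain b where b: "b \<in> A" using nonempty_A by blast
  have wF: "w \<in> F" using Suc.prems(1) forms_over_mono[of N "\<lambda>_. P" A] N(2) by blast
  define \<iota> where "\<iota> = contract_radial b w"
  define Lie where "Lie = ext_deriv \<iota> + contract_radial b (ext_deriv w)"
  define c where "c = (of_nat (Suc n) :: 'k)"
  define w' where "w' = cscale c w - Lie"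
  have \<iota>: "\<iota> \<in> forms_over A (\<lambda>q. N (Suc q))"
    unfolding \<iota>_def by (rule contract_radial_in[OF N(1) Suc.prems(1)])
  have \<iota>F: "\<iota> \<in> F" unfolding \<iota>_def by (rule F_contract_radial[OF wF])
  have "ext_deriv w \<in> forms_over A (\<lambda>q. N (q - 1))"
    using Suc.prems(1) by (intro ext_deriv_in N') simp
  then have "contract_radial b (ext_deriv w) \<in> forms_over A N"
    using contract_radial_in[OF N'(2)] by fastforce
  then have "Lie \<in> forms_over A N"
    unfolding Lie_def by (intro lin_sub_add[OF V] ext_deriv_in N \<iota>)
  then have w': "w' \<in> forms_over A N"
    unfolding w'_def by (intro lin_sub_diff[OF V] lin_sub_scale[OF V] Suc.prems(1))
  have \<iota>d: "contract_radial b (ext_deriv w) \<in> J" by (rule J_contract_radial[OF b Suc.prems(2)])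
  have "ext_deriv w' = cscale c (ext_deriv w) - ext_deriv (contract_radial b (ext_deriv w))"
    by (simp add: w'_def Lie_def ext_deriv_diff ext_deriv_add ext_deriv_cscale[OF wF] ext_deriv_ext_deriv[OF \<iota>F])
  then have dw': "ext_deriv w' \<in> J"
    using J_diff[OF J_scale[OF Suc.prems(2)] J_ext_deriv[OF \<iota>d]] by simp
  have "(\<Sum>i\<in>A. lookup m i) + card K \<le> n" if nz: "lookup (w' K) m \<noteq> 0" for K m
  proof (rule ccontr)
    assume gt: "\<not> (\<Sum>i\<in>A. lookup m i) + card K \<le> n"
    let ?s = "\<Sum>i\<in>A. lookup m i"
    let ?m = "m + single b 1"
    have "(\<Sum>i\<in>A. lookup ?m i) = ?s + 1"
      using finite_A b by (simp add: lookup_add lookup_single sum.distrib when_def sum.delta')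
    then have 0: "lookup (w K) ?m = 0"
      using Suc.prems(3)[of K ?m] gt by fastforce
    have "Lie K = of_nat (card K) * w K + (\<Sum>i\<in>A. radial b i * partial i (w K))"
      unfolding Lie_def \<iota>_def by (rule cartan_formula[OF wF])
    then have "lookup (Lie K) m
        = of_nat (card K) * lookup (w K) m + of_nat ?s * lookup (w K) m"
      by (simp only: lookup_add lookup_of_nat_mult lookup_radial_sum[OF b] 0 mult_zero_right diff_zero)
    also have "\<dots> = of_nat (?s + card K) * lookup (w K) m"
      by (simp only: of_nat_add distrib_right add.commute)
    also have "\<dots> = of_nat (Suc n) * lookup (w K) m"
    proof (cases "lookup (w K) m = 0")
      case False
      then have "?s + card K = Suc n" using Suc.prems(3)[OF False] gt by linarith
      then show ?thesis by (simp only:)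
    qed simp
    finally have "lookup (w' K) m = 0"
      by (simp add: w'_def cscale_def fscale_def lookup_minus lookup_single_zero_mult c_def of_nat_fun
          del: of_nat_Suc)
    then show False using nz by simp
  qed
  from Suc.IH[OF w' dw' this] obtain h \<eta>
    where h: "h \<in> N 0" and \<eta>: "\<eta> \<in> forms_over A (\<lambda>q. N (Suc q))"
      and J': "w' - const_form h - ext_deriv \<eta> \<in> J" by blast
  have \<eta>F: "\<eta> \<in> F" using \<eta> forms_over_mono[of "\<lambda>q. N (Suc q)" "\<lambda>_. P" A] N(2) by blast
  have c: "inverse c * c = 1" unfolding c_def by (intro left_inverse) (simp del: of_nat_Suc)
  \<comment> \<open>By definition \<open>c w = w' + ext_deriv \<iota> + contract_radial b (ext_deriv
    w)\<close>, where the last term is in \<open>J\<close>. Substituting the decomposition of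
    \<open>w'\<close> and dividing by c gives the one for \<open>w\<close>.\<close>
  have "w - const_form (\<lambda>v. inverse c * h v) - ext_deriv (cscale (inverse c) (\<eta> + \<iota>))
      = cscale (inverse c) ((w' - const_form h - ext_deriv \<eta>) + contract_radial b (ext_deriv w))"
  proof -
    have "ext_deriv (cscale (inverse c) (\<eta> + \<iota>)) = cscale (inverse c) (ext_deriv \<eta>) + cscale (inverse c) (ext_deriv \<iota>)"
      using F_add[OF \<eta>F \<iota>F] \<eta>F \<iota>F by (simp add: ext_deriv_cscale ext_deriv_add cscale_add)
    moreover have "w = cscale (inverse c) (cscale c w)" by (simp add: cscale_cscale c cscale_one)
    ultimately show ?thesis
      by (simp add: w'_def Lie_def cscale_add cscale_diff cscale_uminus cscale_const_form)
  qed
  also have "\<dots> \<in> J"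
    by (intro J_scale J_add J' \<iota>d)
  finally show ?case
    using lin_sub_scale[OF N(1)[rule_format] h] lin_sub_scale[OF V' lin_sub_add[OF V' \<eta> \<iota>]] by blast
qed

theorem poincare:
  assumes N: "subspaces N" "\<And>q. N q \<subseteq> P" and w: "w \<in> forms_over A N" "ext_deriv w \<in> J"
  obtains h \<eta> where "h \<in> N 0" "\<eta> \<in> forms_over A (\<lambda>q. N (Suc q))" "w - const_form h - ext_deriv \<eta> \<in> J"
proof -
  define B where "B = (\<Union>K\<in>Pow A. (\<lambda>m. (\<Sum>i\<in>A. lookup m i) + card K) ` keys (w K))"
  have "finite B" unfolding B_def using finite_A by auto
  have "(\<Sum>i\<in>A. lookup m i) + card K \<le> Max B" if "lookup (w K) m \<noteq> 0" for K m
  proof (rule Max_ge[OF \<open>finite B\<close>])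
    have "w K \<noteq> 0" using that by auto
    then have "K \<in> Pow A" using forms_over_support[OF w(1)] by (auto simp: form_support_def)
    moreover have "m \<in> keys (w K)" using that by (simp add: in_keys_iff)
    ultimately show "(\<Sum>i\<in>A. lookup m i) + card K \<in> B" unfolding B_def by blast
  qed
  from poincare_bounded[OF N w this] show thesis using that by blast
qed

subsection \<open>The algebra of forms and its quotient\<close>

lemma F_one: "const_form 1 \<in> F"
  by (rule F_const_form[OF one_poly_funs])

lemma wedge_const_form:
  "w \<in> F \<Longrightarrow> wedge (const_form f) w = fscale (single 0 f) w"
  "w \<in> F \<Longrightarrow> wedge w (const_form f) = fscale (single 0 f) w"
  unfolding const_form_def by (simp_all add: wedge_fun_form[OF finite_A F_support])

lemma wedge_const_form_const_form:
  assumes "g \<in> P" shows "wedge (const_form f) (const_form g :: ('i, 'v \<Rightarrow> 'k) form) = const_form (f * g)"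
  unfolding wedge_const_form(1)[OF F_const_form[OF assms]]
  by (auto simp: fscale_def const_form_def fun_form_def mult_single)

lemma wedge_one: "w \<in> F \<Longrightarrow> wedge (const_form 1) w = w" "w \<in> F \<Longrightarrow> wedge w (const_form 1) = w"
  by (simp_all add: wedge_const_form)

lemma free_forms_simps:
  "carrier (free_forms scl A) = F" "monoid.mult (free_forms scl A) = wedge"
  "monoid.one (free_forms scl A) = const_form 1"
  "ring.zero (free_forms scl A) = 0" "ring.add (free_forms scl A) = (+)"
  by (simp_all only: F_eq) (simp_all add: free_forms_def)

lemma ring_free_forms: "ring (free_forms scl A)"
proof (rule ringI)
  show "abelian_group (free_forms scl A)"
  proof (rule abelian_groupI)
    fix x assume "x \<in> carrier (free_forms scl A)"
    then show "\<exists>y\<in>carrier (free_forms scl A). y \<oplus>\<^bsub>free_forms scl A\<^esub> x = \<zero>\<^bsub>free_forms scl A\<^esub>"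
      unfolding free_forms_simps by (intro bexI[of _ "- x"] F_uminus) auto
  qed (auto simp: free_forms_simps F_add F_zero ac_simps)
  show "Group.monoid (free_forms scl A)"
    by (rule monoidI) (auto simp: free_forms_simps F_wedge F_one wedge_assoc wedge_one)
qed (auto simp: free_forms_simps wedge_add_left wedge_add_right)

lemma free_forms_uminus: "x \<in> F \<Longrightarrow> \<ominus>\<^bsub>free_forms scl A\<^esub> x = - x"
proof -
  interpret ring "free_forms scl A" by (rule ring_free_forms)
  assume "x \<in> F"
  then show ?thesis by (intro minus_equality) (auto simp: free_forms_simps F_uminus)
qed

lemma wedge_dbary_left: "w \<in> F \<Longrightarrow> wedge (\<Sum>i\<in>A. dx_form i) w = dbary_wedge w"
  by (simp add: wedge_sum_left wedge_dx_form(1)[OF finite_A F_support] dbary_wedge_def)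

lemma wedge_dbary_right: "w \<in> F \<Longrightarrow> wedge w (\<Sum>i\<in>A. dx_form i) = dbary_wedge (parity w)"
  by (simp add: wedge_sum_right wedge_dx_form(2)[OF finite_A F_support] dbary_wedge_def)

lemma J_wedge_right:
  assumes "x \<in> J" "v \<in> F" shows "wedge x v \<in> J"
proof -
  obtain u w where x: "x = fscale bary u + dbary_wedge w" "u \<in> F" "w \<in> F" using assms unfolding J_def by blast
  have "wedge x v = fscale bary (wedge u v) + dbary_wedge (wedge w v)"
    using x assms by (simp add: wedge_add_left wedge_fscale wedge_dbary_left[symmetric] F_wedge wedge_assoc)
  then show ?thesis using x assms F_wedge by (metis J_I)
qed

text \<open>The differential of \<open>bary\<close> is moved to the left of \<open>v\<close>, at the
  price of replacing \<open>v\<close> by \<open>parity v\<close>.\<close>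

lemma J_wedge_left:
  assumes "x \<in> J" "v \<in> F" shows "wedge v x \<in> J"
proof -
  obtain u w where x: "x = fscale bary u + dbary_wedge w" "u \<in> F" "w \<in> F" using assms unfolding J_def by blast
  have "wedge v (dbary_wedge w) = wedge (wedge v (\<Sum>i\<in>A. dx_form i)) w"
    using x by (simp add: wedge_dbary_left[symmetric] wedge_assoc)
  also have "\<dots> = dbary_wedge (wedge (parity v) w)"
    unfolding wedge_dbary_right[OF assms(2)]
    using x assms by (simp add: wedge_dbary_left[symmetric] F_parity F_wedge wedge_assoc)
  finally have "wedge v x = fscale bary (wedge v u) + dbary_wedge (wedge (parity v) w)"
    by (simp add: x wedge_add_right wedge_fscale)
  then show ?thesis using x assms F_wedge F_parity by (metis J_I)
qed

lemma ideal_J: "ideal J (free_forms scl A)"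
proof (rule idealI[OF ring_free_forms])
  interpret ring "free_forms scl A" by (rule ring_free_forms)
  show "subgroup J (add_monoid (free_forms scl A))"
  proof (rule add.subgroupI)
    show "J \<noteq> {}" using J_zero by blast
    fix a assume "a \<in> J"
    then show "\<ominus>\<^bsub>free_forms scl A\<^esub> a \<in> J"
      using free_forms_uminus[of a] J_subset lin_sub_uminus[OF J_lin_sub, of a] by fastforce
  qed (use J_subset in \<open>auto simp: free_forms_simps intro: J_add\<close>)
qed (auto simp: free_forms_simps intro: J_wedge_left J_wedge_right)

text \<open>The pairs \<open>(1, 0)\<close> and \<open>(0, 1)\<close> for \<open>(u, w)\<close> give
  the generators, and \<open>J\<close> is an ideal. Conversely, every ideal containing the
  generators contains their right multiples by \<open>u\<close> and \<open>w\<close>.\<close>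

lemma simplex_ideal_eq: "simplex_ideal scl A = J"
proof
  interpret ring "free_forms scl A" by (rule ring_free_forms)
  let ?a = "(\<Sum>i\<in>A. x_form i) - const_form 1 :: ('i, 'v \<Rightarrow> 'k) form"
  let ?b = "\<Sum>i\<in>A. dx_form i :: ('i, 'v \<Rightarrow> 'k) form"
  have a: "?a = fun_form bary"
    by (auto simp: fun_eq_iff fun_sum_apply bary_def x_form_def const_form_def fun_form_def)
  have bF: "?b \<in> F"
  proof (rule lin_sub_sum[OF F_lin_sub])
    fix i assume "i \<in> A"
    then have "dx_wedge i (const_form 1) \<in> F" by (intro F_dx_wedge F_one)
    moreover have "dx_wedge i (const_form 1) = (dx_form i :: ('i, 'v \<Rightarrow> 'k) form)"
    proof
      fix K :: "'i set"
      have "K = {i}" if "i \<in> K" "K - {i} = {}" using that by blast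
      then show "dx_wedge i (const_form 1) K = (dx_form i K :: ('i \<Rightarrow>\<^sub>0 nat) \<Rightarrow>\<^sub>0 ('v \<Rightarrow> 'k))"
        by (auto simp: dx_wedge_def const_form_def fun_form_def dx_form_def)
    qed
    ultimately show "dx_form i \<in> F" by simp
  qed
  have "?a = fscale bary (const_form 1) + dbary_wedge 0"
    unfolding a by (auto simp: fun_eq_iff fscale_def fun_form_def const_form_def dbary_wedge_def)
  then have "?a \<in> J" using J_I[OF F_one F_zero] by simp
  moreover have "?b = fscale bary 0 + dbary_wedge (const_form 1)"
    using wedge_dbary_left[OF F_one] wedge_one(2)[OF bF] by simp
  then have "?b \<in> J" using J_I[OF F_zero F_one] by simp
  ultimately show "simplex_ideal scl A \<subseteq> J"
    unfolding simplex_ideal_def by (intro genideal_minimal[OF ideal_J]) auto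
  show "J \<subseteq> simplex_ideal scl A"
    unfolding simplex_ideal_def genideal_def
  proof (intro Inter_greatest subsetI)
    fix I x assume I: "I \<in> {I. ideal I (free_forms scl A) \<and> {?a, ?b} \<subseteq> I}" and "x \<in> J"
    then interpret I: ideal I "free_forms scl A" by blast
    obtain u w where x: "x = fscale bary u + dbary_wedge w" "u \<in> F" "w \<in> F"
      using \<open>x \<in> J\<close> unfolding J_def by blast
    have "wedge ?a u \<in> I" "wedge ?b w \<in> I"
      using I I.I_r_closed x by (auto simp: free_forms_simps)
    then have "wedge ?a u + wedge ?b w \<in> I"
      using I.a_closed by (simp add: free_forms_simps)
    then show "x \<in> I"
      unfolding a by (simp add: x wedge_fun_form(1)[OF finite_A F_support] wedge_dbary_left)
  qed
qed

lemma lin_pres_free_forms: "lin_pres (free_forms scl A) F {0} cscale (\<lambda>x. x)"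
proof
  show "lin_sub cscale {0::('i, 'v \<Rightarrow> 'k) form}" by (rule lin_subI) (auto simp: cscale_def)
  show "c \<odot>\<^bsub>free_forms scl A\<^esub> x = cscale c x" if "x \<in> F" for c x
    using that by (simp add: free_forms_def wedge_const_form cscale_def)
qed (auto simp: free_forms_simps F_lin_sub F_zero)

lemma mult_pres_free_forms: "mult_pres (free_forms scl A) F wedge (const_form 1) (\<lambda>x. x)"
  by unfold_locales (auto simp: free_forms_simps F_wedge F_one)

lemma form_class_eq: "form_class scl A = (\<lambda>x. J +>\<^bsub>free_forms scl A\<^esub> x)"
  by (simp add: fun_eq_iff form_class_def simplex_ideal_eq)

lemma lin_pres_simplex_forms: "lin_pres (simplex_forms scl A) F J cscale (form_class scl A)"
  unfolding simplex_forms_def simplex_ideal_eq form_class_eq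
  by (rule lin_pres.quotient[OF lin_pres_free_forms J_lin_sub])
    (use J_zero J_subset in \<open>auto simp: cscale_add\<close>)

lemma mult_pres_simplex_forms:
  "mult_pres (simplex_forms scl A) F wedge (const_form 1) (form_class scl A)"
  unfolding simplex_forms_def simplex_ideal_eq form_class_eq
  by (rule lin_pres.quotient_mult[OF lin_pres_free_forms J_lin_sub _ _ _ mult_pres_free_forms])
    (use J_zero J_subset in
      \<open>auto simp: wedge_add_left wedge_add_right intro: J_wedge_left J_wedge_right\<close>)

lemma form_class_set: "\<eta> \<in> F \<Longrightarrow> form_class scl A \<eta> = (\<lambda>h. h + \<eta>) ` J"
  unfolding form_class_eq a_r_coset_def' by (auto simp: free_forms_simps)

lemma form_class_eq_iff: "x \<in> F \<Longrightarrow> y \<in> F \<Longrightarrow> form_class scl A x = form_class scl A y \<longleftrightarrow> x - y \<in> J"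
  by (rule lin_pres.eq_iff[OF lin_pres_simplex_forms])

text \<open>Stability of \<open>J\<close> under the derivative makes all members of the union in
  \<open>simplex_d\<close> the same class.\<close>

lemma simplex_d_form_class:
  assumes "\<eta> \<in> F" shows "simplex_d scl A (form_class scl A \<eta>) = form_class scl A (ext_deriv \<eta>)"
proof -
  have "form_class scl A (ext_deriv (h + \<eta>)) = form_class scl A (ext_deriv \<eta>)" if "h \<in> J" for h
    using that assms J_subset J_ext_deriv
    by (subst form_class_eq_iff) (auto intro!: F_ext_deriv F_add simp: ext_deriv_add)
  moreover have "J \<noteq> {}" using J_zero by blast
  ultimately show ?thesis unfolding simplex_d_def form_class_set[OF assms] by auto
qed

section \<open>Vertex values of representatives\<close>

definition vertex_values :: "('i, 'v \<Rightarrow> 'k) form \<Rightarrow> 'i \<Rightarrow> 'v \<Rightarrow> 'k" where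
  "vertex_values \<eta> = (\<lambda>i. if i \<in> A then poly_eval (vertex i) (\<eta> {}) else 0)"

lemma vertex_values_add: "vertex_values (x + y) = vertex_values x + vertex_values y"
  by (auto simp: vertex_values_def fun_eq_iff poly_eval_add)

lemma vertex_values_diff: "vertex_values (x - y) = vertex_values x - vertex_values y"
  by (auto simp: vertex_values_def fun_eq_iff poly_eval_diff)

lemma vertex_values_zero: "vertex_values 0 = 0"
  by (auto simp: vertex_values_def fun_eq_iff)

lemma vertex_values_cscale: "vertex_values (cscale c x) = (\<lambda>i v. c * vertex_values x i v)"
  by (auto simp: vertex_values_def fun_eq_iff cscale_def fscale_def poly_eval_mult poly_eval_const)

lemma vertex_values_wedge: "vertex_values (wedge x y) = vertex_values x * vertex_values y"
  by (auto simp: vertex_values_def fun_eq_iff wedge_def poly_eval_mult)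

lemma vertex_values_ext_deriv: "vertex_values (ext_deriv x) = 0"
  by (auto simp: vertex_values_def fun_eq_iff ext_deriv_empty)

lemma vertex_values_const_form: "vertex_values (const_form f) = (\<lambda>i. if i \<in> A then f else 0)"
  by (auto simp: vertex_values_def const_form_def fun_form_def poly_eval_const)

text \<open>\<open>bary\<close> vanishes at every vertex, and a multiple of its differential has no
  coefficient at the empty set. Hence evaluation descends to the quotient.\<close>

lemma vertex_values_J: "x \<in> J \<Longrightarrow> vertex_values x = 0"
proof -
  assume "x \<in> J"
  then obtain u w where x: "x = fscale bary u + dbary_wedge w" unfolding J_def by blast
  have "poly_eval (vertex i) bary = 0" if "i \<in> A" for i
    using that finite_A by (simp add: bary_def poly_eval_diff poly_eval_sum poly_eval_pvar del: One_nat_def)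
  then show ?thesis
    by (auto simp: x vertex_values_def fun_eq_iff fscale_def dbary_wedge_def dx_wedge_def fun_sum_apply poly_eval_mult)
qed

lemma vertex_values_P: "x \<in> F \<Longrightarrow> i \<in> A \<Longrightarrow> vertex_values x i \<in> P"
  using poly_eval_vertex_in[OF lin_sub_poly_funs forms_over_coeff] by (simp add: vertex_values_def)

lemma vertices_eval_form_class:
  assumes "\<eta> \<in> F" shows "vertices_eval A (form_class scl A \<eta>) = vertex_values \<eta>"
proof
  fix i
  have J0: "J \<noteq> {}" using J_zero by blast
  have "poly_eval (vertex i) ((h + \<eta>) {}) = vertex_values \<eta> i" if "h \<in> J" "i \<in> A" for h
    using fun_cong[OF vertex_values_J[OF that(1)], of i] that by (simp add: vertex_values_def poly_eval_add)
  then have "(\<lambda>w. poly_eval (vertex i) (w {})) ` form_class scl A \<eta> = {vertex_values \<eta> i}" if "i \<in> A"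
    using J0 that unfolding form_class_set[OF assms] image_image
    by (simp add: image_constant_conv cong: image_cong_simp del: plus_fun_apply)
  then show "vertices_eval A (form_class scl A \<eta>) i = vertex_values \<eta> i"
    by (simp add: vertices_eval_def vertex_eval_def) (simp add: vertex_values_def)
qed

end

subsection \<open>The cohomology of \<open>Q\<^sup>*\<^sub>k(W)\<close>\<close>

lemma const_form_add: "const_form (f + g) = const_form f + const_form g"
  by (auto simp: const_form_def fun_form_def fun_eq_iff single_add)

lemma const_form_diff: "const_form (f - g) = const_form f - const_form g"
  by (auto simp: const_form_def fun_form_def fun_eq_iff single_diff)

lemma const_form_zero: "const_form 0 = 0"
  by (auto simp: const_form_def fun_form_def fun_eq_iff)

lemma const_form_sum: "const_form (\<Sum>x\<in>I. f x) = (\<Sum>x\<in>I. const_form (f x))"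
  by (induction I rule: infinite_finite_induct)
    (simp_all only: sum.infinite sum.empty sum.insert const_form_zero const_form_add not_False_eq_True)

interpretation fun_tuples: vector_space "\<lambda>c (f :: 'i \<Rightarrow> 'v \<Rightarrow> 'k::field) i v. c * f i v"
  by (unfold_locales; rule ext; rule ext; simp add: algebra_simps)

locale quasi_system = simplex scl A
  for scl :: "'k::field_char_0 \<Rightarrow> 'v::ab_group_add \<Rightarrow> 'v" and A :: "'i::linorder set" +
  fixes \<alpha> :: "'i \<Rightarrow> 'v \<Rightarrow> 'k" and \<sigma> :: "'i \<Rightarrow> 'v \<Rightarrow> 'v" and k :: "'i \<Rightarrow> nat"
  assumes involution: "i \<in> A \<Longrightarrow> linear_involution scl (\<alpha> i) (\<sigma> i)"
begin

abbreviation Qi :: "'i \<Rightarrow> ('v \<Rightarrow> 'k) set" where "Qi i \<equiv> quasi_inv1 scl (\<alpha> i) (\<sigma> i) (k i)"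
abbreviation Qk :: "('v \<Rightarrow> 'k) set" where "Qk \<equiv> carrier (quasi_inv scl A \<alpha> \<sigma> k)"
abbreviation Q where "Q \<equiv> Q_dga scl A \<alpha> \<sigma> k"
abbreviation d where "d \<equiv> Q_d scl A"
abbreviation H_dg where "H_dg \<equiv> H_deg scl A \<alpha> \<sigma> k"
abbreviation Sk where "Sk \<equiv> S_space scl A \<alpha> \<sigma> k"
abbreviation Q_dg where "Q_dg \<equiv> Q_deg scl A \<alpha> \<sigma> k"
abbreviation Hev where "Hev \<equiv> H_ev scl A \<alpha> \<sigma> k"
abbreviation Hodd where "Hodd \<equiv> H_odd scl A \<alpha> \<sigma> k"
abbreviation QkW where "QkW \<equiv> quasi_inv scl A \<alpha> \<sigma> k"
abbreviation to_H where "to_H \<equiv> Q_to_H scl A \<alpha> \<sigma> k"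
abbreviation coker where "coker \<equiv> coker_space scl A \<alpha> \<sigma> k"
abbreviation tuples :: "('i \<Rightarrow> 'v \<Rightarrow> 'k) set" where "tuples \<equiv> carrier (prod_alg A (\<lambda>i. P))"

definition E :: "('i, 'v \<Rightarrow> 'k) form set" where
  "E = {\<eta> \<in> F. \<forall>i\<in>A. vertex_values \<eta> i \<in> Qi i}"

definition q :: "('i, 'v \<Rightarrow> 'k) form \<Rightarrow> ('i, 'v, 'k) qdga" where
  "q \<eta> = (vertex_values \<eta>, form_class scl A \<eta>)"

definition Z :: "('i, 'v \<Rightarrow> 'k) form set" where
  "Z = {\<eta> \<in> E. ext_deriv \<eta> \<in> J}"

text \<open>\<open>J\<close> is added so that this is the full preimage of the coboundaries in
  \<open>E\<close>, and not just a set of representatives.\<close>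

definition B :: "('i, 'v \<Rightarrow> 'k) form set" where
  "B = {ext_deriv \<eta> + j | \<eta> j. \<eta> \<in> E \<and> j \<in> J}"

abbreviation cls :: "('i, 'v \<Rightarrow> 'k) form \<Rightarrow> ('i, 'v, 'k) qdga set" where
  "cls \<eta> \<equiv> cohomology_class Q d (q \<eta>)"

lemma Qk_eq: "Qk = {f \<in> P. \<forall>i\<in>A. f \<in> Qi i}"
  by (auto simp: quasi_inv_def quasi_inv1_def)

lemma Qi_lin_sub: "lin_sub (\<lambda>c f v. c * f v) (Qi i)"
  by (simp add: lin_sub_fun_iff subspace_quasi_inv1)

lemma E_F: "\<eta> \<in> E \<Longrightarrow> \<eta> \<in> F"
  by (simp add: E_def)

lemma E_lin_sub: "lin_sub cscale E"
proof (rule lin_subI)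
  show "0 \<in> E" using lin_sub_zero[OF Qi_lin_sub] by (auto simp: E_def F_zero vertex_values_zero)
  show "x - y \<in> E" if "x \<in> E" "y \<in> E" for x y
    using that lin_sub_diff[OF Qi_lin_sub] by (auto simp: E_def F_diff vertex_values_diff)
  show "cscale c x \<in> E" if "x \<in> E" for c x
    using that lin_sub_scale[OF Qi_lin_sub] F_scale by (auto simp: E_def vertex_values_cscale)
qed

lemma E_zero_values: "\<eta> \<in> F \<Longrightarrow> vertex_values \<eta> = 0 \<Longrightarrow> \<eta> \<in> E"
  using lin_sub_zero[OF Qi_lin_sub] by (simp add: E_def)

lemma J_E: "J \<subseteq> E"
  using J_subset vertex_values_J E_zero_values by blast

text \<open>A derivative has no function part, so it vanishes at the vertices whatever the vertex
  values of \<open>\<eta>\<close> are. For \<open>\<eta>\<close> outside \<open>E\<close> it may be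
  a nontrivial class: this is the source of the odd cohomology.\<close>

lemma ext_deriv_E: "\<eta> \<in> F \<Longrightarrow> ext_deriv \<eta> \<in> E"
  by (intro E_zero_values F_ext_deriv vertex_values_ext_deriv)

lemma E_wedge: "x \<in> E \<Longrightarrow> y \<in> E \<Longrightarrow> wedge x y \<in> E"
  using linear_involution.quasi_inv1_mult[OF involution] by (auto simp: E_def F_wedge vertex_values_wedge)

lemma E_parity: "x \<in> E \<Longrightarrow> parity x \<in> E"
  by (auto simp: E_def F_parity) (simp add: vertex_values_def parity_def)

lemma E_const_form_iff: "f \<in> P \<Longrightarrow> const_form f \<in> E \<longleftrightarrow> f \<in> Qk"
  by (simp add: Qk_eq E_def F_const_form vertex_values_const_form)

lemma const_form_one_E: "const_form 1 \<in> E"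
proof -
  have "1 \<in> Qk"
    by (simp add: Qk_eq const_quasi_inv1[of 1, folded one_fun_def] one_poly_funs)
  then show ?thesis using E_const_form_iff[OF one_poly_funs] by simp
qed

lemma lin_pres_Q: "lin_pres Q E J cscale q"
proof
  note S = lin_pres.carrier[OF lin_pres_simplex_forms] lin_pres.add[OF lin_pres_simplex_forms]
    lin_pres.zero[OF lin_pres_simplex_forms] lin_pres.smult[OF lin_pres_simplex_forms]
  show "carrier Q = q ` E"
  proof (intro Set.set_eqI iffI)
    fix x assume "x \<in> carrier Q"
    then obtain f C where x: "x = (f, C)" "\<forall>i\<in>A. f i \<in> Qi i" "C \<in> carrier (simplex_forms scl A)"
        "f = vertices_eval A C"
      by (auto simp: Q_dga_def fibre_product_def prod_alg_def)
    then obtain \<eta> where "\<eta> \<in> F" "C = form_class scl A \<eta>" by (auto simp: S)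
    then show "x \<in> q ` E"
      using x by (intro image_eqI[of _ _ \<eta>]) (auto simp: q_def E_def vertices_eval_form_class)
  next
    fix x assume "x \<in> q ` E"
    then show "x \<in> carrier Q"
      by (auto simp: E_def q_def Q_dga_def fibre_product_def prod_alg_def vertices_eval_form_class S)
        (simp add: vertex_values_def)
  qed
  show "q x = q y \<longleftrightarrow> x - y \<in> J" if "x \<in> E" "y \<in> E" for x y
    using that vertex_values_J[of "x - y"] by (auto simp: q_def E_F form_class_eq_iff vertex_values_diff)
  show "q x \<oplus>\<^bsub>Q\<^esub> q y = q (x + y)" if "x \<in> E" "y \<in> E" for x y
    using that by (simp add: q_def Q_dga_def fibre_product_def prod_alg_def S E_F vertex_values_add)
  show "\<zero>\<^bsub>Q\<^esub> = q 0"
    by (simp add: q_def Q_dga_def fibre_product_def prod_alg_def S vertex_values_zero)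
  show "a \<odot>\<^bsub>Q\<^esub> q x = q (cscale a x)" if "x \<in> E" for a x
    using that by (simp add: q_def Q_dga_def fibre_product_def prod_alg_def S E_F vertex_values_cscale)
qed (fact E_lin_sub J_lin_sub J_E)+

lemma mult_pres_Q: "mult_pres Q E wedge (const_form 1) q"
proof
  note S = mult_pres.mult[OF mult_pres_simplex_forms] mult_pres.one[OF mult_pres_simplex_forms]
  show "q x \<otimes>\<^bsub>Q\<^esub> q y = q (wedge x y)" if "x \<in> E" "y \<in> E" for x y
    using that by (simp add: q_def Q_dga_def fibre_product_def prod_alg_def S E_F vertex_values_wedge)
  show "\<one>\<^bsub>Q\<^esub> = q (const_form 1)"
    by (simp add: q_def Q_dga_def fibre_product_def prod_alg_def S vertex_values_const_form)
qed (fact E_wedge const_form_one_E)+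

lemma d_q: "\<eta> \<in> F \<Longrightarrow> d (q \<eta>) = q (ext_deriv \<eta>)"
  by (simp add: Q_d_def q_def simplex_d_form_class vertex_values_ext_deriv)

lemma Z_E: "\<eta> \<in> Z \<Longrightarrow> \<eta> \<in> E" and Z_F: "\<eta> \<in> Z \<Longrightarrow> \<eta> \<in> F"
  by (auto simp: Z_def E_F)

lemma Z_lin_sub: "lin_sub cscale Z"
  using lin_sub_zero[OF E_lin_sub] lin_sub_diff[OF E_lin_sub] lin_sub_scale[OF E_lin_sub]
    J_zero J_diff J_scale
  by (intro lin_subI) (auto simp: Z_def ext_deriv_zero ext_deriv_diff ext_deriv_cscale E_F)

lemma B_I: "\<eta> \<in> E \<Longrightarrow> j \<in> J \<Longrightarrow> ext_deriv \<eta> + j \<in> B"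
  by (auto simp: B_def)

lemma ext_deriv_B: "\<eta> \<in> E \<Longrightarrow> ext_deriv \<eta> \<in> B"
  using B_I[of \<eta> 0] J_zero by simp

lemma B_lin_sub: "lin_sub cscale B"
proof (rule lin_subI)
  show "0 \<in> B"
    using ext_deriv_B[OF lin_sub_zero[OF E_lin_sub]] by (simp add: ext_deriv_zero)
  fix x c assume "x \<in> B"
  then obtain \<eta> j where x: "x = ext_deriv \<eta> + j" "\<eta> \<in> E" "j \<in> J" unfolding B_def by blast
  have "cscale c x = ext_deriv (cscale c \<eta>) + cscale c j"
    using x by (simp add: cscale_add ext_deriv_cscale E_F)
  then show "cscale c x \<in> B"
    using B_I[OF lin_sub_scale[OF E_lin_sub x(2)] J_scale[OF x(3)]] by simp
  fix y assume "y \<in> B"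
  then obtain \<eta>' j' where y: "y = ext_deriv \<eta>' + j'" "\<eta>' \<in> E" "j' \<in> J" unfolding B_def by blast
  have "x - y = ext_deriv (\<eta> - \<eta>') + (j - j')" by (simp add: x y ext_deriv_diff)
  then show "x - y \<in> B"
    using B_I[OF lin_sub_diff[OF E_lin_sub x(2) y(2)] J_diff[OF x(3) y(3)]] by simp
qed

lemma J_B: "J \<subseteq> B"
  using B_I[OF lin_sub_zero[OF E_lin_sub]] by (auto simp: ext_deriv_zero)

lemma B_Z: "B \<subseteq> Z"
proof
  fix x assume "x \<in> B"
  then obtain \<eta> j where x: "x = ext_deriv \<eta> + j" "\<eta> \<in> E" "j \<in> J" unfolding B_def by blast
  then show "x \<in> Z"
    using lin_sub_add[OF E_lin_sub ext_deriv_E, of \<eta> j] J_E J_ext_deriv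
    by (auto simp: Z_def E_F ext_deriv_add ext_deriv_ext_deriv)
qed

lemma J_Z: "J \<subseteq> Z"
  using J_B B_Z by blast

lemma Z_wedge: "x \<in> Z \<Longrightarrow> y \<in> Z \<Longrightarrow> wedge x y \<in> Z"
  using J_add[OF J_wedge_right J_wedge_left, of "ext_deriv x" y "ext_deriv y" "parity x"]
  by (simp add: Z_def E_wedge E_F ext_deriv_wedge F_parity)

text \<open>By the Leibniz rule \<open>ext_deriv \<eta>\<close> times \<open>z\<close> is the
  derivative of \<open>wedge \<eta> z\<close> up to a multiple of \<open>ext_deriv z\<close>, which
  lies in \<open>J\<close>. On the other side \<open>parity z\<close> compensates the sign.\<close>

lemma B_wedge:
  assumes x: "x \<in> B" and z: "z \<in> Z"
  shows "wedge x z \<in> B" "wedge z x \<in> B"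
proof -
  obtain \<eta> j where x: "x = ext_deriv \<eta> + j" "\<eta> \<in> E" "j \<in> J" using x unfolding B_def by blast
  note F = E_F[OF x(2)] Z_F[OF z] and add = J_add and diff = J_diff
  have z': "z \<in> E" "ext_deriv z \<in> J" using z by (auto simp: Z_def)
  have "wedge x z = ext_deriv (wedge \<eta> z) + (wedge j z - wedge (parity \<eta>) (ext_deriv z))"
    using F by (simp add: x(1) wedge_add_left ext_deriv_wedge)
  moreover have "wedge j z - wedge (parity \<eta>) (ext_deriv z) \<in> J"
    using F x z' by (intro diff J_wedge_left J_wedge_right F_parity)
  ultimately show "wedge x z \<in> B" using B_I[OF E_wedge[OF x(2) z'(1)]] by metis
  have "wedge z x = ext_deriv (wedge (parity z) \<eta>) + (wedge z j + wedge (parity (ext_deriv z)) \<eta>)"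
  proof -
    have "wedge (- u) \<eta> = - wedge u \<eta>" for u
      by (simp add: wedge_def fun_eq_iff sum_negf)
    then show ?thesis
      using F by (simp add: x(1) wedge_add_right ext_deriv_wedge F_parity ext_deriv_parity)
  qed
  moreover have "wedge z j + wedge (parity (ext_deriv z)) \<eta> \<in> J"
    using F x z' by (intro add J_wedge_left J_wedge_right J_parity)
  ultimately show "wedge z x \<in> B" using B_I[OF E_wedge[OF E_parity[OF z'(1)] x(2)]] by metis
qed

lemma cocycles_eq: "cocycles Q d = q ` Z"
proof -
  have "d (q \<eta>) = \<zero>\<^bsub>Q\<^esub> \<longleftrightarrow> ext_deriv \<eta> \<in> J" if "\<eta> \<in> E" for \<eta>
    using that lin_pres.eq_zero_iff[OF lin_pres_Q ext_deriv_E] by (simp add: d_q E_F)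
  then show ?thesis by (auto simp: cocycles_def lin_pres.carrier[OF lin_pres_Q] Z_def)
qed

lemma coboundaries_eq: "coboundaries Q d = q ` B"
proof -
  have "q (ext_deriv \<eta> + j) = q (ext_deriv \<eta>)" if "\<eta> \<in> E" "j \<in> J" for \<eta> j
    using that J_E ext_deriv_E[OF E_F]
    by (subst lin_pres.eq_iff[OF lin_pres_Q]) (auto intro: lin_sub_add[OF E_lin_sub])
  moreover have "coboundaries Q d = (\<lambda>\<eta>. q (ext_deriv \<eta>)) ` E"
    by (simp add: coboundaries_def lin_pres.carrier[OF lin_pres_Q] image_image d_q E_F cong: image_cong_simp)
  moreover have "0 \<in> J" by (rule J_zero)
  ultimately show ?thesis unfolding B_def by (fastforce simp: image_iff)
qed

text \<open>A coset refers to the addition of the record but not to its carrier, so it may be formed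
  inside the cocycles, where \<open>lin_pres.quotient\<close> applies.\<close>

lemma cohomology_class_cocycles:
  "cohomology_class Q d = (\<lambda>x. coboundaries Q d +>\<^bsub>Q\<lparr>carrier := cocycles Q d\<rparr>\<^esub> x)"
  by (simp add: cohomology_class_def fun_eq_iff a_r_coset_def')

lemma lin_pres_cocycles: "lin_pres (Q\<lparr>carrier := cocycles Q d\<rparr>) Z J cscale q"
  unfolding cocycles_eq by (rule lin_pres.restrict[OF lin_pres_Q Z_lin_sub J_Z]) (auto simp: Z_E)

lemma lin_pres_H: "lin_pres (cohomology Q d) Z B cscale cls"
  unfolding cohomology_def cohomology_class_cocycles
  by (rule lin_pres.quotient[OF lin_pres_cocycles B_lin_sub J_B B_Z coboundaries_eq cscale_add])

lemma mult_pres_H: "mult_pres (cohomology Q d) Z wedge (const_form 1) cls"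
  unfolding cohomology_def cohomology_class_cocycles
proof (rule lin_pres.quotient_mult[OF lin_pres_cocycles B_lin_sub J_B B_Z coboundaries_eq _
      wedge_add_left wedge_add_right])
  have "const_form 1 \<in> Z"
    using const_form_one_E J_zero by (simp add: Z_def ext_deriv_const_form)
  then show "mult_pres (Q\<lparr>carrier := cocycles Q d\<rparr>) Z wedge (const_form 1) q"
    using mult_pres_Q by (auto simp: mult_pres_def Z_wedge Z_E)
qed (auto intro: B_wedge)

lemma cls_eq_iff: "x \<in> Z \<Longrightarrow> y \<in> Z \<Longrightarrow> cls x = cls y \<longleftrightarrow> x - y \<in> B"
  by (rule lin_pres.eq_iff[OF lin_pres_H])

text \<open>\<open>S\<close> is a space of normal forms for the classes in question: constant forms
  in the even case, derivatives of interpolations in the odd case. Each homogeneous class must have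
  a normal form, and each normal form must split into homogeneous ones.\<close>

lemma carrier_cohomology_part:
  assumes S: "lin_sub cscale S" "S \<subseteq> Z"
    and deg: "\<And>n. p n \<Longrightarrow> cohomology_deg Q d gr n \<subseteq> cls ` S"
    and decomp: "\<And>s. s \<in> S \<Longrightarrow> \<exists>I g. finite I \<and> I \<subseteq> Collect p \<and>
      (\<forall>n\<in>I. g n \<in> S \<and> cls (g n) \<in> cohomology_deg Q d gr n) \<and> s = (\<Sum>n\<in>I. g n)"
  shows "carrier (cohomology_part Q d gr p) = cls ` S"
proof (intro Set.set_eqI iffI)
  interpret abelian_monoid "cohomology Q d" by (rule lin_pres.abelian_monoid[OF lin_pres_H])
  note H = lin_pres.carrier[OF lin_pres_H] lin_pres.finsum[OF lin_pres_H]
  fix x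
  {
    assume "x \<in> carrier (cohomology_part Q d gr p)"
    then obtain h I where I: "finite I" "I \<subseteq> Collect p" "\<forall>n\<in>I. h n \<in> cohomology_deg Q d gr n"
      and x: "x = finsum (cohomology Q d) h I"
      by (auto simp: cohomology_part_def)
    then have "\<forall>n\<in>I. \<exists>s\<in>S. h n = cls s" using deg by blast
    then obtain g where g: "\<forall>n\<in>I. g n \<in> S \<and> h n = cls (g n)" by metis
    then have "x = finsum (cohomology Q d) (\<lambda>n. cls (g n)) I"
      unfolding x using S(2) by (intro finsum_cong') (auto simp: H)
    also have "\<dots> = cls (sum g I)" using g S(2) I by (intro H) auto
    finally show "x \<in> cls ` S" using lin_sub_sum[OF S(1), of I g] g by auto
  }
  assume "x \<in> cls ` S"
  then obtain s where s: "s \<in> S" "x = cls s" by blast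
  from decomp[OF s(1)] obtain I g where I: "finite I" "I \<subseteq> Collect p" "s = (\<Sum>n\<in>I. g n)"
    and g: "\<forall>n\<in>I. g n \<in> S \<and> cls (g n) \<in> cohomology_deg Q d gr n" by blast
  have "x = finsum (cohomology Q d) (\<lambda>n. cls (g n)) I"
    unfolding s(2) I(3) using g S(2) I by (intro H(2)[symmetric]) auto
  then show "x \<in> carrier (cohomology_part Q d gr p)"
    using I g by (auto simp: cohomology_part_def)
qed

section \<open>Homogeneous components of the cohomology\<close>

definition coeffs_deg :: "nat \<Rightarrow> nat \<Rightarrow> ('v \<Rightarrow> 'k) set" where
  "coeffs_deg n r = (if r \<le> n \<and> even (n - r) then hom_poly scl ((n - r) div 2) else {0})"

lemma subspaces_coeffs_deg: "subspaces (coeffs_deg n)"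
proof
  have "lin_sub (\<lambda>c f v. c * f v) {0 :: 'v \<Rightarrow> 'k}" by (rule lin_subI) (auto simp: fun_eq_iff)
  then show "lin_sub (\<lambda>c f v. c * f v) (coeffs_deg n r)" for r
    by (simp add: coeffs_deg_def lin_sub_hom_poly)
qed

lemma coeffs_deg_P: "coeffs_deg n r \<subseteq> P"
  using hom_poly_subset lin_sub_zero[OF lin_sub_poly_funs] by (auto simp: coeffs_deg_def)

text \<open>The parity of the total degree decides which of the first two form degrees is empty: 1
  in the even case, 0 in the odd case.\<close>

lemma coeffs_deg_simps:
  "coeffs_deg (2 * e) 0 = hom_poly scl e" "coeffs_deg (2 * e) (Suc 0) = {0}"
  "coeffs_deg (2 * e + 1) 0 = {0}" "coeffs_deg (2 * e + 1) (Suc 0) = hom_poly scl e"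
  by (auto simp: coeffs_deg_def)

lemma forms_coeffs_deg_F: "w \<in> forms_over A (coeffs_deg n) \<Longrightarrow> w \<in> F"
  "w \<in> forms_over A (\<lambda>r. coeffs_deg n (Suc r)) \<Longrightarrow> w \<in> F"
  using forms_over_mono[of "coeffs_deg n" "\<lambda>_. P" A]
    forms_over_mono[of "\<lambda>r. coeffs_deg n (Suc r)" "\<lambda>_. P" A] coeffs_deg_P by auto

lemma simplex_forms_deg_eq: "simplex_forms_deg scl A n = form_class scl A ` forms_over A (coeffs_deg n)"
proof -
  have iff: "f \<in> coeffs_deg n r \<longleftrightarrow> (\<exists>e. n = 2 * e + r \<and> f \<in> hom_poly scl e)" if "f \<noteq> 0" for f r
  proof (cases "r \<le> n \<and> even (n - r)")
    case True
    then have "n = 2 * e + r \<longleftrightarrow> e = (n - r) div 2" for e by auto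
    moreover have "coeffs_deg n r = hom_poly scl ((n - r) div 2)"
      unfolding coeffs_deg_def by (rule if_P[OF True])
    ultimately show ?thesis by simp
  next
    case False
    then have "n \<noteq> 2 * e + r" for e by auto
    moreover have "coeffs_deg n r = {0}"
      unfolding coeffs_deg_def by (rule if_not_P[OF False])
    ultimately show ?thesis using that by simp
  qed
  have "w \<in> forms_over A (coeffs_deg n) \<longleftrightarrow> w \<in> F \<and>
      (\<forall>K. \<forall>m\<in>keys (w K). \<exists>e. n = 2 * e + card K \<and> lookup (w K) m \<in> hom_poly scl e)"
    (is "?l \<longleftrightarrow> w \<in> F \<and> ?r") for w
  proof
    assume ?l
    then show "w \<in> F \<and> ?r"
      using forms_coeffs_deg_F(1)[OF \<open>?l\<close>] iff by (auto simp: forms_over_def pm_over_def in_keys_iff)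
  next
    assume "w \<in> F \<and> ?r"
    then show ?l using iff by (auto simp: forms_over_def pm_over_def in_keys_iff)
  qed
  then show ?thesis unfolding simplex_forms_deg_def F_eq[symmetric] by (intro arg_cong[where f = "(`) _"]) blast
qed

text \<open>Homogeneity of a class means that some representative is homogeneous. That
  representative differs from a given cocycle by an element of \<open>J\<close>, so it is a cocycle
  in \<open>E\<close> as well.\<close>

lemma H_deg_eq:
  "H_dg n = cls ` {w \<in> Z \<inter> forms_over A (coeffs_deg n).
    \<forall>i\<in>A. vertex_values w i = 0 \<or> (\<exists>e. n = 2 * e \<and> vertex_values w i \<in> hom_poly scl e)}" (is "_ = cls ` ?V")
proof -
  have "cocycles Q d \<inter> Q_dg n = q ` ?V"
  proof (intro Set.set_eqI iffI)
    fix x assume x: "x \<in> cocycles Q d \<inter> Q_dg n"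
    then obtain \<eta> where \<eta>: "\<eta> \<in> Z" "x = q \<eta>" by (auto simp: cocycles_eq)
    with x obtain w where w: "w \<in> forms_over A (coeffs_deg n)" "form_class scl A \<eta> = form_class scl A w"
      by (auto simp: Q_deg_def q_def simplex_forms_deg_eq)
    then have j: "w - \<eta> \<in> J"
      using \<eta> form_class_eq_iff[OF forms_coeffs_deg_F(1)[OF w(1)] Z_F[OF \<eta>(1)]] by simp
    then have "w \<in> Z" using lin_sub_add[OF Z_lin_sub \<eta>(1), of "w - \<eta>"] J_Z by auto
    then have "q w = x" using j \<eta> lin_pres.eq_iff[OF lin_pres_Q] by (auto simp: Z_E)
    then show "x \<in> q ` ?V" using x w \<open>w \<in> Z\<close> by (auto simp: Q_deg_def q_def)
  next
    fix x assume "x \<in> q ` ?V"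
    then show "x \<in> cocycles Q d \<inter> Q_dg n"
      using lin_pres.carrier[OF lin_pres_Q]
      by (auto simp: cocycles_eq Q_deg_def q_def simplex_forms_deg_eq Z_E intro: image_eqI)
  qed
  then show ?thesis by (simp add: H_deg_def cohomology_deg_def image_image)
qed

section \<open>Even cohomology\<close>

lemma const_form_Z_iff: "f \<in> P \<Longrightarrow> const_form f \<in> Z \<longleftrightarrow> f \<in> Qk"
  using J_zero by (simp add: Z_def E_const_form_iff ext_deriv_const_form)

lemma H_deg_even: "H_dg (2 * e) = cls ` const_form ` (Qk \<inter> hom_poly scl e)"
proof (intro Set.set_eqI iffI)
  fix x assume "x \<in> H_dg (2 * e)"
  then obtain w where x: "x = cls w" and w: "w \<in> Z" "w \<in> forms_over A (coeffs_deg (2 * e))"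
    by (auto simp: H_deg_eq)
  then obtain h \<eta> where h: "h \<in> coeffs_deg (2 * e) 0" and \<eta>: "\<eta> \<in> forms_over A (\<lambda>r. coeffs_deg (2 * e) (Suc r))"
    and j: "w - const_form h - ext_deriv \<eta> \<in> J"
    using poincare[OF subspaces_coeffs_deg coeffs_deg_P, of w] by (auto simp: Z_def)
  have hP: "h \<in> P" using h coeffs_deg_P by blast
  have "vertex_values w = vertex_values (const_form h)"
    using vertex_values_J[OF j] by (simp add: vertex_values_diff vertex_values_ext_deriv)
  then have hQ: "h \<in> Qk" using Z_E[OF w(1)] hP by (simp add: E_def E_const_form_iff[symmetric] F_const_form)
  \<comment> \<open>The coefficient at the empty set lies in
    \<open>coeffs_deg (2 * e) (Suc 0)\<close>, which is zero by parity.\<close>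
  have "\<eta> {} = 0"
    using forms_over_coeff[OF \<eta>, of "{}"] by (auto simp: coeffs_deg_simps pm_over_def in_keys_iff intro!: poly_mapping_eqI)
  then have "\<eta> \<in> E"
    by (intro E_zero_values forms_coeffs_deg_F(2)[OF \<eta>]) (auto simp: vertex_values_def fun_eq_iff)
  then have "ext_deriv \<eta> + (w - const_form h - ext_deriv \<eta>) \<in> B" by (rule B_I[OF _ j])
  then have "w - const_form h \<in> B" by (simp add: algebra_simps)
  then have "x = cls (const_form h)" using w(1) hQ hP by (simp add: x cls_eq_iff const_form_Z_iff)
  then show "x \<in> cls ` const_form ` (Qk \<inter> hom_poly scl e)"
    using hQ h by (auto simp: coeffs_deg_simps)
next
  fix x assume "x \<in> cls ` const_form ` (Qk \<inter> hom_poly scl e)"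
  then obtain f where f: "f \<in> Qk" "f \<in> hom_poly scl e" "x = cls (const_form f)" by blast
  then have fP: "f \<in> P" by (simp add: Qk_eq)
  have "const_form f \<in> forms_over A (coeffs_deg (2 * e))"
    using f by (auto simp: forms_over_def form_support_def const_form_def fun_form_def pm_over_zero coeffs_deg_simps
        intro: pm_over_single)
  then show "x \<in> H_dg (2 * e)"
    unfolding H_deg_eq f(3) using f fP
    by (intro imageI) (auto simp: const_form_Z_iff vertex_values_const_form)
qed

lemma Qk_lin_sub: "lin_sub (\<lambda>c f v. c * f v) Qk"
  unfolding Qk_eq
  using lin_sub_zero[OF Qi_lin_sub] lin_sub_diff[OF Qi_lin_sub] lin_sub_scale[OF Qi_lin_sub]
    lin_sub_zero[OF lin_sub_poly_funs] lin_sub_diff[OF lin_sub_poly_funs] lin_sub_scale[OF lin_sub_poly_funs]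
  by (intro lin_subI) auto

lemma Q_to_H_eq: "to_H f = cls (const_form f)"
  by (simp add: Q_to_H_def q_def vertex_values_const_form)

lemma carrier_H_ev: "carrier Hev = cls ` const_form ` Qk"
  unfolding H_ev_def
proof (rule carrier_cohomology_part)
  show "lin_sub cscale (const_form ` Qk)"
    using lin_sub_zero[OF Qk_lin_sub] lin_sub_diff[OF Qk_lin_sub] lin_sub_scale[OF Qk_lin_sub]
    by (intro lin_subI)
      (auto simp: cscale_const_form const_form_zero[symmetric] const_form_diff[symmetric])
  show "const_form ` Qk \<subseteq> Z" by (auto simp: const_form_Z_iff Qk_eq)
  show "cohomology_deg Q d Q_dg n \<subseteq> cls ` const_form ` Qk" if "even n" for n
    using that H_deg_even by (auto simp: H_deg_def elim!: evenE)
  fix s :: "('i, 'v \<Rightarrow> 'k) form"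
  assume "s \<in> const_form ` Qk"
  then obtain f where f: "f \<in> P" "\<forall>i\<in>A. f \<in> Qi i" "s = const_form f" by (auto simp: Qk_eq)
  obtain G n where G: "\<And>e. G e \<in> hom_poly scl e" "\<And>e. e \<ge> n \<Longrightarrow> G e = 0" "f = (\<Sum>e<n. G e)"
    using poly_funs_decomp[OF f(1)] by metis
  \<comment> \<open>The components of a quasi-invariant are quasi-invariant; otherwise the
    homogeneous classes might not exhaust the whole image.\<close>
  have "G e \<in> Qi i" if "i \<in> A" for e i
    using linear_involution.quasi_inv1_graded[OF involution[OF that], of G n "k i" e] f(2) G that by auto
  then have GQ: "G e \<in> Qk" for e
    using subsetD[OF hom_poly_subset G(1)] by (auto simp: Qk_eq)
  let ?I = "(\<lambda>e. 2 * e) ` {..<n}"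
  let ?g = "\<lambda>m. const_form (G (m div 2)) :: ('i, 'v \<Rightarrow> 'k) form"
  have "s = (\<Sum>m\<in>?I. ?g m)"
    by (subst sum.reindex) (auto simp: inj_on_def f(3) G(3) const_form_sum)
  moreover have "cls (?g m) \<in> cohomology_deg Q d Q_dg m" if "m \<in> ?I" for m
    using that GQ G(1) H_deg_even by (auto simp: H_deg_def)
  ultimately show "\<exists>I g. finite I \<and> I \<subseteq> Collect even \<and>
      (\<forall>m\<in>I. g m \<in> const_form ` Qk \<and> cls (g m) \<in> cohomology_deg Q d Q_dg m) \<and> s = (\<Sum>m\<in>I. g m)"
    using GQ by (intro exI[of _ ?I] exI[of _ ?g]) auto
qed

theorem even_cohomology:
  "algebra_iso QkW Hev to_H"
proof -
  interpret H: lin_pres "cohomology Q d" Z B cscale cls by (rule lin_pres_H)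
  interpret HM: mult_pres "cohomology Q d" Z wedge "const_form 1" cls by (rule mult_pres_H)
  have ops: "monoid.mult Hev = monoid.mult (cohomology Q d)"
    "monoid.one Hev = monoid.one (cohomology Q d)"
    "ring.add Hev = ring.add (cohomology Q d)"
    "module.smult Hev = module.smult (cohomology Q d)"
    by (simp_all add: H_ev_def cohomology_part_def)
  have ops': "f \<otimes>\<^bsub>QkW\<^esub> g = f * g" "\<one>\<^bsub>QkW\<^esub> = 1"
    "f \<oplus>\<^bsub>QkW\<^esub> g = f + g" "c \<odot>\<^bsub>QkW\<^esub> f = (\<lambda>v. c * f v)" for f g c
    by (simp_all add: quasi_inv_def)
  have QP: "f \<in> P" and QZ: "const_form f \<in> Z" if "f \<in> Qk" for f
    using that by (auto simp: Qk_eq const_form_Z_iff)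
  have bij: "bij_betw to_H Qk (carrier Hev)"
  proof (rule bij_betw_imageI)
    show "inj_on to_H Qk"
    proof (rule inj_onI)
      fix f g assume fg: "f \<in> Qk" "g \<in> Qk" "to_H f = to_H g"
      then have "const_form f - const_form g \<in> B" by (simp add: Q_to_H_eq cls_eq_iff QZ)
      then obtain \<eta> j where "const_form f - const_form g = ext_deriv \<eta> + j" "j \<in> J" unfolding B_def by blast
      \<comment> \<open>Coboundaries and elements of \<open>J\<close> vanish at the vertices, where
        the constants f and g can be read off; this takes at least one vertex.\<close>
      then have "vertex_values (const_form f - const_form g) = 0"
        by (simp add: vertex_values_add vertex_values_ext_deriv vertex_values_J)
      then have "vertex_values (const_form f) i = vertex_values (const_form g) i" for i
        by (simp add: vertex_values_diff)
      moreover obtain i where "i \<in> A" using nonempty_A by blast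
      ultimately show "f = g" by (metis vertex_values_const_form)
    qed
    show "to_H ` Qk = carrier Hev"
      unfolding carrier_H_ev image_image Q_to_H_eq ..
  qed
  have "to_H \<in> ring_iso QkW Hev"
    using bij bij_betw_imp_surj_on[OF bij]
    by (auto simp: ring_iso_def ring_hom_def ops ops' Q_to_H_eq H.add HM.mult HM.one QZ QP
        wedge_const_form_const_form const_form_add)
  moreover have "linear_iso QkW Hev to_H"
    using bij by (auto simp: linear_iso_def ops ops' Q_to_H_eq H.add H.smult QZ const_form_add cscale_const_form)
  ultimately show ?thesis by (simp add: algebra_iso_def)
qed

end

section \<open>Odd cohomology\<close>

context quasi_system
begin

text \<open>The affine function on the simplex with prescribed vertex values: a linear section of
  \<open>vertex_values\<close>, which singles out one primitive for each tuple.\<close>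

definition interpolate :: "('i \<Rightarrow> 'v \<Rightarrow> 'k) \<Rightarrow> ('i, 'v \<Rightarrow> 'k) form" where
  "interpolate g = fun_form (\<Sum>i\<in>A. pvar i * single 0 (g i))"

lemma interpolate_add: "interpolate (g + g') = interpolate g + interpolate g'"
  by (auto simp: interpolate_def fun_form_def fun_eq_iff single_add distrib_left sum.distrib)

lemma interpolate_cscale: "interpolate (\<lambda>i v. c * g i v) = cscale c (interpolate g)"
proof -
  have "single (0 :: 'i \<Rightarrow>\<^sub>0 nat) (\<lambda>v. c * g i v) = single 0 (\<lambda>v. c) * single 0 (g i)" for i
    by (simp add: mult_single times_fun_def)
  then show ?thesis
    by (auto simp: interpolate_def fun_form_def fun_eq_iff cscale_def fscale_def sum_distrib_left ac_simps)
qed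

lemma interpolate_in:
  assumes N: "subspaces N" and g: "\<And>i. i \<in> A \<Longrightarrow> g i \<in> N 0"
  shows "interpolate g \<in> forms_over A N"
proof -
  have V: "lin_sub (\<lambda>c f v. c * f v) (N 0)" using N by blast
  have "(\<Sum>i\<in>A. pvar i * single 0 (g i)) \<in> pm_over A (N 0)"
    by (intro pm_over_sum[OF V] pm_over_const_mult[OF V] pm_over_const_pvar pm_over_single g) auto
  then show ?thesis
    by (auto simp: interpolate_def fun_form_def forms_over_def form_support_def pm_over_zero)
qed

lemma tuples_iff: "g \<in> tuples \<longleftrightarrow> (\<forall>i\<in>A. g i \<in> P) \<and> (\<forall>i. i \<notin> A \<longrightarrow> g i = 0)"
  by (simp add: prod_alg_def)

lemma F_interpolate: "g \<in> tuples \<Longrightarrow> interpolate g \<in> F"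
  by (rule interpolate_in[OF subspaces_P]) (simp add: tuples_iff)

lemma vertex_values_interpolate: "g \<in> tuples \<Longrightarrow> vertex_values (interpolate g) = g"
  using finite_A
  by (auto simp: tuples_iff vertex_values_def interpolate_def fun_form_def poly_eval_sum poly_eval_mult
      poly_eval_pvar poly_eval_const fun_eq_iff fun_sum_apply if_distrib[of "\<lambda>x. x * _"] sum.delta
      simp del: One_nat_def cong: if_cong)

lemma vertex_values_tuples: "\<eta> \<in> F \<Longrightarrow> vertex_values \<eta> \<in> tuples"
  by (simp add: tuples_iff vertex_values_P) (simp add: vertex_values_def)

lemma tuples_lin_sub: "lin_sub (\<lambda>c f i v. c * f i v) tuples"
  using lin_sub_zero[OF lin_sub_poly_funs[of scl]] lin_sub_diff[OF lin_sub_poly_funs[of scl]]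
    lin_sub_scale[OF lin_sub_poly_funs[of scl]]
  by (intro lin_subI) (auto simp: tuples_iff zero_fun_def)

lemma ext_deriv_interpolate_Z: "g \<in> tuples \<Longrightarrow> ext_deriv (interpolate g) \<in> Z"
  using J_zero
  by (simp add: Z_def ext_deriv_E ext_deriv_ext_deriv F_interpolate)

text \<open>The two primitives agree at the vertices, so their difference lies in \<open>E\<close>
  and its derivative is a coboundary.\<close>

lemma cls_ext_deriv:
  assumes \<eta>: "\<eta> \<in> F"
  shows "ext_deriv \<eta> - ext_deriv (interpolate (vertex_values \<eta>)) \<in> B"
proof -
  note g = vertex_values_tuples[OF \<eta>]
  have "\<eta> - interpolate (vertex_values \<eta>) \<in> E"
    using \<eta> by (intro E_zero_values F_diff F_interpolate[OF g])
      (simp_all add: vertex_values_diff vertex_values_interpolate[OF g])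
  then show ?thesis using ext_deriv_B by (simp add: ext_deriv_diff[symmetric])
qed

lemma H_deg_odd:
  "H_dg (2 * e + 1)
    = (\<lambda>g. cls (ext_deriv (interpolate g))) ` carrier (prod_alg A (\<lambda>i. hom_poly scl e))"
proof (intro Set.set_eqI iffI)
  fix x assume "x \<in> H_dg (2 * e + 1)"
  then obtain w where x: "x = cls w" and w: "w \<in> Z" "w \<in> forms_over A (coeffs_deg (2 * e + 1))"
    by (auto simp: H_deg_eq)
  then obtain h \<eta> where h: "h \<in> coeffs_deg (2 * e + 1) 0"
    and \<eta>: "\<eta> \<in> forms_over A (\<lambda>r. coeffs_deg (2 * e + 1) (Suc r))"
    and j: "w - const_form h - ext_deriv \<eta> \<in> J"
    using poincare[OF subspaces_coeffs_deg coeffs_deg_P, of w] by (auto simp: Z_def)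
  \<comment> \<open>In odd total degree the coefficient space of form degree 0 is zero.\<close>
  have h0: "const_form h = 0" using h by (simp add: coeffs_deg_simps const_form_zero del: One_nat_def add_Suc_right)
  define g where "g = vertex_values \<eta>"
  have \<eta>F: "\<eta> \<in> F" by (rule forms_coeffs_deg_F(2)[OF \<eta>])
  have "(w - const_form h - ext_deriv \<eta>) + (ext_deriv \<eta> - ext_deriv (interpolate g)) \<in> B"
    unfolding g_def using j J_B cls_ext_deriv[OF \<eta>F] by (intro lin_sub_add[OF B_lin_sub]) auto
  then have "w - ext_deriv (interpolate g) \<in> B" by (simp add: h0)
  then have "x = cls (ext_deriv (interpolate g))"
    using w(1) vertex_values_tuples[OF \<eta>F] by (simp add: x cls_eq_iff ext_deriv_interpolate_Z g_def)
  moreover have "poly_eval (vertex i) (\<eta> {}) \<in> hom_poly scl e" for i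
    using poly_eval_vertex_in[OF lin_sub_hom_poly, of "\<eta> {}" A scl e i] forms_over_coeff[OF \<eta>, of "{}"]
    by (simp add: coeffs_deg_simps[simplified])
  then have "g \<in> carrier (prod_alg A (\<lambda>i. hom_poly scl e))"
    by (simp add: prod_alg_def g_def vertex_values_def)
  ultimately show "x \<in> (\<lambda>g. cls (ext_deriv (interpolate g))) ` carrier (prod_alg A (\<lambda>i. hom_poly scl e))" by blast
next
  fix x assume "x \<in> (\<lambda>g. cls (ext_deriv (interpolate g))) ` carrier (prod_alg A (\<lambda>i. hom_poly scl e))"
  then obtain g where x: "x = cls (ext_deriv (interpolate g))"
    and g: "\<forall>i\<in>A. g i \<in> hom_poly scl e" "\<forall>i. i \<notin> A \<longrightarrow> g i = 0" by (auto simp: prod_alg_def)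
  have gt: "g \<in> tuples" using g hom_poly_subset[of scl e] by (auto simp: tuples_iff)
  have "subspaces (\<lambda>r. coeffs_deg (2 * e + 1) (Suc r))" using subspaces_coeffs_deg by blast
  then have "interpolate g \<in> forms_over A (\<lambda>r. coeffs_deg (2 * e + 1) (Suc r))"
    using g(1) by (intro interpolate_in) (auto simp only: coeffs_deg_simps)
  then have "ext_deriv (interpolate g) \<in> forms_over A (coeffs_deg (2 * e + 1))"
    by (intro ext_deriv_in subspaces_coeffs_deg coeffs_deg_P)
  then show "x \<in> H_dg (2 * e + 1)"
    unfolding H_deg_eq x using ext_deriv_interpolate_Z[OF gt]
    by (intro imageI) (simp add: vertex_values_ext_deriv)
qed

lemma carrier_H_odd: "carrier Hodd = cls ` (\<lambda>g. ext_deriv (interpolate g)) ` tuples"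
  unfolding H_odd_def
proof (rule carrier_cohomology_part)
  let ?\<psi> = "\<lambda>g. ext_deriv (interpolate g)"
  have diff: "?\<psi> (g - g') = ?\<psi> g - ?\<psi> g'" for g g'
    using interpolate_add[of "g - g'" g'] by (simp add: ext_deriv_diff[symmetric] algebra_simps)
  have scale: "cscale c (?\<psi> g) = ?\<psi> (\<lambda>i v. c * g i v)" if "g \<in> tuples" for c g
    using F_interpolate[OF that] by (simp add: ext_deriv_cscale interpolate_cscale)
  have zero: "?\<psi> 0 = 0" using diff[of 0 0] by simp
  show "lin_sub cscale (?\<psi> ` tuples)"
  proof (rule lin_subI)
    show "0 \<in> ?\<psi> ` tuples" using lin_sub_zero[OF tuples_lin_sub] zero by (metis image_eqI)
    show "x - y \<in> ?\<psi> ` tuples" if "x \<in> ?\<psi> ` tuples" "y \<in> ?\<psi> ` tuples" for x y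
      using that lin_sub_diff[OF tuples_lin_sub] by (auto simp only: diff[symmetric] intro!: imageI)
    show "cscale c x \<in> ?\<psi> ` tuples" if "x \<in> ?\<psi> ` tuples" for c x
      using that lin_sub_scale[OF tuples_lin_sub] by (auto simp: scale)
  qed
  show "?\<psi> ` tuples \<subseteq> Z" using ext_deriv_interpolate_Z by blast
  show "cohomology_deg Q d Q_dg n \<subseteq> cls ` ?\<psi> ` tuples" if n: "odd n" for n
  proof -
    obtain e where "n = 2 * e + 1" using n by (rule oddE)
    moreover have "carrier (prod_alg A (\<lambda>i. hom_poly scl e)) \<subseteq> tuples"
      using hom_poly_subset[of scl e] by (auto simp: prod_alg_def)
    ultimately show ?thesis using H_deg_odd[of e] by (auto simp: H_deg_def)
  qed
  fix s assume "s \<in> ?\<psi> ` tuples"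
  then obtain g where g: "g \<in> tuples" "s = ?\<psi> g" by blast
  have "\<exists>G n. (\<forall>e. G e \<in> hom_poly scl e) \<and> (\<forall>e\<ge>n. G e = 0) \<and> g i = (\<Sum>e<n. G e)" if "i \<in> A" for i
  proof -
    have "g i \<in> P" using g that by (simp add: tuples_iff)
    then show ?thesis by (rule poly_funs_decomp) metis
  qed
  then obtain G n where G: "\<And>i e. i \<in> A \<Longrightarrow> G i e \<in> hom_poly scl e"
    "\<And>i e. i \<in> A \<Longrightarrow> n i \<le> e \<Longrightarrow> G i e = 0" "\<And>i. i \<in> A \<Longrightarrow> g i = (\<Sum>e<n i. G i e)" by metis
  \<comment> \<open>A common bound for the finitely many lengths \<open>n i\<close>.\<close>
  define m where "m = (\<Sum>i\<in>A. n i)"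
  define G' where "G' e = (\<lambda>i. if i \<in> A then G i e else 0)" for e
  have G': "G' e \<in> carrier (prod_alg A (\<lambda>i. hom_poly scl e))" for e
    using G(1) by (simp add: prod_alg_def G'_def)
  then have G't: "G' e \<in> tuples" for e using hom_poly_subset[of scl e] by (auto simp: prod_alg_def)
  have "g = (\<Sum>e<m. G' e)"
  proof
    fix i
    show "g i = (\<Sum>e<m. G' e) i"
    proof (cases "i \<in> A")
      case True
      have "n i \<le> m" unfolding m_def using finite_A True by (intro member_le_sum) auto
      then have "(\<Sum>e<m. G i e) = g i"
        unfolding G(3)[OF True] using G(2)[OF True] by (intro sum.mono_neutral_right) auto
      then show ?thesis using True by (simp add: fun_sum_apply G'_def)
    next
      case False
      then show ?thesis using g(1) by (simp add: fun_sum_apply G'_def tuples_iff)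
    qed
  qed
  moreover have sum: "?\<psi> (\<Sum>e\<in>I. G' e) = (\<Sum>e\<in>I. ?\<psi> (G' e))" if "finite I" for I
    using that
    by induction (simp_all only: sum.empty sum.insert zero interpolate_add ext_deriv_add not_False_eq_True)
  ultimately have s: "s = (\<Sum>e<m. ?\<psi> (G' e))" by (simp add: g(2))
  let ?I = "(\<lambda>e. 2 * e + 1) ` {..<m}"
  let ?g = "\<lambda>r. ?\<psi> (G' (r div 2))"
  have "s = (\<Sum>r\<in>?I. ?g r)"
    unfolding s by (subst sum.reindex) (auto simp: inj_on_def)
  moreover have "cls (?g r) \<in> cohomology_deg Q d Q_dg r" if r': "r \<in> ?I" for r
  proof -
    obtain e where r: "r = 2 * e + 1" using r' by blast
    then have "r div 2 = e" by simp
    then show ?thesis using G'[of e] H_deg_odd[of e] r by (auto simp: H_deg_def)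
  qed
  ultimately show "\<exists>I g. finite I \<and> I \<subseteq> Collect odd \<and>
      (\<forall>r\<in>I. g r \<in> ?\<psi> ` tuples \<and> cls (g r) \<in> cohomology_deg Q d Q_dg r) \<and> s = (\<Sum>r\<in>I. g r)"
    using G't by (intro exI[of _ ?I] exI[of _ ?g]) auto
qed

text \<open>The spanning tuples are already closed under linear combinations, because
  \<open>f\<close> and \<open>h\<close> can be combined separately. So membership means a single
  pair.\<close>

lemma S_space_eq:
  "Sk = {(\<lambda>i. if i \<in> A then f i - h else 0) | f h. (\<forall>i\<in>A. f i \<in> Qi i) \<and> h \<in> P}" (is "_ = ?S")
proof -
  have "lin_sub (\<lambda>c f i v. c * f i v) ?S"
  proof (rule lin_subI)
    show "0 \<in> ?S"
      using lin_sub_zero[OF Qi_lin_sub] lin_sub_zero[OF lin_sub_poly_funs]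
      by (intro CollectI exI[of _ "\<lambda>_. 0"] exI[of _ 0]) (auto simp: fun_eq_iff)
    fix x assume "x \<in> ?S"
    then obtain f h where x: "x = (\<lambda>i. if i \<in> A then f i - h else 0)" "\<forall>i\<in>A. f i \<in> Qi i" "h \<in> P" by blast
    have "(\<lambda>i v. c * x i v) = (\<lambda>i. if i \<in> A then (\<lambda>v. c * f i v) - (\<lambda>v. c * h v) else 0)" for c
      by (auto simp: x(1) fun_eq_iff algebra_simps)
    then show "(\<lambda>i v. c * x i v) \<in> ?S" for c
      using x lin_sub_scale[OF Qi_lin_sub] lin_sub_scale[OF lin_sub_poly_funs]
      by (intro CollectI exI[of _ "\<lambda>i v. c * f i v"] exI[of _ "\<lambda>v. c * h v"]) auto
    fix y assume "y \<in> ?S"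
    then obtain f' h' where y: "y = (\<lambda>i. if i \<in> A then f' i - h' else 0)" "\<forall>i\<in>A. f' i \<in> Qi i" "h' \<in> P" by blast
    have "x - y = (\<lambda>i. if i \<in> A then (f i - f' i) - (h - h') else 0)"
      by (auto simp: x(1) y(1) fun_eq_iff algebra_simps)
    then show "x - y \<in> ?S"
      using x y lin_sub_diff[OF Qi_lin_sub] lin_sub_diff[OF lin_sub_poly_funs]
      by (intro CollectI exI[of _ "\<lambda>i. f i - f' i"] exI[of _ "h - h'"]) auto
  qed
  note V = this
  have "fun_tuples.subspace ?S"
    by (intro fun_tuples.subspaceI lin_sub_zero[OF V] lin_sub_add[OF V] lin_sub_scale[OF V])
  then show ?thesis unfolding S_space_def by (simp only: fun_tuples.span_eq_iff)
qed

lemma S_space_tuples: "Sk \<subseteq> tuples"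
proof -
  have *: "f i - h \<in> P" if "\<forall>i\<in>A. f i \<in> Qi i" "h \<in> P" "i \<in> A" for f h i
    using lin_sub_diff[OF lin_sub_poly_funs quasi_inv1_poly that(2), of "f i"] that by blast
  show ?thesis unfolding S_space_eq by (auto simp: tuples_iff intro: *)
qed

lemma S_space_lin_sub: "lin_sub (\<lambda>c f i v. c * f i v) Sk"
  unfolding S_space_def
  by (intro lin_subI fun_tuples.span_zero fun_tuples.span_diff fun_tuples.span_scale)

lemma lin_pres_tuples: "lin_pres (prod_alg A (\<lambda>i. P)) tuples {0} (\<lambda>c f i v. c * f i v) (\<lambda>x. x)"
proof
  show "lin_sub (\<lambda>c f i v. c * f i v) {0 :: 'i \<Rightarrow> 'v \<Rightarrow> 'k}" by (rule lin_subI) (auto simp: fun_eq_iff)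
qed (use lin_sub_zero[OF tuples_lin_sub] in \<open>auto simp: tuples_lin_sub, auto simp: prod_alg_def\<close>)

lemma lin_pres_coker:
  "lin_pres coker tuples Sk (\<lambda>c f i v. c * f i v)
    (\<lambda>x. Sk +>\<^bsub>prod_alg A (\<lambda>i. P)\<^esub> x)"
  unfolding coker_space_def
  by (rule lin_pres.quotient[OF lin_pres_tuples S_space_lin_sub _ S_space_tuples])
    (use lin_sub_zero[OF S_space_lin_sub] in \<open>auto simp: fun_eq_iff algebra_simps\<close>)

lemma ext_deriv_interpolate_B_iff:
  assumes g: "g \<in> tuples"
  shows "ext_deriv (interpolate g) \<in> B \<longleftrightarrow> g \<in> Sk"
proof
  assume "ext_deriv (interpolate g) \<in> B"
  then obtain \<eta> j where \<eta>: "\<eta> \<in> E" "j \<in> J" "ext_deriv (interpolate g) = ext_deriv \<eta> + j" unfolding B_def by blast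
  then have "interpolate g - \<eta> \<in> F" "ext_deriv (interpolate g - \<eta>) \<in> J"
    using F_interpolate[OF g] by (auto simp: F_diff E_F ext_deriv_diff)
  \<comment> \<open>The difference of the two primitives is closed modulo \<open>J\<close>, so up to
    an exact form it is a constant, and exact forms do not change vertex values.\<close>
  then obtain h \<eta>' where h: "h \<in> P" and j: "interpolate g - \<eta> - const_form h - ext_deriv \<eta>' \<in> J"
    using poincare[OF subspaces_P order_refl] by blast
  have "g - vertex_values \<eta> - vertex_values (const_form h) = 0"
    using vertex_values_J[OF j]
    by (simp add: vertex_values_diff vertex_values_ext_deriv vertex_values_interpolate[OF g])
  then have "g i = vertex_values \<eta> i - - h" if "i \<in> A" for i
    using that fun_cong[of "g - vertex_values \<eta> - vertex_values (const_form h)" 0 i]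
    by (simp add: vertex_values_const_form algebra_simps)
  \<comment> \<open>\<open>Sk\<close> subtracts its common function while \<open>h\<close> is added
    here, hence the double minus.\<close>
  then have "g = (\<lambda>i. if i \<in> A then vertex_values \<eta> i - - h else 0)"
    using g by (auto simp: tuples_iff fun_eq_iff)
  then show "g \<in> Sk"
    unfolding S_space_eq using \<eta>(1) lin_sub_uminus[OF lin_sub_poly_funs h] by (auto simp: E_def)
next
  assume "g \<in> Sk"
  then obtain f h where f: "g = (\<lambda>i. if i \<in> A then f i - h else 0)" "\<forall>i\<in>A. f i \<in> Qi i" "h \<in> P"
    unfolding S_space_eq by blast
  have "interpolate g + const_form h \<in> F" using f(3) by (intro F_add F_interpolate F_const_form g)
  moreover have "vertex_values (interpolate g + const_form h) i = f i" if "i \<in> A" for i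
    using that by (simp add: vertex_values_add vertex_values_interpolate[OF g] vertex_values_const_form)
      (simp add: f(1))
  ultimately have "interpolate g + const_form h \<in> E" using f(2) by (simp add: E_def)
  from ext_deriv_B[OF this] show "ext_deriv (interpolate g) \<in> B"
    by (simp add: ext_deriv_add ext_deriv_const_form)
qed

theorem odd_cohomology:
  "\<exists>\<phi>. linear_iso coker Hodd \<phi> \<and>
    (\<forall>e. \<phi> ` coker_deg scl A \<alpha> \<sigma> k e = H_dg (2 * e + 1))"
proof -
  let ?\<psi> = "\<lambda>g. ext_deriv (interpolate g)"
  \<comment> \<open>\<open>lin_pres.restrict\<close> needs representatives containing all of
    \<open>B\<close>. Adding \<open>B\<close> changes no class.\<close>
  let ?Z = "{?\<psi> g + b | g b. g \<in> tuples \<and> b \<in> B}"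
  have diff: "?\<psi> (g - g') = ?\<psi> g - ?\<psi> g'" for g g'
    using interpolate_add[of "g - g'" g'] by (simp add: ext_deriv_diff[symmetric] algebra_simps)
  have scale: "?\<psi> (\<lambda>i v. c * g i v) = cscale c (?\<psi> g)" if "g \<in> tuples" for c g
    using F_interpolate[OF that] by (simp add: ext_deriv_cscale interpolate_cscale)
  have zero: "?\<psi> 0 = 0" using diff[of 0 0] by simp
  have ZI: "?\<psi> g + b \<in> ?Z" if "g \<in> tuples" "b \<in> B" for g b using that by blast
  have B0: "0 \<in> B" by (rule lin_sub_zero[OF B_lin_sub])
  have Z: "lin_sub cscale ?Z"
  proof (rule lin_subI)
    show "0 \<in> ?Z" using ZI[OF lin_sub_zero[OF tuples_lin_sub] B0] by (simp only: zero add_0)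
    fix x c assume "x \<in> ?Z"
    then obtain g b where x: "x = ?\<psi> g + b" "g \<in> tuples" "b \<in> B" by blast
    then have "cscale c x = ?\<psi> (\<lambda>i v. c * g i v) + cscale c b" by (simp only: scale cscale_add)
    then show "cscale c x \<in> ?Z"
      using ZI[OF lin_sub_scale[OF tuples_lin_sub x(2)] lin_sub_scale[OF B_lin_sub x(3)]] by simp
    fix y assume "y \<in> ?Z"
    then obtain g' b' where y: "y = ?\<psi> g' + b'" "g' \<in> tuples" "b' \<in> B" by blast
    have "x - y = ?\<psi> (g - g') + (b - b')" unfolding diff by (simp add: x y)
    then show "x - y \<in> ?Z"
      using ZI[OF lin_sub_diff[OF tuples_lin_sub x(2) y(2)] lin_sub_diff[OF B_lin_sub x(3) y(3)]] by simp
  qed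
  have BZ: "B \<subseteq> ?Z" using ZI[OF lin_sub_zero[OF tuples_lin_sub]] by (auto simp only: zero add_0)
  have ZZ: "?Z \<subseteq> Z"
    using lin_sub_add[OF Z_lin_sub] ext_deriv_interpolate_Z B_Z by blast
  have "cls (?\<psi> g + b) = cls (?\<psi> g)" if "g \<in> tuples" "b \<in> B" for g b
    using that ZI[OF that] ZZ by (subst cls_eq_iff) (auto intro: ext_deriv_interpolate_Z)
  then have img: "cls ` ?Z = cls ` ?\<psi> ` tuples"
    using ZI[OF _ B0] by (auto simp: image_iff)
  have odd_eq: "Hodd = cohomology Q d\<lparr>carrier := cls ` ?Z\<rparr>"
    using carrier_H_odd unfolding img by (simp add: H_odd_def cohomology_part_def)
  have pres: "lin_pres Hodd ?Z B cscale cls"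
    unfolding odd_eq by (rule lin_pres.restrict[OF lin_pres_H Z BZ ZZ])
  have "\<exists>\<phi>. linear_iso coker Hodd \<phi> \<and>
      (\<forall>g\<in>tuples. \<phi> (Sk +>\<^bsub>prod_alg A (\<lambda>i. P)\<^esub> g) = cls (?\<psi> g))"
  proof (rule lin_pres.induced_linear_iso[OF lin_pres_coker pres])
    show "?\<psi> g \<in> ?Z" if "g \<in> tuples" for g using ZI[OF that B0] by simp
  qed (use scale ext_deriv_interpolate_B_iff img in \<open>auto simp: interpolate_add ext_deriv_add\<close>)
  then obtain \<phi> where \<phi>: "linear_iso coker Hodd \<phi>"
    "\<And>g. g \<in> tuples \<Longrightarrow> \<phi> (Sk +>\<^bsub>prod_alg A (\<lambda>i. P)\<^esub> g) = cls (?\<psi> g)" by blast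
  have "\<phi> ` coker_deg scl A \<alpha> \<sigma> k e = H_dg (2 * e + 1)" for e
  proof -
    have "carrier (prod_alg A (\<lambda>i. hom_poly scl e)) \<subseteq> tuples"
      using hom_poly_subset[of scl e] by (auto simp: prod_alg_def)
    moreover have "coker_deg scl A \<alpha> \<sigma> k e
        = (\<lambda>g. Sk +>\<^bsub>prod_alg A (\<lambda>i. P)\<^esub> g) ` carrier (prod_alg A (\<lambda>i. hom_poly scl e))"
      by (auto simp: coker_deg_def)
    ultimately show ?thesis
      unfolding H_deg_odd using \<phi>(2) by (simp add: image_image subset_iff cong: image_cong_simp)
  qed
  then show ?thesis using \<phi>(1) by blast
qed

end

lemma (in coxeter_reflection_rep) quasi_system: "quasi_system scl A \<alpha> \<sigma>"
proof (intro quasi_system.intro simplex.intro quasi_system_axioms.intro)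
  fix i assume i: "i \<in> A"
  show "linear_involution scl (\<alpha> i) (\<sigma> i)"
    using forms[OF i] reflections[OF i] by (simp add: linear_involution_def is_reflection_def)
qed (fact finite_index nonempty_index)+

subsection \<open>The reflection group \<open>\<int>/2 \<times> \<int>/2\<close>\<close>

text \<open>The product \<open>{1, s\<^sub>1} \<times> {1, s\<^sub>2}\<close>; an element is coded by the bit mask of its components.\<close>

definition klein :: "nat monoid" where
  "klein = \<lparr>carrier = {0, 1, 2, 3}, monoid.mult = xor, monoid.one = 0\<rparr>"

text \<open>The low bit of \<open>g\<close> is the sign change of the first coordinate, the next bit
  that of the second; 1 and 2 act as reflections and 3 as minus the identity.\<close>

definition klein_rep :: "nat \<Rightarrow> 'k::field_char_0 ^ 2 \<Rightarrow> 'k ^ 2" where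
  "klein_rep g = (\<lambda>v. \<chi> i. if odd (if i = 1 then g else g div 2) then - (v $ i) else v $ i)"

lemma klein_simps:
  "carrier klein = {0, 1, 2, 3}" "x \<otimes>\<^bsub>klein\<^esub> y = xor x y" "\<one>\<^bsub>klein\<^esub> = 0"
  by (simp_all add: klein_def)

lemma group_klein: "group klein"
proof (rule groupI)
  show "x \<otimes>\<^bsub>klein\<^esub> y \<in> carrier klein" if "x \<in> carrier klein" "y \<in> carrier klein" for x y
    using that by (auto simp: klein_simps)
  show "\<exists>y\<in>carrier klein. y \<otimes>\<^bsub>klein\<^esub> x = \<one>\<^bsub>klein\<^esub>" if "x \<in> carrier klein" for x
    using that by (intro bexI[of _ x]) (auto simp: klein_simps)
qed (auto simp: klein_simps xor.assoc)

text \<open>These are the products of two generators: equal ones give 0, different ones give 3. The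
  orders are the exponents in the Coxeter relations.\<close>

lemma klein_ord: "group.ord klein 0 = 1" "group.ord klein 3 = 2"
proof -
  interpret group klein by (rule group_klein)
  show "ord 0 = 1" using ord_id by (simp add: klein_simps)
  have "3 [^]\<^bsub>klein\<^esub> n = (if even n then 0 else 3)" for n :: nat
    by (induction n) (auto simp: klein_simps)
  then show "ord 3 = 2" by (subst ord_unique) (auto simp: klein_simps)
qed

lemma coxeter_equiv_Cons: "coxeter_equiv G S u v \<Longrightarrow> s \<in> S \<Longrightarrow> coxeter_equiv G S (s # u) (s # v)"
proof (induction rule: coxeter_equiv.induct)
  case (relation x y u v)
  then show ?case using coxeter_equiv.relation[of x S y "s # u" v G] by simp
next
  case (refl u)
  then show ?case by (intro coxeter_equiv.refl) auto
qed (auto intro: coxeter_equiv.sym coxeter_equiv.trans)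

abbreviation klein_equiv :: "nat list \<Rightarrow> nat list \<Rightarrow> bool" where
  "klein_equiv \<equiv> coxeter_equiv klein {1, 2}"

lemma klein_cancel:
  "s \<in> {1, 2} \<Longrightarrow> v \<in> lists {1, 2} \<Longrightarrow> klein_equiv (s # s # v) v"
  using coxeter_equiv.relation[of s "{1, 2}" s "[]" v klein]
  by (auto simp: klein_simps klein_ord[simplified])

text \<open>The word \<open>1 1 2 1 2 2 v\<close> reduces in two ways: deleting the inner
  \<open>1 2 1 2\<close> leaves \<open>1 2 v\<close>, and cancelling the squares at both ends leaves
  \<open>2 1 v\<close>.\<close>

lemma klein_commute:
  assumes v: "v \<in> lists {1, 2}"
  shows "klein_equiv (2 # 1 # v) (1 # 2 # v)"
proof -
  note trans = coxeter_equiv.trans and sym = coxeter_equiv.sym and Cons = coxeter_equiv_Cons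
  have r: "replicate 2 x = [x, x]" for x :: "nat list" by (simp add: numeral_2_eq_2)
  have "klein_equiv (1 # 2 # 1 # 2 # 2 # v) (2 # v)"
    using coxeter_equiv.relation[of 1 "{1, 2}" 2 "[]" "2 # v" klein] v
    by (simp add: klein_simps klein_ord r del: One_nat_def)
  then have "klein_equiv (1 # 1 # 2 # 1 # 2 # 2 # v) (1 # 2 # v)" by (rule Cons) simp
  moreover have "klein_equiv (1 # 1 # 2 # 1 # 2 # 2 # v) (1 # 1 # 2 # 1 # v)"
    by (intro Cons klein_cancel v) auto
  moreover have "klein_equiv (1 # 1 # 2 # 1 # v) (2 # 1 # v)" using v by (intro klein_cancel) auto
  ultimately show ?thesis by (blast intro: trans sym)
qed

definition klein_word :: "nat \<Rightarrow> nat list" where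
  "klein_word g = (if g = 0 then [] else if g = 1 then [1] else if g = 2 then [2] else [1, 2])"

lemma klein_word_simps:
  "klein_word 0 = []" "klein_word 1 = [1]" "klein_word 2 = [2]" "klein_word 3 = [1, 2]"
  by (simp_all add: klein_word_def)

lemma klein_word_step:
  assumes "s \<in> {1, 2}" "g \<in> {0, 1, 2, 3}"
  shows "klein_equiv (s # klein_word g) (klein_word (xor s g))"
proof -
  have "klein_equiv [1] [1]" "klein_equiv [2] [2]" "klein_equiv [1, 2] [1, 2]"
    by (rule coxeter_equiv.refl; simp)+
  moreover have c: "klein_equiv [1, 1] []" "klein_equiv [1, 1, 2] [2]" "klein_equiv [2, 2] []"
    by (rule klein_cancel; simp)+
  moreover have "klein_equiv [2, 1] [1, 2]" by (rule klein_commute) simp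
  moreover have "klein_equiv [2, 1, 2] [1]"
    by (rule coxeter_equiv.trans[OF klein_commute coxeter_equiv_Cons[OF c(3)]]) simp_all
  ultimately show ?thesis
    using assms by (elim insertE emptyE) (simp_all add: klein_word_simps del: One_nat_def)
qed

text \<open>The word is absorbed letter by letter into the normal form of its tail. Words with the
  same product thus share a normal form, which is the presentation property.\<close>

lemma klein_normal_form:
  "w \<in> lists {1, 2} \<Longrightarrow> foldr xor w 0 \<in> {0, 1, 2, 3} \<and> klein_equiv w (klein_word (foldr xor w 0))"
proof (induction w)
  case Nil
  then show ?case by (simp add: klein_word_def coxeter_equiv.refl)
next
  case (Cons s w)
  let ?g = "foldr xor w 0"
  have s: "s \<in> {1, 2}" and g: "?g \<in> {0, 1, 2, 3}" using Cons by auto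
  have "klein_equiv (s # w) (s # klein_word ?g)"
    using Cons s by (intro coxeter_equiv_Cons) auto
  moreover have "klein_equiv (s # klein_word ?g) (klein_word (xor s ?g))"
    by (rule klein_word_step[OF s g])
  moreover have "xor s ?g \<in> {0, 1, 2, 3}" using s g by auto
  ultimately show ?case using coxeter_equiv.trans by (simp only: foldr.simps o_apply) blast
qed

lemma coxeter_system_klein: "coxeter_system klein {1, 2}"
proof -
  interpret group klein by (rule group_klein)
  show ?thesis
  proof
    show "generate klein {1, 2} = carrier klein"
    proof
      show "generate klein {1, 2} \<subseteq> carrier klein"
        by (rule generate_incl) (auto simp: klein_simps)
      have "1 \<otimes>\<^bsub>klein\<^esub> 2 \<in> generate klein {1, 2}"
        by (intro generate.eng generate.incl) auto
      then show "carrier klein \<subseteq> generate klein {1, 2}"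
        using generate.one[of klein "{1, 2}"] by (auto simp: klein_simps intro: generate.incl)
    qed
    fix u v :: "nat list"
    assume "u \<in> lists {1, 2}" "v \<in> lists {1, 2}" "foldr (\<otimes>\<^bsub>klein\<^esub>) u \<one>\<^bsub>klein\<^esub> = foldr (\<otimes>\<^bsub>klein\<^esub>) v \<one>\<^bsub>klein\<^esub>"
    then have "foldr xor u 0 = foldr xor v 0" and u: "klein_equiv u (klein_word (foldr xor u 0))"
      and v: "klein_equiv v (klein_word (foldr xor v 0))"
      using klein_normal_form[of u] klein_normal_form[of v] by (simp_all add: klein_def)
    then show "coxeter_equiv klein {1, 2} u v"
      using coxeter_equiv.trans[OF u coxeter_equiv.sym[OF v[folded \<open>foldr xor u 0 = foldr xor v 0\<close>]]] by simp
  qed (auto simp: klein_simps)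
qed

section \<open>The action on the plane and its two hyperplanes\<close>

lemma klein_rep_linear: "Vector_Spaces.linear (*s) (*s) (klein_rep g)"
  by (auto simp: Vector_Spaces.linear_iff vec.vector_space_axioms klein_rep_def vec_eq_iff)

lemma linear_form_nth: "linear_form (*s) (\<lambda>v. v $ i)"
  by (auto simp: linear_form_def Vector_Spaces.linear_iff vec.vector_space_axioms
      vector_space_over_itself.vector_space_axioms)

lemma klein_rep_nth:
  "klein_rep g v $ 1 = (if odd g then - (v $ 1) else v $ 1)"
  "klein_rep g v $ 2 = (if odd (g div 2) then - (v $ 2) else v $ 2)"
  by (simp_all add: klein_rep_def)

lemma eq_neg_iff: "(x :: 'k::field_char_0) = - x \<longleftrightarrow> x = 0" "- x = x \<longleftrightarrow> x = 0"
proof -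
  have "x + x = 0 \<longleftrightarrow> x = 0" by (metis mult_2 mult_eq_0_iff zero_neq_numeral)
  then show "x = - x \<longleftrightarrow> x = 0" "- x = x \<longleftrightarrow> x = 0" by (auto simp: eq_neg_iff_add_eq_0 neg_eq_iff_add_eq_0)
qed

lemma klein_fixed_space:
  "fixed_space (klein_rep 1) = ker_form (\<lambda>v. v $ 1)" "fixed_space (klein_rep 2) = ker_form (\<lambda>v. v $ 2)"
  "fixed_space (klein_rep 0 :: 'k::field_char_0 ^ 2 \<Rightarrow> _) = UNIV"
  "fixed_space (klein_rep 3 :: 'k::field_char_0 ^ 2 \<Rightarrow> _) = {0}"
  by (auto simp: fixed_space_def ker_form_def vec_eq_iff forall_2 klein_rep_nth eq_neg_iff)

lemma klein_rep_mult:
  "klein_rep (xor g h) = klein_rep g \<circ> klein_rep h"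
proof -
  have "xor g h div 2 = xor (g div 2) (h div 2)"
    using drop_bit_xor[of 1 g h] by (simp add: drop_bit_eq_div)
  then show ?thesis
    by (auto simp: fun_eq_iff vec_eq_iff forall_2 klein_rep_nth even_xor_iff)
qed

lemma klein_reflection:
  assumes "g \<in> {0, 1, 2, 3}"
  shows "is_reflection (*s) (klein_rep g :: 'k::field_char_0 ^ 2 \<Rightarrow> _) \<longleftrightarrow> g \<in> {1, 2}"
proof
  assume "is_reflection (*s) (klein_rep g :: 'k ^ 2 \<Rightarrow> _)"
  then obtain l :: "'k ^ 2 \<Rightarrow> 'k"
    where l: "linear_form (*s) l" "l \<noteq> 0" "fixed_space (klein_rep g) = ker_form l"
    unfolding is_reflection_def by blast
  have "g \<noteq> 0"
  proof
    assume "g = 0"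
    then have "l v = 0" for v using l(3) by (auto simp: klein_fixed_space ker_form_def)
    then show False using l(2) by (auto simp: fun_eq_iff)
  qed
  moreover have "g \<noteq> 3"
  proof
    assume "g = 3"
    then have ker: "v = 0" if "l v = 0" for v using l(3) that by (auto simp: klein_fixed_space ker_form_def)
    let ?e = "\<lambda>i. axis i 1 :: 'k ^ 2"
    have add: "l (x + y) = l x + l y" and sc: "l (c *s x) = c * l x" for x y c
      using l(1) by (simp_all add: linear_form_def Vector_Spaces.linear_iff)
    \<comment> \<open>In dimension two this explicit vector always lies in the kernel of
      \<open>l\<close>. The element 3 fixes only 0, so the vector, then a basis vector, would have
      to vanish.\<close>
    have "l (l (?e 2) *s ?e 1 + (- l (?e 1)) *s ?e 2) = 0" by (simp only: add sc) simp
    then have z: "l (?e 2) *s ?e 1 + (- l (?e 1)) *s ?e 2 = 0" by (rule ker)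
    have "l (?e 2) = 0" using arg_cong[OF z, of "\<lambda>v. v $ 1"] by (simp add: axis_def)
    then have "?e 2 = 0" by (rule ker)
    then show False by (simp add: axis_eq_0_iff)
  qed
  ultimately show "g \<in> {1, 2}" using assms by auto
next
  assume g: "g \<in> {1, 2}"
  have inv: "klein_rep g \<circ> klein_rep g = (id :: 'k ^ 2 \<Rightarrow> _)"
    by (auto simp: fun_eq_iff vec_eq_iff forall_2 klein_rep_nth)
  have nz: "(\<lambda>v. v $ i) \<noteq> (0 :: 'k ^ 2 \<Rightarrow> 'k)" for i
    using fun_cong[of "\<lambda>v. v $ i" "0 :: 'k ^ 2 \<Rightarrow> 'k" "axis i 1"] by (auto simp: axis_def)
  from g show "is_reflection (*s) (klein_rep g :: 'k ^ 2 \<Rightarrow> _)"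
    unfolding is_reflection_def using klein_rep_linear inv linear_form_nth nz klein_fixed_space(1,2) by blast
qed

text \<open>Indices start at 0 while the reflections are coded by 1 and 2; hence index i goes with
  \<open>klein_rep (Suc i)\<close>.\<close>

definition klein_form :: "nat \<Rightarrow> 'k::field_char_0 ^ 2 \<Rightarrow> 'k" where
  "klein_form i = (\<lambda>v. v $ (if i = 0 then 1 else 2))"

lemma klein_hyperplanes:
  "reflection_hyperplanes (*s) klein (klein_rep :: nat \<Rightarrow> 'k::field_char_0 ^ 2 \<Rightarrow> _)
    = {ker_form (klein_form 0), ker_form (klein_form 1)}"
proof -
  have "reflection_hyperplanes (*s) klein (klein_rep :: nat \<Rightarrow> 'k ^ 2 \<Rightarrow> _) = (\<lambda>g. fixed_space (klein_rep g)) ` {1, 2}"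
  proof -
    have "g \<in> carrier klein \<and> is_reflection (*s) (klein_rep g :: 'k ^ 2 \<Rightarrow> _) \<longleftrightarrow> g \<in> {1, 2}" for g
    proof (cases "g \<in> {0, 1, 2, 3}")
      case True
      then show ?thesis by (simp only: klein_simps klein_reflection[OF True] simp_thms)
    next
      case False
      then show ?thesis by (auto simp: klein_simps)
    qed
    then show ?thesis unfolding reflection_hyperplanes_def by (simp only:) blast
  qed
  then show ?thesis by (simp add: klein_fixed_space klein_form_def del: One_nat_def)
qed

lemma coxeter_reflection_rep_klein:
  "coxeter_reflection_rep ((*s) :: 'k::field_char_0 \<Rightarrow> 'k ^ 2 \<Rightarrow> _) klein {1, 2} klein_rep {0, 1 :: nat}
    klein_form (\<lambda>i. klein_rep (Suc i))"
proof (intro coxeter_reflection_rep.intro vec.vector_space_axioms coxeter_system_klein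
    coxeter_reflection_rep_axioms.intro)
  have ne: "ker_form (klein_form 0) \<noteq> ker_form (klein_form 1 :: 'k ^ 2 \<Rightarrow> 'k)"
  proof
    assume "ker_form (klein_form 0) = ker_form (klein_form 1 :: 'k ^ 2 \<Rightarrow> 'k)"
    then have "axis 1 1 \<in> ker_form (klein_form 0 :: 'k ^ 2 \<Rightarrow> 'k)" by (simp add: ker_form_def klein_form_def axis_def)
    then show False by (simp add: ker_form_def klein_form_def axis_def)
  qed
  then show "bij_betw (\<lambda>i. ker_form (klein_form i)) {0, 1 :: nat}
      (reflection_hyperplanes (*s) klein (klein_rep :: nat \<Rightarrow> 'k ^ 2 \<Rightarrow> _))"
    by (simp add: klein_hyperplanes bij_betw_def)
  show "\<exists>C :: ('k ^ 2) set. finite C \<and> vec.span C = UNIV"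
    using finite_cart_basis span_cart_basis by blast
  show "klein_rep \<one>\<^bsub>klein\<^esub> = (id :: 'k ^ 2 \<Rightarrow> _)"
    by (auto simp: klein_simps fun_eq_iff vec_eq_iff forall_2 klein_rep_nth)
  show "inj_on (klein_rep :: nat \<Rightarrow> 'k ^ 2 \<Rightarrow> _) (carrier klein)"
  proof (rule inj_onI)
    fix g h assume gh: "g \<in> carrier klein" "h \<in> carrier klein" "klein_rep g = (klein_rep h :: 'k ^ 2 \<Rightarrow> _)"
    then have "klein_rep g (1 :: 'k ^ 2) $ i = klein_rep h 1 $ i" for i by simp
    from this[of 1] this[of 2] show "g = h"
      using gh(1,2) by (auto simp: klein_simps klein_rep_nth eq_neg_iff)
  qed
  fix s :: nat assume "s \<in> {1, 2}"
  then show "is_reflection (*s) (klein_rep s :: 'k ^ 2 \<Rightarrow> _)" using klein_reflection[of s] by auto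
next
  fix i :: nat assume i: "i \<in> {0, 1}"
  show "linear_form (*s) (klein_form i :: 'k ^ 2 \<Rightarrow> 'k)" unfolding klein_form_def by (rule linear_form_nth)
  show "is_reflection (*s) (klein_rep (Suc i) :: 'k ^ 2 \<Rightarrow> _)" using klein_reflection[of "Suc i"] i by auto
  show "(klein_rep (Suc i) :: 'k ^ 2 \<Rightarrow> _) \<in> klein_rep ` carrier klein"
    using i by (intro imageI) (auto simp: klein_simps)
  show "fixed_space (klein_rep (Suc i)) = ker_form (klein_form i :: 'k ^ 2 \<Rightarrow> 'k)"
    using i by (auto simp: klein_form_def klein_fixed_space[simplified] numeral_2_eq_2[symmetric])
qed (auto simp: klein_simps klein_rep_linear klein_rep_mult)

text \<open>Restricted to the line, \<open>f\<close> is a polynomial in t, and the field is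
  infinite. The lemma recovers the value at the origin after an identity has been divided by a power
  of t.\<close>

lemma poly_funs_const_on_line:
  fixes f :: "'v::ab_group_add \<Rightarrow> 'k::field_char_0"
  assumes f: "f \<in> poly_funs scl" and c: "\<And>t. t \<noteq> 0 \<Longrightarrow> f (scl t v) = c"
  shows "f (scl 0 v) = c"
proof -
  obtain F n where F: "\<And>d. F d \<in> hom_poly scl d" "f = (\<Sum>d<n. F d)"
    using poly_funs_decomp[OF f] by metis
  define p where "p = (\<Sum>d<n. Polynomial.monom (F d v) d) - [:c:]"
  have p: "poly p t = f (scl t v) - c" for t
    by (simp add: p_def F(2) fun_sum_apply poly_sum poly_monom hom_poly_scale[OF F(1)] mult.commute)
  have "p = 0"
  proof (rule ccontr)
    assume "p \<noteq> 0"
    then have "finite {t. poly p t = 0}" by (rule poly_roots_finite)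
    moreover have "UNIV - {0} \<subseteq> {t. poly p t = 0}" using c by (auto simp: p)
    ultimately have "finite (UNIV :: 'k set)" by (metis finite_Diff2 finite.emptyI finite_insert finite_subset)
    then show False using infinite_UNIV_char_0 by blast
  qed
  then show ?thesis using p[of 0] by simp
qed

text \<open>The alternating sum over the group multiplies \<open>x\<^sub>1 x\<^sub>2\<close> by \<open>4\<close> and maps \<open>Q\<^sub>\<alpha>\<close> (for \<open>k\<^sub>\<alpha> = 1\<close>) into
  \<open>\<langle>\<alpha>\<^sup>2\<rangle>\<close>, but \<open>4 x\<^sub>1 x\<^sub>2\<close> is not in \<open>\<langle>x\<^sub>1\<^sup>2, x\<^sub>2\<^sup>2\<rangle>\<close>.\<close>

lemma klein_product_not_in_sum:
  fixes f g :: "'k::field_char_0 ^ 2 \<Rightarrow> 'k"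
  assumes f: "f \<in> quasi_inv1 (*s) (klein_form 0) (klein_rep 1) 1"
    and g: "g \<in> quasi_inv1 (*s) (klein_form 1) (klein_rep 2) 1"
  shows "(\<lambda>v. v $ 1 * v $ 2) \<noteq> f - g"
proof
  assume fg: "(\<lambda>v. v $ 1 * v $ 2) = f - g"
  let ?s = "klein_rep 1 :: 'k ^ 2 \<Rightarrow> 'k ^ 2" and ?t = "klein_rep 2 :: 'k ^ 2 \<Rightarrow> 'k ^ 2"
  have inv: "?s \<circ> ?s = id" "?t \<circ> ?t = id"
    by (auto simp: fun_eq_iff vec_eq_iff forall_2 klein_rep_nth)
  interpret s: linear_involution "(*s)" "klein_form 0 :: 'k ^ 2 \<Rightarrow> 'k" ?s
    by (rule linear_involution.intro[OF _ klein_rep_linear inv(1)]) (simp add: klein_form_def linear_form_nth)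
  interpret t: linear_involution "(*s)" "klein_form 1 :: 'k ^ 2 \<Rightarrow> 'k" ?t
    by (rule linear_involution.intro[OF _ klein_rep_linear inv(2)]) (simp add: klein_form_def linear_form_nth)
  obtain u where u: "u \<in> poly_funs (*s)" "(f \<circ> ?s) - f = klein_form 0 ^ (2 * 1) * u"
    using f unfolding s.quasi_inv1_iff by blast
  obtain w where w: "w \<in> poly_funs (*s)" "(g \<circ> ?t) - g = klein_form 1 ^ (2 * 1) * w"
    using g unfolding t.quasi_inv1_iff by blast
  have f': "f (?s v) - f v = v $ 1 * v $ 1 * u v" and g': "g (?t v) - g v = v $ 2 * v $ 2 * w v" for v
    using fun_cong[OF u(2), of v] fun_cong[OF w(2), of v] by (auto simp: klein_form_def power2_eq_square)
  define a where "a = (u \<circ> ?t) - u"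
  define b where "b = (w \<circ> ?s) - w"
  have ab: "a \<in> poly_funs (*s)" "b \<in> poly_funs (*s)"
    unfolding a_def b_def
    by (intro funs.subspace_diff[OF subspace_poly_funs] poly_funs_comp[OF klein_rep_linear] u(1) w(1))+
  have comm: "?s (?t v) = ?t (?s v)" for v
    by (auto simp: vec_eq_iff forall_2 klein_rep_nth)
  \<comment> \<open>\<open>a\<close> and \<open>b\<close> are what remains of the cofactors after
    the second difference: f is differenced by the first reflection and then the second, g in the
    opposite order. Each reflection preserves the square of the coordinate belonging to the
    other.\<close>
  have id: "4 * (v $ 1 * v $ 2) = v $ 1 * v $ 1 * a v - v $ 2 * v $ 2 * b v" for v
  proof -
    have p: "x $ 1 * x $ 2 = f x - g x" for x using fun_cong[OF fg, of x] by simp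
    have sx: "?s v $ 1 = - (v $ 1)" "?s v $ 2 = v $ 2" "?t v $ 1 = v $ 1" "?t v $ 2 = - (v $ 2)"
      by (simp_all add: klein_rep_nth)
    have "4 * (v $ 1 * v $ 2) = v $ 1 * v $ 2 - ?s v $ 1 * ?s v $ 2 - ?t v $ 1 * ?t v $ 2
        + ?s (?t v) $ 1 * ?s (?t v) $ 2"
      by (simp add: klein_rep_nth)
    also have "\<dots> = (f (?s (?t v)) - f (?t v)) - (f (?s v) - f v) - ((g (?t (?s v)) - g (?s v)) - (g (?t v) - g v))"
      unfolding p by (simp add: comm del: One_nat_def)
    also have "\<dots> = v $ 1 * v $ 1 * a v - v $ 2 * v $ 2 * b v"
      unfolding f' g' sx by (simp add: a_def b_def algebra_simps)
    finally show ?thesis .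
  qed
  have a0: "a 0 = 0"
  proof -
    \<comment> \<open>On the first axis the second coordinate is 0, so only the term with
      \<open>a\<close> survives.\<close>
    have "a (t *s axis 1 1) = 0" if "t \<noteq> 0" for t
      using id[of "t *s axis 1 1"] that by (simp add: axis_def)
    from poly_funs_const_on_line[OF ab(1) this] show ?thesis by simp
  qed
  have b0: "b 0 = 0"
  proof -
    have "b (t *s axis 2 1) = 0" if "t \<noteq> 0" for t
      using id[of "t *s axis 2 1"] that by (simp add: axis_def)
    from poly_funs_const_on_line[OF ab(2) this] show ?thesis by simp
  qed
  \<comment> \<open>On the diagonal both squares and the product equal the square of t, so
    \<open>a - b\<close> is 4 away from the origin and hence at it, although both vanish
    there.\<close>
  have "(a - b) (t *s 1) = 4" if "t \<noteq> 0" for t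
  proof -
    have "t * t * (a (t *s 1) - b (t *s 1)) = t * t * 4"
      using id[of "t *s 1"] by (simp add: algebra_simps)
    then show ?thesis using that by simp
  qed
  from poly_funs_const_on_line[OF funs.subspace_diff[OF subspace_poly_funs ab] this]
  show False using a0 b0 by simp
qed

text \<open>For two hyperplanes the common function cancels in the difference of the two components,
  so a tuple in \<open>Sk\<close> has its difference in the sum of the two spaces of
  quasi-invariants. The tuple with entries \<open>v $ 1 * v $ 2\<close> and 0 violates this, so the
  cokernel is nonzero.\<close>

lemma klein_odd_cohomology:
  "carrier (H_odd ((*s) :: 'k::field_char_0 \<Rightarrow> 'k ^ 2 \<Rightarrow> _) {0, 1 :: nat} klein_form (\<lambda>i. klein_rep (Suc i)) (\<lambda>_. 1))
    \<noteq> {\<zero>\<^bsub>H_odd ((*s) :: 'k \<Rightarrow> 'k ^ 2 \<Rightarrow> _) {0, 1 :: nat} klein_form (\<lambda>i. klein_rep (Suc i)) (\<lambda>_. 1)\<^esub>}"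
proof
  let ?scl = "(*s) :: 'k \<Rightarrow> 'k ^ 2 \<Rightarrow> _"
  let ?\<sigma> = "\<lambda>i. klein_rep (Suc i) :: 'k ^ 2 \<Rightarrow> _"
  let ?k = "\<lambda>_ :: nat. 1 :: nat"
  let ?H = "H_odd ?scl {0, 1 :: nat} klein_form ?\<sigma> ?k"
  assume H: "carrier ?H = {\<zero>\<^bsub>?H\<^esub>}"
  interpret quasi_system ?scl "{0, 1 :: nat}" klein_form ?\<sigma> ?k
    by (rule coxeter_reflection_rep.quasi_system[OF coxeter_reflection_rep_klein])
  interpret C: lin_pres "coker_space ?scl {0, 1} klein_form ?\<sigma> ?k" tuples "S_space ?scl {0, 1} klein_form ?\<sigma> ?k"
      "\<lambda>c f i v. c * f i v" "\<lambda>x. S_space ?scl {0, 1} klein_form ?\<sigma> ?k +>\<^bsub>prod_alg {0, 1} (\<lambda>i. P)\<^esub> x"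
    by (rule lin_pres_coker)
  define g where "g = (\<lambda>i :: nat. if i = 0 then (\<lambda>v :: 'k ^ 2. v $ 1 * v $ 2) else 0)"
  have "(\<lambda>v. v $ 1) * (\<lambda>v. v $ 2) \<in> P"
    by (intro poly_funs_mult linear_form_poly_funs linear_form_nth)
  then have g: "g \<in> tuples"
    using lin_sub_zero[OF lin_sub_poly_funs[of ?scl]] unfolding tuples_iff g_def times_fun_def by simp
  have 0: "0 \<in> tuples" by (rule lin_sub_zero[OF tuples_lin_sub])
  obtain \<phi> where "linear_iso coker ?H \<phi>"
    using odd_cohomology by blast
  then have bij: "bij_betw \<phi> (carrier coker) (carrier ?H)"
    by (simp add: linear_iso_def)
  let ?c = "\<lambda>x. S_space ?scl {0, 1} klein_form ?\<sigma> ?k +>\<^bsub>prod_alg {0, 1} (\<lambda>i. P)\<^esub> x"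
  have mem: "?c g \<in> carrier (coker)"
    "?c 0 \<in> carrier (coker)"
    unfolding C.carrier using g 0 by (auto intro: imageI)
  have "\<phi> (?c g) = \<phi> (?c 0)"
    using bij_betwE[OF bij] mem unfolding H by (metis singletonD)
  then have "?c g = ?c 0" using bij mem by (meson bij_betw_imp_inj_on inj_onD)
  then have "g \<in> Sk" using C.eq_iff[OF g 0] by simp
  then obtain f h where fh: "g = (\<lambda>i. if i \<in> {0, 1} then f i - h else 0)"
      "\<forall>i\<in>{0, 1}. f i \<in> quasi_inv1 ?scl (klein_form i) (?\<sigma> i) (?k i)"
    unfolding S_space_eq by blast
  have "(\<lambda>v. v $ 1 * v $ 2) = f 0 - h" "0 = f 1 - h"
    using fun_cong[OF fh(1), of 0] fun_cong[OF fh(1), of 1] by (simp_all add: g_def)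
  then have "(\<lambda>v. v $ 1 * v $ 2) = f 0 - f 1" by simp
  moreover have "f 0 \<in> quasi_inv1 ?scl (klein_form 0) (klein_rep 1) 1"
    "f 1 \<in> quasi_inv1 ?scl (klein_form 1) (klein_rep 2) 1"
    using fh(2) by (simp_all add: numeral_2_eq_2)
  ultimately show False using klein_product_not_in_sum by blast
qed

theorem theorem3p8:
  shows
    "(\<forall>(scl :: 'k::field_char_0 \<Rightarrow> 'v::ab_group_add \<Rightarrow> 'v) (G :: ('g, 'h) monoid_scheme) S \<rho>
        (A :: 'i::linorder set) \<alpha> \<sigma> k.
        coxeter_reflection_rep scl G S \<rho> A \<alpha> \<sigma> \<and> invariant_multiplicity G \<rho> A \<alpha> k \<longrightarrow>
          algebra_iso (quasi_inv scl A \<alpha> \<sigma> k) (H_ev scl A \<alpha> \<sigma> k) (Q_to_H scl A \<alpha> \<sigma> k) \<and>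
          (\<forall>d. Q_to_H scl A \<alpha> \<sigma> k ` (carrier (quasi_inv scl A \<alpha> \<sigma> k) \<inter> hom_poly scl d)
                 = H_deg scl A \<alpha> \<sigma> k (2 * d)) \<and>
          (\<exists>\<phi>. linear_iso (coker_space scl A \<alpha> \<sigma> k) (H_odd scl A \<alpha> \<sigma> k) \<phi> \<and>
            (\<forall>d. \<phi> ` coker_deg scl A \<alpha> \<sigma> k d = H_deg scl A \<alpha> \<sigma> k (2 * d + 1))))
     \<and> (\<exists>(G :: nat monoid) S \<rho> (A :: nat set) \<alpha> \<sigma> k.
          coxeter_reflection_rep ((*s) :: 'k \<Rightarrow> 'k ^ 2 \<Rightarrow> 'k ^ 2) G S \<rho> A \<alpha> \<sigma> \<and>
          invariant_multiplicity G \<rho> A \<alpha> k \<and>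
          carrier (H_odd (*s) A \<alpha> \<sigma> k) \<noteq> {\<zero>\<^bsub>H_odd (*s) A \<alpha> \<sigma> k\<^esub>})"
proof (intro conjI allI impI)
  fix scl :: "'k \<Rightarrow> 'v \<Rightarrow> 'v" and G :: "('g, 'h) monoid_scheme" and S \<rho> and A :: "'i set" and \<alpha> \<sigma> k
  assume "coxeter_reflection_rep scl G S \<rho> A \<alpha> \<sigma> \<and> invariant_multiplicity G \<rho> A \<alpha> k"
  then interpret quasi_system scl A \<alpha> \<sigma> k
    by (intro coxeter_reflection_rep.quasi_system) blast
  show "algebra_iso (quasi_inv scl A \<alpha> \<sigma> k) (H_ev scl A \<alpha> \<sigma> k) (Q_to_H scl A \<alpha> \<sigma> k)"
    by (rule even_cohomology)
  show "Q_to_H scl A \<alpha> \<sigma> k ` (carrier (quasi_inv scl A \<alpha> \<sigma> k) \<inter> hom_poly scl d) = H_deg scl A \<alpha> \<sigma> k (2 * d)" for d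
    unfolding H_deg_even image_image Q_to_H_eq ..
  show "\<exists>\<phi>. linear_iso (coker_space scl A \<alpha> \<sigma> k) (H_odd scl A \<alpha> \<sigma> k) \<phi> \<and>
      (\<forall>d. \<phi> ` coker_deg scl A \<alpha> \<sigma> k d = H_deg scl A \<alpha> \<sigma> k (2 * d + 1))"
    by (rule odd_cohomology)
next
  show "\<exists>(G :: nat monoid) S \<rho> (A :: nat set) \<alpha> \<sigma> k.
      coxeter_reflection_rep ((*s) :: 'k \<Rightarrow> 'k ^ 2 \<Rightarrow> 'k ^ 2) G S \<rho> A \<alpha> \<sigma> \<and>
      invariant_multiplicity G \<rho> A \<alpha> k \<and>
      carrier (H_odd (*s) A \<alpha> \<sigma> k) \<noteq> {\<zero>\<^bsub>H_odd (*s) A \<alpha> \<sigma> k\<^esub>}"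
  proof (intro exI conjI)
    show "invariant_multiplicity klein klein_rep {0, 1 :: nat} (klein_form :: nat \<Rightarrow> 'k ^ 2 \<Rightarrow> 'k) (\<lambda>_. 1)"
      by (simp add: invariant_multiplicity_def)
  qed (rule coxeter_reflection_rep_klein klein_odd_cohomology)+
qed

end
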